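(* Let $W$ be an irreducible affine Coxeter group. Then $W$ is first-order rigid; that is, whenever $H$ is a finitely generated group that is elementarily equivalent to $W$ (in the language of groups), one has $H\cong W$.
   Context: A Coxeter matrix on a set $S$ is a map $m:S\times S\to\{1,2,\dots,\infty\}$ with $m(s,s')=m(s',s)$ and $m(s,s')=1\Leftrightarrow s=s'$. It determines the Coxeter group $W$ with generators $S$ and relations $(ss')^{m(s,s')}=e$ for all $(s,s')$ with $m(s,s')<\infty$; $(W,S)$ is called a Coxeter system. Its Coxeter diagram is the graph on $S$ in which $s,s'$ are adjacent iff $m(s,s')\geq 3$ (edges labeled by $m(s,s')$), and $(W,S)$ is irreducible if this diagram is connected. A Coxeter group is affine if it is infinite and has a representation as a discrete affine reflection group, i.e., as a discrete group of isometries of a finite-dimensional Euclidean space generated by affine reflections. The irreducible affine Coxeter groups are classified: they are those of types $\tilde A_n$ ($n\ge 1$), $\tilde B_n$ ($n\ge 3$), $\tilde C_n$ ($n\ge 2$), $\tilde D_n$ ($n\ge 4$), $\tilde E_6,\tilde E_7,\tilde E_8,\tilde F_4,\tilde G_2$. Two groups are elementarily equivalent if they satisfy the same first-order sentences in the language of groups. *)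

theory Defs
  imports
    "HOL-Analysis.Analysis"
    "HOL-Algebra.Generated_Groups"
    "HOL-Library.Extended_Nat"
begin

section \<open>Group presentations\<close>

text \<open>A letter \<open>(s, True)\<close> stands for the generator \<open>s\<close>, a letter \<open>(s, False)\<close> for its formal
  inverse.\<close>

type_synonym 'a word = "('a \<times> bool) list"

definition words :: "'a set \<Rightarrow> 'a word set" where
  "words S = lists (S \<times> UNIV)"

text \<open>Two words are equivalent iff they represent the same element of the group \<open>\<langle>S | R\<rangle>\<close>: this is
  the least congruence on the monoid of words that contains the free cancellations and
  makes every relator in \<open>R\<close> trivial.\<close>

inductive word_equiv :: "'a set \<Rightarrow> 'a word set \<Rightarrow> 'a word \<Rightarrow> 'a word \<Rightarrow> bool"
  for S :: "'a set" and R :: "'a word set" where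
  refl: "w \<in> words S \<Longrightarrow> word_equiv S R w w"
| sym: "word_equiv S R v w \<Longrightarrow> word_equiv S R w v"
| trans: "word_equiv S R u v \<Longrightarrow> word_equiv S R v w \<Longrightarrow> word_equiv S R u w"
| append: "word_equiv S R u u' \<Longrightarrow> word_equiv S R v v' \<Longrightarrow> word_equiv S R (u @ v) (u' @ v')"
| cancel: "s \<in> S \<Longrightarrow> word_equiv S R [(s, b), (s, \<not> b)] []"
| relator: "r \<in> R \<Longrightarrow> r \<in> words S \<Longrightarrow> word_equiv S R r []"

definition word_rel :: "'a set \<Rightarrow> 'a word set \<Rightarrow> ('a word \<times> 'a word) set" where
  "word_rel S R = {(v, w). word_equiv S R v w}"

definition presented_group :: "'a set \<Rightarrow> 'a word set \<Rightarrow> 'a word set monoid" where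
  "presented_group S R =
    \<lparr> carrier = words S // word_rel S R,
      monoid.mult = (\<lambda>A B. \<Union>v\<in>A. \<Union>w\<in>B. word_rel S R `` {v @ w}),
      one = word_rel S R `` {[]} \<rparr>"

lemma word_equiv_words:
  "word_equiv S R v w \<Longrightarrow> v \<in> words S \<and> w \<in> words S"
  by (induction rule: word_equiv.induct) (auto simp: words_def)

lemma equiv_word_rel: "equiv (words S) (word_rel S R)"
proof (rule equivI)
  show "word_rel S R \<subseteq> words S \<times> words S"
    by (auto simp: word_rel_def dest: word_equiv_words)
  show "refl_on (words S) (word_rel S R)"
    by (auto simp: word_rel_def refl_on_def intro: word_equiv.refl)
  show "sym_on UNIV (word_rel S R)"
    by (auto simp: word_rel_def intro!: symI intro: word_equiv.sym)
  show "trans_on UNIV (word_rel S R)"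
    by (auto simp: word_rel_def intro!: transI intro: word_equiv.trans)
qed

lemma presented_group_mult:
  assumes "v \<in> words S" "w \<in> words S"
  shows "(word_rel S R `` {v}) \<otimes>\<^bsub>presented_group S R\<^esub> (word_rel S R `` {w})
    = word_rel S R `` {v @ w}"
proof -
  have c: "congruent2 (word_rel S R) (word_rel S R) (\<lambda>v w. word_rel S R `` {v @ w})"
    by (rule congruent2I', rule equiv_class_eq[OF equiv_word_rel])
      (auto simp: word_rel_def intro: word_equiv.append)
  show ?thesis
    using UN_equiv_class2[OF equiv_word_rel equiv_word_rel c assms]
    by (simp add: presented_group_def)
qed

lemma word_equiv_inverse:
  assumes "w \<in> words S"
  shows "word_equiv S R (rev (map (apsnd Not) w) @ w) []"
  using assms
proof (induction w)
  case Nil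
  then show ?case by (auto simp: words_def intro: word_equiv.refl)
next
  case (Cons x w)
  obtain s b where x: "x = (s, b)" by force
  have s: "s \<in> S" and w: "w \<in> words S" using Cons.prems x by (auto simp: words_def)
  let ?w' = "rev (map (apsnd Not) w)"
  have w': "?w' \<in> words S" using w by (fastforce simp: words_def)
  have "word_equiv S R ([(s, \<not> b), (s, \<not> \<not> b)] @ w) ([] @ w)"
    by (intro word_equiv.append word_equiv.cancel word_equiv.refl s w)
  then have "word_equiv S R (?w' @ [(s, \<not> b), (s, b)] @ w) (?w' @ w)"
    using word_equiv.append[OF word_equiv.refl[OF w']] by fastforce
  then show ?case
    using Cons.IH[OF w] x by (auto intro: word_equiv.trans)
qed

lemma group_presented_group: "group (presented_group S R)"
proof (rule groupI)
  let ?G = "presented_group S R" and ?c = "\<lambda>w. word_rel S R `` {w}"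
  have car: "carrier ?G = ?c ` words S" and one: "\<one>\<^bsub>?G\<^esub> = ?c []"
    by (auto simp: presented_group_def quotient_def)
  have app: "v @ w \<in> words S" if "v \<in> words S" "w \<in> words S" for v w
    using that by (auto simp: words_def)
  have nil: "[] \<in> words S" by (simp add: words_def)
  show "\<one>\<^bsub>?G\<^esub> \<in> carrier ?G" using nil by (simp add: car one)
  show "x \<otimes>\<^bsub>?G\<^esub> y \<in> carrier ?G" if "x \<in> carrier ?G" "y \<in> carrier ?G" for x y
    using that by (auto simp: car presented_group_mult app)
  show "x \<otimes>\<^bsub>?G\<^esub> y \<otimes>\<^bsub>?G\<^esub> z = x \<otimes>\<^bsub>?G\<^esub> (y \<otimes>\<^bsub>?G\<^esub> z)"
    if "x \<in> carrier ?G" "y \<in> carrier ?G" "z \<in> carrier ?G" for x y z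
    using that by (auto simp: car presented_group_mult app)
  show "\<one>\<^bsub>?G\<^esub> \<otimes>\<^bsub>?G\<^esub> x = x" if "x \<in> carrier ?G" for x
    using that nil by (auto simp: car one presented_group_mult)
  show "\<exists>y\<in>carrier ?G. y \<otimes>\<^bsub>?G\<^esub> x = \<one>\<^bsub>?G\<^esub>" if x: "x \<in> carrier ?G" for x
  proof -
    obtain w where w: "w \<in> words S" "x = ?c w" using x by (auto simp: car)
    let ?w' = "rev (map (apsnd Not) w)"
    have w': "?w' \<in> words S" using w by (fastforce simp: words_def)
    have "?c (?w' @ w) = ?c []"
      using word_equiv_inverse[OF w(1)] by (intro equiv_class_eq[OF equiv_word_rel])
        (simp add: word_rel_def)
    then have "?c ?w' \<otimes>\<^bsub>?G\<^esub> x = \<one>\<^bsub>?G\<^esub>"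
      using w w' by (simp add: presented_group_mult one)
    then show ?thesis using w' by (auto simp: car)
  qed
qed

section \<open>Coxeter groups\<close>

definition coxeter_matrix :: "'a set \<Rightarrow> ('a \<Rightarrow> 'a \<Rightarrow> enat) \<Rightarrow> bool" where
  "coxeter_matrix S m \<longleftrightarrow>
    (\<forall>s\<in>S. \<forall>t\<in>S. 1 \<le> m s t \<and> m s t = m t s \<and> (m s t = 1 \<longleftrightarrow> s = t))"

definition coxeter_relators :: "'a set \<Rightarrow> ('a \<Rightarrow> 'a \<Rightarrow> enat) \<Rightarrow> 'a word set" where
  "coxeter_relators S m =
    {concat (replicate k [(s, True), (t, True)]) | s t k. s \<in> S \<and> t \<in> S \<and> m s t = enat k}"

definition coxeter_group :: "'a set \<Rightarrow> ('a \<Rightarrow> 'a \<Rightarrow> enat) \<Rightarrow> 'a word set monoid" where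
  "coxeter_group S m = presented_group S (coxeter_relators S m)"

definition coxeter_diagram :: "'a set \<Rightarrow> ('a \<Rightarrow> 'a \<Rightarrow> enat) \<Rightarrow> ('a \<times> 'a) set" where
  "coxeter_diagram S m = {(s, t). s \<in> S \<and> t \<in> S \<and> 3 \<le> m s t}"

text \<open>Connectedness of the Coxeter diagram. The adjacency relation is symmetric when \<open>m\<close> is a Coxeter
  matrix, so its reflexive transitive closure describes the connected components.\<close>

definition coxeter_irreducible :: "'a set \<Rightarrow> ('a \<Rightarrow> 'a \<Rightarrow> enat) \<Rightarrow> bool" where
  "coxeter_irreducible S m \<longleftrightarrow> (\<forall>s\<in>S. \<forall>t\<in>S. (s, t) \<in> (coxeter_diagram S m)\<^sup>*)"

section \<open>Discrete affine reflection groups\<close>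

definition isometry_group :: "('e::metric_space \<Rightarrow> 'e) monoid" where
  "isometry_group =
    \<lparr> carrier = {f. bij f \<and> (\<forall>x y. dist (f x) (f y) = dist x y)}, monoid.mult = (\<circ>), one = id \<rparr>"

lemma group_isometry_group: "group (isometry_group :: ('e::metric_space \<Rightarrow> 'e) monoid)"
proof (rule groupI)
  let ?G = "isometry_group :: ('e \<Rightarrow> 'e) monoid"
  show "\<exists>g\<in>carrier ?G. g \<otimes>\<^bsub>?G\<^esub> f = \<one>\<^bsub>?G\<^esub>" if f: "f \<in> carrier ?G" for f
  proof (rule bexI[of _ "inv_into UNIV f"])
    have bij: "bij f" and iso: "dist (f x) (f y) = dist x y" for x y
      using f by (auto simp: isometry_group_def)
    show "inv_into UNIV f \<otimes>\<^bsub>?G\<^esub> f = \<one>\<^bsub>?G\<^esub>"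
      using bij by (simp add: isometry_group_def bij_is_inj)
    have "dist (inv_into UNIV f x) (inv_into UNIV f y) = dist x y" for x y
      using iso[of "inv_into UNIV f x" "inv_into UNIV f y"] bij by (simp add: bij_is_surj surj_f_inv_f)
    then show "inv_into UNIV f \<in> carrier ?G"
      using bij by (simp add: isometry_group_def bij_imp_bij_inv)
  qed
qed (auto simp: isometry_group_def bij_comp)

text \<open>The orthogonal reflection in the affine hyperplane \<open>{x. a \<bullet> x = b}\<close>.\<close>

definition affine_reflection :: "('e::euclidean_space \<Rightarrow> 'e) \<Rightarrow> bool" where
  "affine_reflection f \<longleftrightarrow>
    (\<exists>a b. a \<noteq> 0 \<and> f = (\<lambda>x. x - (2 * (a \<bullet> x - b) / (a \<bullet> a)) *\<^sub>R a))"

lemma affine_reflection_isometry: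
  fixes f :: "'e::euclidean_space \<Rightarrow> 'e"
  assumes "affine_reflection f"
  shows "f \<in> carrier isometry_group"
proof -
  obtain a b where a: "a \<noteq> 0" and f: "f = (\<lambda>x. x - (2 * (a \<bullet> x - b) / (a \<bullet> a)) *\<^sub>R a)"
    using assms by (auto simp: affine_reflection_def)
  have "f (f x) = x" for x
  proof -
    define c where "c = 2 * (a \<bullet> x - b) / (a \<bullet> a)"
    have fx: "f x = x - c *\<^sub>R a" by (simp add: f c_def)
    have "a \<bullet> f x - b = - (a \<bullet> x - b)"
      using a by (simp add: f inner_diff_right)
    then have "2 * (a \<bullet> f x - b) / (a \<bullet> a) = - c"
      by (simp only: c_def mult_minus_right minus_divide_left)
    then have "f (f x) = f x - (- c) *\<^sub>R a"
      by (metis f)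
    then show ?thesis by (simp add: fx)
  qed
  then have "bij f" by (intro o_bij[of f f]) auto
  moreover have "dist (f x) (f y) = dist x y" for x y
  proof -
    define d where "d = x - y"
    have "f x - f y = d - (2 * (a \<bullet> d) / (a \<bullet> a)) *\<^sub>R a"
      by (simp add: f d_def inner_diff_right diff_divide_distrib algebra_simps)
    moreover have "norm (d - (2 * (a \<bullet> d) / (a \<bullet> a)) *\<^sub>R a) = norm d"
      using a by (simp add: norm_eq inner_diff_left inner_diff_right inner_commute)
    ultimately show ?thesis by (simp add: dist_norm d_def)
  qed
  ultimately show ?thesis by (simp add: isometry_group_def)
qed

text \<open>Discreteness refers to the topology on functions, i.e. that of pointwise convergence;
  on the isometry group it coincides with the usual (compact-open) topology.\<close>

definition discrete_affine_reflection_group :: "('e::euclidean_space \<Rightarrow> 'e) set \<Rightarrow> bool" where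
  "discrete_affine_reflection_group \<Gamma> \<longleftrightarrow>
    (\<exists>R \<subseteq> Collect affine_reflection. \<Gamma> = generate isometry_group R) \<and> discrete \<Gamma>"

text \<open>The Euclidean space is a type parameter because a definition cannot quantify over types. A group
  is affine iff it is affine over some Euclidean space; used as a hypothesis with a free type
  variable \<open>'e\<close>, this predicate expresses exactly that.\<close>

definition affine_over :: "'e::euclidean_space itself \<Rightarrow> ('w, 'k) monoid_scheme \<Rightarrow> bool" where
  "affine_over TYPE('e) W \<longleftrightarrow>
    infinite (carrier W) \<and>
    (\<exists>\<Gamma> :: ('e \<Rightarrow> 'e) set. discrete_affine_reflection_group \<Gamma> \<and>
      W \<cong> isometry_group\<lparr>carrier := \<Gamma>\<rparr>)"

section \<open>First-order logic of groups\<close>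

datatype gterm = Var nat | One | Mult gterm gterm | Inv gterm

datatype gformula =
    Eq gterm gterm
  | Neg gformula
  | Conj gformula gformula
  | Disj gformula gformula
  | Imp gformula gformula
  | All nat gformula
  | Ex nat gformula

primrec gterm_vars :: "gterm \<Rightarrow> nat set" where
  "gterm_vars (Var n) = {n}"
| "gterm_vars One = {}"
| "gterm_vars (Mult t u) = gterm_vars t \<union> gterm_vars u"
| "gterm_vars (Inv t) = gterm_vars t"

primrec free_vars :: "gformula \<Rightarrow> nat set" where
  "free_vars (Eq t u) = gterm_vars t \<union> gterm_vars u"
| "free_vars (Neg \<phi>) = free_vars \<phi>"
| "free_vars (Conj \<phi> \<psi>) = free_vars \<phi> \<union> free_vars \<psi>"
| "free_vars (Disj \<phi> \<psi>) = free_vars \<phi> \<union> free_vars \<psi>"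
| "free_vars (Imp \<phi> \<psi>) = free_vars \<phi> \<union> free_vars \<psi>"
| "free_vars (All n \<phi>) = free_vars \<phi> - {n}"
| "free_vars (Ex n \<phi>) = free_vars \<phi> - {n}"

definition sentence :: "gformula \<Rightarrow> bool" where
  "sentence \<phi> \<longleftrightarrow> free_vars \<phi> = {}"

primrec gterm_val :: "('g, 'k) monoid_scheme \<Rightarrow> (nat \<Rightarrow> 'g) \<Rightarrow> gterm \<Rightarrow> 'g" where
  "gterm_val G e (Var n) = e n"
| "gterm_val G e One = \<one>\<^bsub>G\<^esub>"
| "gterm_val G e (Mult t u) = gterm_val G e t \<otimes>\<^bsub>G\<^esub> gterm_val G e u"
| "gterm_val G e (Inv t) = inv\<^bsub>G\<^esub> (gterm_val G e t)"

primrec sat :: "('g, 'k) monoid_scheme \<Rightarrow> (nat \<Rightarrow> 'g) \<Rightarrow> gformula \<Rightarrow> bool" where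
  "sat G e (Eq t u) \<longleftrightarrow> gterm_val G e t = gterm_val G e u"
| "sat G e (Neg \<phi>) \<longleftrightarrow> \<not> sat G e \<phi>"
| "sat G e (Conj \<phi> \<psi>) \<longleftrightarrow> sat G e \<phi> \<and> sat G e \<psi>"
| "sat G e (Disj \<phi> \<psi>) \<longleftrightarrow> sat G e \<phi> \<or> sat G e \<psi>"
| "sat G e (Imp \<phi> \<psi>) \<longleftrightarrow> (sat G e \<phi> \<longrightarrow> sat G e \<psi>)"
| "sat G e (All n \<phi>) \<longleftrightarrow> (\<forall>x\<in>carrier G. sat G (e(n := x)) \<phi>)"
| "sat G e (Ex n \<phi>) \<longleftrightarrow> (\<exists>x\<in>carrier G. sat G (e(n := x)) \<phi>)"

text \<open>For a sentence the truth value does not depend on the assignment.\<close>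

definition models :: "('g, 'k) monoid_scheme \<Rightarrow> gformula \<Rightarrow> bool" where
  "models G \<phi> \<longleftrightarrow> (\<forall>e. range e \<subseteq> carrier G \<longrightarrow> sat G e \<phi>)"

definition elementarily_equivalent ::
  "('g, 'k) monoid_scheme \<Rightarrow> ('h, 'l) monoid_scheme \<Rightarrow> bool" where
  "elementarily_equivalent G H \<longleftrightarrow> (\<forall>\<phi>. sentence \<phi> \<longrightarrow> (models G \<phi> \<longleftrightarrow> models H \<phi>))"

definition finitely_generated_group :: "('g, 'k) monoid_scheme \<Rightarrow> bool" where
  "finitely_generated_group G \<longleftrightarrow>
    group G \<and> (\<exists>X. finite X \<and> X \<subseteq> carrier G \<and> generate G X = carrier G)"

end

theory Submission
  imports
    Defs
    "HOL-Algebra.Multiplicative_Group"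
    "Jordan_Normal_Form.Determinant"
begin

text \<open>
  A discrete affine reflection group splits as \<open>\<Gamma> = T \<rtimes> F\<close> with \<open>T \<cong> \<int>\<^sup>n\<close> and \<open>F\<close> finite: finitely many
  directions of mirrors occur, and \<open>F\<close> is the stabilizer of a point through which mirrors of all
  these directions pass. Since all \<open>|F|\<close>-th powers lie in \<open>T\<close>, the subgroup \<open>T\<close> is definable from a
  basis, and a single sentence describes the splitting together with the action of \<open>F\<close> on \<open>T / T\<^sup>K\<close>
  for any fixed \<open>K\<close>. In a finitely generated group \<open>H\<close> satisfying it, \<open>H = D \<rtimes> F\<close> with \<open>D\<close>
  finitely generated abelian and, by further sentences, torsion free. Averaging a lift of the basis over \<open>F\<close>, as in
  Maranda's theorem, gives an equivariant embedding \<open>T \<rightarrow> D\<close> which is an isomorphism modulo \<open>k\<close>;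
  so \<open>D\<close> is isomorphic to an invariant sublattice of \<open>T\<close> of index prime to \<open>k\<close>. For suitable \<open>k\<close> the
  Cartan integers force such a sublattice to be a multiple of the coroot lattice on every component
  of the diagram, hence isomorphic to \<open>T\<close>, and \<open>H \<cong> \<Gamma>\<close>.
\<close>

section \<open>Expressing lattice splittings by a first-order sentence\<close>

text \<open>Elementary equivalence sees \<open>D\<close> only modulo powers, that is, up to local
  isomorphism of lattices with an action of \<open>F\<close>. For an arbitrary finite group such
  lattices need not be isomorphic; reflections are what closes this gap, and they enter the logical
  half only through \<open>diagonal_sublattices\<close>. The modulus is \<open>d * k\<close> instead
  of \<open>k\<close> because averaging over \<open>F\<close> yields \<open>d\<close>-th powers, and
  extracting the root costs a factor \<open>d\<close>. The number \<open>k\<close> is a common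
  multiple of the nonzero Cartan integers and of the determinant of their matrix, so all of these
  can be cancelled against anything that divides an exponent prime to \<open>k\<close>. On the
  geometric side mirrors carry unit normals, so the theory of simple roots is run with real
  coefficients; integrality appears only later, from the shortest nonzero translations along the
  normals.\<close>

primrec tpow :: "gterm \<Rightarrow> nat \<Rightarrow> gterm" where
  "tpow t 0 = One"
| "tpow t (Suc k) = Mult (tpow t k) t"

definition tipow :: "gterm \<Rightarrow> int \<Rightarrow> gterm" where
  "tipow t z = (if z < 0 then Inv (tpow t (nat (- z))) else tpow t (nat z))"

primrec tprod :: "(nat \<Rightarrow> int) \<Rightarrow> nat \<Rightarrow> gterm" where
  "tprod u 0 = One"
| "tprod u (Suc n) = Mult (tprod u n) (tipow (Var n) (u n))"

text \<open>An ordered product instead of \<open>finprod\<close>, since the ambient group need not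
  be commutative; it is the value of the term \<open>tprod\<close>.\<close>

primrec zprod :: "('a, 'b) monoid_scheme \<Rightarrow> (nat \<Rightarrow> 'a) \<Rightarrow> (nat \<Rightarrow> int) \<Rightarrow> nat \<Rightarrow> 'a" where
  "zprod G y u 0 = \<one>\<^bsub>G\<^esub>"
| "zprod G y u (Suc n) = zprod G y u n \<otimes>\<^bsub>G\<^esub> (y n [^]\<^bsub>G\<^esub> u n)"

text \<open>The term repeats the recursion of the group power, so the equation needs no group
  axioms.\<close>

lemma val_tpow [simp]: "gterm_val G e (tpow t k) = gterm_val G e t [^]\<^bsub>G\<^esub> k"
  by (induction k) (simp_all add: nat_pow_def)

lemma val_tipow [simp]: "gterm_val G e (tipow t z) = gterm_val G e t [^]\<^bsub>G\<^esub> z"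
  unfolding tipow_def int_pow_def2 by (cases "z < 0") (simp_all only: gterm_val.simps val_tpow if_True if_False)

lemma val_tprod [simp]: "gterm_val G e (tprod u n) = zprod G e u n"
  by (induction n) simp_all

lemma vars_tpow: "gterm_vars (tpow t k) \<subseteq> gterm_vars t"
  by (induction k) auto

lemma vars_tprod: "gterm_vars (tprod u n) \<subseteq> {..<n}"
proof (induction n)
  case (Suc n)
  have "gterm_vars (tipow (Var n) (u n)) \<subseteq> {n}"
    using vars_tpow[of "Var n"] by (auto simp: tipow_def)
  with Suc show ?case by fastforce
qed simp

lemma zprod_cong: "(\<And>i. i < n \<Longrightarrow> y i = y' i) \<Longrightarrow> zprod G y u n = zprod G y' u n"
  by (induction n) auto

lemma zprod_upd [simp]: "n \<le> b \<Longrightarrow> zprod G (e(b := v)) u n = zprod G e u n"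
  by (rule zprod_cong) auto

lemma gterm_val_upd: "b \<notin> gterm_vars t \<Longrightarrow> gterm_val G (e(b := v)) t = gterm_val G e t"
  by (induction t) auto

section \<open>Finite conjunctions, finite disjunctions and blocks of quantifiers\<close>

text \<open>The enumeration of \<open>A\<close> is an arbitrary choice: the formula depends on it,
  its truth value does not.\<close>

definition AndS :: "'i set \<Rightarrow> ('i \<Rightarrow> gformula) \<Rightarrow> gformula" where
  "AndS A f = foldr Conj (map f (SOME l. set l = A)) (Eq One One)"

definition OrS :: "'i set \<Rightarrow> ('i \<Rightarrow> gformula) \<Rightarrow> gformula" where
  "OrS A f = foldr Disj (map f (SOME l. set l = A)) (Neg (Eq One One))"

lemma set_some_list: "finite A \<Longrightarrow> set (SOME l. set l = A) = A"
  using finite_list[of A] by (rule someI_ex)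

lemma sat_AndS [simp]: "finite A \<Longrightarrow> sat G e (AndS A f) \<longleftrightarrow> (\<forall>a\<in>A. sat G e (f a))"
proof -
  have "sat G e (foldr Conj (map f l) (Eq One One)) \<longleftrightarrow> (\<forall>a\<in>set l. sat G e (f a))" for l
    by (induction l) auto
  then show "finite A \<Longrightarrow> ?thesis" by (simp add: AndS_def set_some_list)
qed

lemma sat_OrS [simp]: "finite A \<Longrightarrow> sat G e (OrS A f) \<longleftrightarrow> (\<exists>a\<in>A. sat G e (f a))"
proof -
  have "sat G e (foldr Disj (map f l) (Neg (Eq One One))) \<longleftrightarrow> (\<exists>a\<in>set l. sat G e (f a))" for l
    by (induction l) auto
  then show "finite A \<Longrightarrow> ?thesis" by (simp add: OrS_def set_some_list)
qed

lemma free_vars_AndS [simp]: "finite A \<Longrightarrow> free_vars (AndS A f) = (\<Union>a\<in>A. free_vars (f a))"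
proof -
  have "free_vars (foldr Conj (map f l) (Eq One One)) = (\<Union>a\<in>set l. free_vars (f a))" for l
    by (induction l) auto
  then show "finite A \<Longrightarrow> ?thesis" by (simp add: AndS_def set_some_list)
qed

lemma free_vars_OrS [simp]: "finite A \<Longrightarrow> free_vars (OrS A f) = (\<Union>a\<in>A. free_vars (f a))"
proof -
  have "free_vars (foldr Disj (map f l) (Neg (Eq One One))) = (\<Union>a\<in>set l. free_vars (f a))" for l
    by (induction l) auto
  then show "finite A \<Longrightarrow> ?thesis" by (simp add: OrS_def set_some_list)
qed

primrec exs :: "nat \<Rightarrow> gformula \<Rightarrow> gformula" where
  "exs 0 \<phi> = \<phi>"
| "exs (Suc N) \<phi> = Ex N (exs N \<phi>)"

lemma free_vars_exs: "free_vars (exs N \<phi>) = free_vars \<phi> - {..<N}"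
proof (induction N)
  case (Suc N)
  have "{..<Suc N} = {..<N} \<union> {N}" by (simp add: lessThan_Suc)
  then show ?case by (simp only: exs.simps free_vars.simps Suc.IH Diff_eq Compl_Un Int_assoc)
qed simp

lemma sat_exs:
  "sat G e (exs N \<phi>) \<longleftrightarrow>
    (\<exists>f. (\<forall>i<N. f i \<in> carrier G) \<and> sat G (\<lambda>i. if i < N then f i else e i) \<phi>)"
proof (induction N arbitrary: e)
  case (Suc N)
  show ?case
  proof
    assume "sat G e (exs (Suc N) \<phi>)"
    then obtain v where v: "v \<in> carrier G" and "sat G (e(N := v)) (exs N \<phi>)"
      unfolding exs.simps sat.simps by blast
    then obtain f where f: "\<forall>i<N. f i \<in> carrier G"
      and s: "sat G (\<lambda>i. if i < N then f i else (e(N := v)) i) \<phi>"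
      unfolding Suc.IH by blast
    have "(\<lambda>i. if i < N then f i else (e(N := v)) i) = (\<lambda>i. if i < Suc N then (f(N := v)) i else e i)"
      by auto
    with s have "sat G (\<lambda>i. if i < Suc N then (f(N := v)) i else e i) \<phi>" by (simp only:)
    moreover have "\<forall>i<Suc N. (f(N := v)) i \<in> carrier G" using f v by simp
    ultimately show "\<exists>f. (\<forall>i<Suc N. f i \<in> carrier G) \<and>
        sat G (\<lambda>i. if i < Suc N then f i else e i) \<phi>" by blast
  next
    assume "\<exists>f. (\<forall>i<Suc N. f i \<in> carrier G) \<and> sat G (\<lambda>i. if i < Suc N then f i else e i) \<phi>"
    then obtain f where f: "\<forall>i<Suc N. f i \<in> carrier G"
      and s: "sat G (\<lambda>i. if i < Suc N then f i else e i) \<phi>" by blast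
    have "(\<lambda>i. if i < Suc N then f i else e i) = (\<lambda>i. if i < N then f i else (e(N := f N)) i)"
      by auto
    with s have "sat G (\<lambda>i. if i < N then f i else (e(N := f N)) i) \<phi>" by (simp only:)
    moreover have "\<forall>i<N. f i \<in> carrier G" "f N \<in> carrier G" using f by auto
    ultimately show "sat G e (exs (Suc N) \<phi>)"
      unfolding exs.simps sat.simps Suc.IH by blast
  qed
qed simp

section \<open>Integer vectors, residues and the definable lattice\<close>

text \<open>Vectors are functions vanishing from \<open>n\<close> on, so that equality of vectors is
  equality of functions.\<close>

definition zvec :: "nat \<Rightarrow> (nat \<Rightarrow> int) set" where
  "zvec n = {u. \<forall>i\<ge>n. u i = 0}"

definition unitv :: "nat \<Rightarrow> nat \<Rightarrow> int" where
  "unitv i = (\<lambda>j. if j = i then 1 else 0)"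

text \<open>Representatives of the integer vectors modulo \<open>k\<close>; there are finitely many,
  so a formula can list them.\<close>

definition residue_box :: "nat \<Rightarrow> nat \<Rightarrow> (nat \<Rightarrow> int) set" where
  "residue_box n k = {u \<in> zvec n. \<forall>i<n. 0 \<le> u i \<and> u i < int k}"

lemma finite_residue_box [simp]: "finite (residue_box n k)"
proof (rule finite_subset)
  show "residue_box n k \<subseteq> {u. \<forall>i. (i \<in> {..<n} \<longrightarrow> u i \<in> {0..<int k}) \<and> (i \<notin> {..<n} \<longrightarrow> u i = 0)}"
    by (auto simp: residue_box_def zvec_def)
  show "finite {u. \<forall>i. (i \<in> {..<n} \<longrightarrow> u i \<in> {0..<int k}) \<and> (i \<notin> {..<n} \<longrightarrow> u i = 0)}"
    by (rule finite_set_of_finite_funs) auto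
qed

text \<open>If \<open>y\<^sub>0, \<dots>, y\<^sub>n\<^sub>-\<^sub>1\<close> is a basis of a normal subgroup \<open>T \<cong> \<int>\<^sup>n\<close> of index \<open>d\<close> then this set is
  \<open>T\<close>, since all \<open>d\<close>-th powers lie in \<open>T\<close>: it makes \<open>T\<close> definable with parameters.\<close>

definition span_set :: "('a, 'b) monoid_scheme \<Rightarrow> nat \<Rightarrow> nat \<Rightarrow> (nat \<Rightarrow> 'a) \<Rightarrow> 'a set" where
  "span_set G n d y = {zprod G y a n \<otimes>\<^bsub>G\<^esub> (h [^]\<^bsub>G\<^esub> d) | a h. a \<in> residue_box n d \<and> h \<in> carrier G}"

definition in_span :: "nat \<Rightarrow> nat \<Rightarrow> nat \<Rightarrow> gterm \<Rightarrow> gformula" where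
  "in_span n d b t = Ex b (OrS (residue_box n d) (\<lambda>a. Eq t (Mult (tprod a n) (tpow (Var b) d))))"

lemma sat_in_span:
  assumes "b \<notin> gterm_vars t" "n \<le> b"
  shows "sat G e (in_span n d b t) \<longleftrightarrow> gterm_val G e t \<in> span_set G n d e"
  using assms by (auto simp: in_span_def span_set_def gterm_val_upd)

lemma free_vars_in_span: "free_vars (in_span n d b t) \<subseteq> gterm_vars t \<union> {..<n}"
  using vars_tprod vars_tpow[of "Var b" d] by (auto simp: in_span_def; fastforce)

lemma span_set_upd [simp]: "n \<le> b \<Longrightarrow> span_set G n d (e(b := v)) = span_set G n d e"
  by (simp add: span_set_def)

text \<open>What a first-order sentence can say about a splitting over a lattice with basis \<open>y\<close> and
  finite complement \<open>x\<close>: the action \<open>act\<close> of the complement on the lattice is only determined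
  modulo \<open>d k\<close>-th powers.\<close>

definition mod_split ::
  "('a, 'b) monoid_scheme \<Rightarrow> nat \<Rightarrow> nat \<Rightarrow> nat \<Rightarrow> (nat \<Rightarrow> (nat \<Rightarrow> int) \<Rightarrow> nat \<Rightarrow> int) \<Rightarrow>
    (nat \<Rightarrow> nat \<Rightarrow> nat) \<Rightarrow> (nat \<Rightarrow> 'a) \<Rightarrow> (nat \<Rightarrow> 'a) \<Rightarrow> bool" where
  "mod_split G n d k act mu y x \<longleftrightarrow>
    (\<forall>v\<in>carrier G. \<forall>w\<in>carrier G. v \<in> span_set G n d y \<and> w \<in> span_set G n d y \<longrightarrow>
      v \<otimes>\<^bsub>G\<^esub> w \<in> span_set G n d y \<and> inv\<^bsub>G\<^esub> v \<in> span_set G n d y \<and> v \<otimes>\<^bsub>G\<^esub> w = w \<otimes>\<^bsub>G\<^esub> v) \<and>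
    (\<forall>v\<in>carrier G. v \<in> span_set G n d y \<longrightarrow>
      (\<forall>j\<in>{..<d}. x j \<otimes>\<^bsub>G\<^esub> v \<otimes>\<^bsub>G\<^esub> inv\<^bsub>G\<^esub> x j \<in> span_set G n d y)) \<and>
    (\<forall>v\<in>carrier G. \<exists>j\<in>{..<d}. v \<otimes>\<^bsub>G\<^esub> inv\<^bsub>G\<^esub> x j \<in> span_set G n d y) \<and>
    (\<forall>i\<in>{..<d}. \<forall>j\<in>{..<d}. i = j \<or> x i \<otimes>\<^bsub>G\<^esub> inv\<^bsub>G\<^esub> x j \<notin> span_set G n d y) \<and>
    (\<forall>i\<in>{..<d}. \<forall>j\<in>{..<d}. x i \<otimes>\<^bsub>G\<^esub> x j = x (mu i j)) \<and>
    (\<forall>j\<in>{..<d}. \<forall>i\<in>{..<n}. \<exists>v\<in>carrier G. v \<in> span_set G n d y \<and>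
      x j \<otimes>\<^bsub>G\<^esub> y i \<otimes>\<^bsub>G\<^esub> inv\<^bsub>G\<^esub> x j = zprod G y (act j (unitv i)) n \<otimes>\<^bsub>G\<^esub> (v [^]\<^bsub>G\<^esub> (d * k))) \<and>
    (\<forall>v\<in>carrier G. v \<in> span_set G n d y \<longrightarrow> (\<exists>w\<in>carrier G. w \<in> span_set G n d y \<and>
      (\<exists>a\<in>residue_box n (d * k). v = zprod G y a n \<otimes>\<^bsub>G\<^esub> (w [^]\<^bsub>G\<^esub> (d * k))))) \<and>
    (\<forall>a\<in>residue_box n k - {\<lambda>_. 0}. \<not> (\<exists>w\<in>carrier G. w \<in> span_set G n d y \<and> zprod G y a n = w [^]\<^bsub>G\<^esub> k)) \<and>
    (\<forall>v\<in>carrier G. v \<in> span_set G n d y \<longrightarrow> v [^]\<^bsub>G\<^esub> d = \<one>\<^bsub>G\<^esub> \<longrightarrow> v = \<one>\<^bsub>G\<^esub>) \<and>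
    (\<forall>i\<in>{..<n}. y i \<in> span_set G n d y)"

text \<open>Layout of the variables: the basis occupies \<open>0, ..., n - 1\<close> and the
  complement \<open>n, ..., n + d - 1\<close>; the next two are the bound elements \<open>V\<close>
  and \<open>W\<close>, and the one after them is bound inside \<open>in_span\<close>. Diagonal
  pairs are filled with a true equation because \<open>AndS\<close> runs over all pairs.\<close>

definition mod_split_body ::
  "nat \<Rightarrow> nat \<Rightarrow> nat \<Rightarrow> (nat \<Rightarrow> (nat \<Rightarrow> int) \<Rightarrow> nat \<Rightarrow> int) \<Rightarrow> (nat \<Rightarrow> nat \<Rightarrow> nat) \<Rightarrow> gformula" where
  "mod_split_body n d k act mu =
    (let V = Var (n + d); W = Var (Suc (n + d));
         D = in_span n d (Suc (Suc (n + d))); x = (\<lambda>j. Var (n + j));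
         all = All (n + d); exi = Ex (Suc (n + d))
     in
      Conj (all (All (Suc (n + d)) (Imp (Conj (D V) (D W))
        (Conj (D (Mult V W)) (Conj (D (Inv V)) (Eq (Mult V W) (Mult W V)))))))
     (Conj (all (Imp (D V) (AndS {..<d} (\<lambda>j. D (Mult (Mult (x j) V) (Inv (x j)))))))
     (Conj (all (OrS {..<d} (\<lambda>j. D (Mult V (Inv (x j))))))
     (Conj (AndS {..<d} (\<lambda>i. AndS {..<d} (\<lambda>j.
        if i = j then Eq One One else Neg (D (Mult (x i) (Inv (x j)))))))
     (Conj (AndS {..<d} (\<lambda>i. AndS {..<d} (\<lambda>j. Eq (Mult (x i) (x j)) (x (mu i j)))))
     (Conj (AndS {..<d} (\<lambda>j. AndS {..<n} (\<lambda>i. exi (Conj (D W)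
        (Eq (Mult (Mult (x j) (Var i)) (Inv (x j)))
          (Mult (tprod (act j (unitv i)) n) (tpow W (d * k))))))))
     (Conj (all (Imp (D V) (exi (Conj (D W)
        (OrS (residue_box n (d * k)) (\<lambda>a. Eq V (Mult (tprod a n) (tpow W (d * k)))))))))
     (Conj (AndS (residue_box n k - {\<lambda>_. 0}) (\<lambda>a. Neg (exi (Conj (D W) (Eq (tprod a n) (tpow W k))))))
     (Conj (all (Imp (D V) (Imp (Eq (tpow V d) One) (Eq V One))))
       (AndS {..<n} (\<lambda>i. D (Var i))))))))))))"

lemma sat_mod_split_body:
  assumes "\<And>i j. i < d \<Longrightarrow> j < d \<Longrightarrow> mu i j < d"
  shows "sat G e (mod_split_body n d k act mu) \<longleftrightarrow> mod_split G n d k act mu e (\<lambda>j. e (n + j))"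
proof -
  have [simp]: "mu i j \<noteq> d" "n + mu i j \<noteq> Suc (n + d)" if "i < d" "j < d" for i j
    using assms[OF that] by auto
  have [simp]: "(n + j = Suc (n + d)) = False" "(n + j = n + d) = False" if "j < d" for j
    using that by auto
  have [simp]: "(i = Suc (n + d)) = False" "(i = n + d) = False" if "i < n" for i
    using that by auto
  have *: "sat G e (if P then Eq One One else Neg \<phi>) \<longleftrightarrow> P \<or> \<not> sat G e \<phi>" for P \<phi> e
    by simp
  show ?thesis
    unfolding mod_split_body_def Let_def mod_split_def
    by (simp only: sat.simps sat_AndS sat_OrS finite_lessThan finite_residue_box finite_Diff *)
       (simp add: sat_in_span)
qed

lemma free_vars_mod_split_body:
  assumes "\<And>i j. i < d \<Longrightarrow> j < d \<Longrightarrow> mu i j < d"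
  shows "free_vars (mod_split_body n d k act mu) \<subseteq> {..<n + d}"
proof -
  have D: "a \<in> free_vars (in_span n d b t) \<Longrightarrow> a \<in> gterm_vars t \<or> a < n" for a b t
    using free_vars_in_span by blast
  have p: "a \<in> gterm_vars (tprod u n) \<Longrightarrow> a < n" for a u using vars_tprod by blast
  have q: "a \<in> gterm_vars (tpow t m) \<Longrightarrow> a \<in> gterm_vars t" for a t m using vars_tpow by blast
  show ?thesis
    unfolding mod_split_body_def Let_def
    apply (simp only: free_vars.simps free_vars_AndS free_vars_OrS finite_lessThan finite_residue_box
        finite_Diff Diff_subset_conv Un_subset_iff UN_subset_iff if_distrib[of free_vars])
    apply (intro conjI subsetI ballI)
    apply (simp_all only: gterm_vars.simps Un_iff UN_iff singleton_iff lessThan_iff split: if_splits)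
    by (auto dest!: D p q simp: assms)
qed

definition mod_split_sentence ::
  "nat \<Rightarrow> nat \<Rightarrow> nat \<Rightarrow> (nat \<Rightarrow> (nat \<Rightarrow> int) \<Rightarrow> nat \<Rightarrow> int) \<Rightarrow> (nat \<Rightarrow> nat \<Rightarrow> nat) \<Rightarrow> gformula" where
  "mod_split_sentence n d k act mu = exs (n + d) (mod_split_body n d k act mu)"

lemma mod_split_cong:
  assumes "\<And>i. i < n \<Longrightarrow> y i = y' i" "\<And>j. j < d \<Longrightarrow> x j = x' j" "\<And>i j. i < d \<Longrightarrow> j < d \<Longrightarrow> mu i j < d"
  shows "mod_split G n d k act mu y x \<longleftrightarrow> mod_split G n d k act mu y' x'"
proof -
  have z: "zprod G y u n = zprod G y' u n" for u by (rule zprod_cong) (simp add: assms)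
  have s: "span_set G n d y = span_set G n d y'" by (simp add: span_set_def z)
  show ?thesis unfolding mod_split_def z s using assms by simp
qed

lemma models_mod_split_sentence:
  assumes mu: "\<And>i j. i < d \<Longrightarrow> j < d \<Longrightarrow> mu i j < d" and "carrier G \<noteq> {}"
  shows "models G (mod_split_sentence n d k act mu) \<longleftrightarrow>
    (\<exists>y x. (\<forall>i<n. y i \<in> carrier G) \<and> (\<forall>j<d. x j \<in> carrier G) \<and> mod_split G n d k act mu y x)"
    (is "_ \<longleftrightarrow> ?R")
proof -
  have "sat G e (mod_split_sentence n d k act mu) \<longleftrightarrow> ?R" for e
  proof
    assume "sat G e (mod_split_sentence n d k act mu)"
    then obtain f where f: "\<forall>i<n + d. f i \<in> carrier G"
      and "sat G (\<lambda>i. if i < n + d then f i else e i) (mod_split_body n d k act mu)"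
      unfolding mod_split_sentence_def sat_exs by blast
    then have "mod_split G n d k act mu (\<lambda>i. if i < n + d then f i else e i)
        (\<lambda>j. if n + j < n + d then f (n + j) else e (n + j))"
      using sat_mod_split_body[where mu = mu, OF mu] by blast
    moreover have "(if i < n + d then f i else e i) \<in> carrier G" if "i < n" for i
      using f that by auto
    moreover have "(if n + j < n + d then f (n + j) else e (n + j)) \<in> carrier G" if "j < d" for j
      using f that by auto
    ultimately show ?R
      by (intro exI[of _ "\<lambda>i. if i < n + d then f i else e i"]
        exI[of _ "\<lambda>j. if n + j < n + d then f (n + j) else e (n + j)"] conjI allI impI) auto
  next
    assume ?R
    then obtain y x where y: "\<forall>i<n. y i \<in> carrier G" "\<forall>j<d. x j \<in> carrier G"
      and s: "mod_split G n d k act mu y x" by blast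
    let ?f = "\<lambda>i. if i < n then y i else x (i - n)"
    have "mod_split G n d k act mu (\<lambda>i. if i < n + d then ?f i else e i)
        (\<lambda>j. if n + j < n + d then ?f (n + j) else e (n + j))"
      using s by (rule iffD1[OF mod_split_cong, rotated -1]) (auto simp: mu)
    then have "sat G (\<lambda>i. if i < n + d then ?f i else e i) (mod_split_body n d k act mu)"
      by (subst sat_mod_split_body[where mu = mu, OF mu])
    moreover have "\<forall>i<n + d. ?f i \<in> carrier G" using y by auto
    ultimately show "sat G e (mod_split_sentence n d k act mu)"
      unfolding mod_split_sentence_def sat_exs by (intro exI[of _ ?f] conjI)
  qed
  \<comment> \<open>Some assignment takes its values in the carrier, so the quantifier over
    assignments in \<open>models\<close> is not vacuous.\<close>
  moreover obtain a where "a \<in> carrier G" using assms(2) by blast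
  then have "range (\<lambda>_::nat. a) \<subseteq> carrier G" by auto
  ultimately show ?thesis unfolding models_def by (simp only:) blast
qed

lemma sentence_mod_split_sentence:
  assumes "\<And>i j. i < d \<Longrightarrow> j < d \<Longrightarrow> mu i j < d"
  shows "sentence (mod_split_sentence n d k act mu)"
  using free_vars_mod_split_body[of d mu n k act, OF assms]
  by (auto simp: sentence_def mod_split_sentence_def free_vars_exs)

text \<open>The lattice is definable only from parameters quantified inside one sentence, which
  cannot hold infinitely many conditions on it. So this sentence speaks of the whole group; it is
  used for \<open>p\<close> prime to \<open>d\<close>, where the finite complement has no torsion to
  offer.\<close>

definition torsion_free_sentence :: "nat \<Rightarrow> gformula" where
  "torsion_free_sentence p = All 0 (Imp (Eq (tpow (Var 0) p) One) (Eq (Var 0) One))"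

lemma models_torsion_free_sentence:
  assumes "carrier G \<noteq> {}"
  shows "models G (torsion_free_sentence p) \<longleftrightarrow>
    (\<forall>v\<in>carrier G. v [^]\<^bsub>G\<^esub> p = \<one>\<^bsub>G\<^esub> \<longrightarrow> v = \<one>\<^bsub>G\<^esub>)"
proof -
  obtain a where "a \<in> carrier G" using assms by blast
  then have "range (\<lambda>_::nat. a) \<subseteq> carrier G" by auto
  then show ?thesis unfolding models_def torsion_free_sentence_def by auto
qed

lemma sentence_torsion_free_sentence: "sentence (torsion_free_sentence p)"
  using vars_tpow[of "Var 0" p] by (auto simp: sentence_def torsion_free_sentence_def)

section \<open>Lattices modulo powers\<close>

lemma zvec_zero [simp]: "(\<lambda>_. 0) \<in> zvec n" by (simp add: zvec_def)
lemma zvec_add: "u \<in> zvec n \<Longrightarrow> v \<in> zvec n \<Longrightarrow> (\<lambda>i. u i + v i) \<in> zvec n" by (simp add: zvec_def)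
lemma zvec_neg: "u \<in> zvec n \<Longrightarrow> (\<lambda>i. - u i) \<in> zvec n" by (simp add: zvec_def)
lemma zvec_mult: "u \<in> zvec n \<Longrightarrow> (\<lambda>i. g i * u i) \<in> zvec n" by (simp add: zvec_def)
lemma zvec_scale: "u \<in> zvec n \<Longrightarrow> (\<lambda>i. z * u i) \<in> zvec n" by (simp add: zvec_def)
lemma zvec_unitv: "i < n \<Longrightarrow> unitv i \<in> zvec n" by (simp add: zvec_def unitv_def)
lemma residue_box_zvec: "a \<in> residue_box n k \<Longrightarrow> a \<in> zvec n" by (simp add: residue_box_def)

lemma zvec_induct [consumes 1, case_names zero unitv add neg]:
  assumes "u \<in> zvec n" and zero: "P (\<lambda>_. 0)" and unitv: "\<And>i. i < n \<Longrightarrow> P (unitv i)"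
    and add: "\<And>u v. u \<in> zvec n \<Longrightarrow> v \<in> zvec n \<Longrightarrow> P u \<Longrightarrow> P v \<Longrightarrow> P (\<lambda>i. u i + v i)"
    and neg: "\<And>u. u \<in> zvec n \<Longrightarrow> P u \<Longrightarrow> P (\<lambda>i. - u i)"
  shows "P u"
proof -
  have nat: "P (\<lambda>j. int k * unitv i j)" if i: "i < n" for i k
  proof (induction k)
    case (Suc k)
    have "P (\<lambda>j. int k * unitv i j + unitv i j)"
      by (rule add[OF zvec_scale _ Suc unitv]) (use i in \<open>auto simp: zvec_unitv\<close>)
    then show ?case by (simp add: algebra_simps)
  qed (simp add: zero)
  have int: "P (\<lambda>j. z * unitv i j)" if i: "i < n" for i z
  proof (cases "z \<ge> 0")
    case True
    then show ?thesis using nat[OF i, of "nat z"] by simp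
  next
    case False
    have "P (\<lambda>j. - (int (nat (- z)) * unitv i j))"
      by (rule neg[OF zvec_scale nat]) (use i in \<open>auto simp: zvec_unitv\<close>)
    then show ?thesis using False by simp
  qed
  have "P (\<lambda>i. if i < m then u i else 0)" if "m \<le> n" for m
    using that
  proof (induction m)
    case (Suc m)
    have "P (\<lambda>i. (if i < m then u i else 0) + u m * unitv m i)"
      by (rule add[OF _ zvec_scale _ int]) (use Suc in \<open>auto simp: zvec_def unitv_def\<close>)
    moreover have "(\<lambda>i. (if i < m then u i else 0) + u m * unitv m i) = (\<lambda>i. if i < Suc m then u i else 0)"
      by (auto simp: unitv_def fun_eq_iff less_Suc_eq)
    ultimately show ?case by simp
  qed (simp add: zero)
  from this[of n] have "P (\<lambda>i. if i < n then u i else 0)" by blast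
  moreover have "(\<lambda>i. if i < n then u i else 0) = u"
    using assms(1) by (auto simp: zvec_def fun_eq_iff)
  ultimately show ?thesis by simp
qed

lemma zvec_div_mod:
  assumes "u \<in> zvec n" "0 < k"
  obtains a v where "a \<in> residue_box n k" "v \<in> zvec n" "u = (\<lambda>i. a i + int k * v i)"
proof
  show "(\<lambda>i. u i mod int k) \<in> residue_box n k" "(\<lambda>i. u i div int k) \<in> zvec n"
    using assms by (auto simp: residue_box_def zvec_def)
  show "u = (\<lambda>i. u i mod int k + int k * (u i div int k))" by auto
qed

lemma (in group) zprod_zero [simp]: "(\<And>i. i < n \<Longrightarrow> y i \<in> carrier G) \<Longrightarrow> zprod G y (\<lambda>_. 0) n = \<one>"
  by (induction n) auto

lemma (in group) zprod_closed [simp]: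
  "(\<And>i. i < n \<Longrightarrow> y i \<in> carrier G) \<Longrightarrow> zprod G y u n \<in> carrier G"
  by (induction n) auto

lemma (in comm_group) zprod_add:
  assumes "\<And>i. i < n \<Longrightarrow> y i \<in> carrier G"
  shows "zprod G y (\<lambda>i. u i + v i) n = zprod G y u n \<otimes> zprod G y v n"
  using assms
proof (induction n)
  case (Suc n)
  then have c: "y n \<in> carrier G" "zprod G y u n \<in> carrier G" "zprod G y v n \<in> carrier G"
    by auto
  then show ?case using Suc by (simp add: int_pow_mult m_ac)
qed simp

lemma (in group) zprod_unitv:
  assumes "i < n" "\<And>i. i < n \<Longrightarrow> y i \<in> carrier G"
  shows "zprod G y (unitv i) n = y i"
proof -
  have "zprod G y (unitv i) m = (if i < m then y i else \<one>)" if "m \<le> n" for m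
    using that
  proof (induction m)
    case (Suc m)
    then show ?case using assms by (auto simp: unitv_def not_less int_pow_1 less_Suc_eq)
  qed simp
  then show ?thesis using assms by simp
qed

section \<open>Finitely generated abelian groups modulo \<open>k\<close>-th powers\<close>

lemma (in comm_group) generate_insert:
  assumes "Y \<subseteq> carrier G" "z \<in> carrier G" "w \<in> generate G (insert z Y)"
  shows "\<exists>b::int. \<exists>w'\<in>generate G Y. w = z [^] b \<otimes> w'"
  using assms(3)
proof (induction rule: generate.induct)
  case one
  then show ?case using generate.one by (intro exI[of _ 0] bexI[of _ "\<one>"]) auto
next
  case (incl h)
  show ?case
  proof (cases "h = z")
    case True
    then show ?thesis using assms generate.one
      by (intro exI[of _ 1] bexI[of _ "\<one>"]) auto
  next
    case False
    then show ?thesis using incl assms generate.incl[of h Y]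
      by (intro exI[of _ 0] bexI[of _ h]) auto
  qed
next
  case (inv h)
  show ?case
  proof (cases "h = z")
    case True
    then show ?thesis using assms generate.one
      by (intro exI[of _ "-1"] bexI[of _ "\<one>"]) (auto simp: int_pow_neg)
  next
    case False
    then show ?thesis using inv assms generate.inv[of h Y]
      by (intro exI[of _ 0] bexI[of _ "inv h"]) auto
  qed
next
  case (eng h1 h2)
  then obtain b1 b2 :: int and w1 w2 where w: "w1 \<in> generate G Y" "w2 \<in> generate G Y"
    "h1 = z [^] b1 \<otimes> w1" "h2 = z [^] b2 \<otimes> w2" by blast
  have "w1 \<in> carrier G" "w2 \<in> carrier G" using w generate_in_carrier[OF assms(1)] by auto
  then have "h1 \<otimes> h2 = z [^] (b1 + b2) \<otimes> (w1 \<otimes> w2)"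
    using assms by (simp add: w int_pow_mult m_ac)
  then show ?case using generate.eng[OF w(1,2)] by blast
qed

lemma (in comm_group) generate_pow_in_subgroup:
  fixes r :: int
  assumes "subgroup P G" "Y \<subseteq> carrier G" "\<And>t. t \<in> Y \<Longrightarrow> t [^] r \<in> P" "w \<in> generate G Y"
  shows "w [^] r \<in> P"
  using assms(4)
proof (induction rule: generate.induct)
  case one
  then show ?case using assms(1) by (simp add: subgroup.one_closed int_pow_one)
next
  case (incl h)
  then show ?case using assms by blast
next
  case (inv h)
  then have "h \<in> carrier G" "h [^] r \<in> P" using assms by auto
  then show ?case using assms(1) by (simp add: int_pow_inv subgroup.m_inv_closed)
next
  case (eng h1 h2)
  have "h1 \<in> carrier G" "h2 \<in> carrier G" using eng generate_in_carrier[OF assms(2)] by auto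
  then show ?case using eng assms(1) by (simp add: int_pow_distrib subgroup.m_closed)
qed

lemma (in group) subgroup_int_pow_closed:
  fixes z :: int
  assumes "subgroup P G" "p \<in> P"
  shows "p [^] z \<in> P"
proof -
  have "p [^] m \<in> P" for m :: nat
    by (induction m) (use assms in \<open>auto simp: subgroup.one_closed subgroup.m_closed\<close>)
  then show ?thesis
    unfolding int_pow_def2 using assms by (auto simp only: subgroup.m_inv_closed split: if_splits)
qed

text \<open>Nakayama's lemma for \<open>\<langle>P, Z\<rangle>/P\<close>, by elimination of one generator at a time.\<close>

lemma (in comm_group) nakayama:
  fixes k :: int
  assumes "finite Z" and P: "subgroup P G" and "Z \<subseteq> carrier G"
    and "\<And>z. z \<in> Z \<Longrightarrow> \<exists>p\<in>P. \<exists>w\<in>generate G (P \<union> Z). z = p \<otimes> w [^] k"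
  shows "\<exists>r. k dvd r - 1 \<and> (\<forall>z\<in>Z. z [^] r \<in> P)"
  using assms(1,3,4)
proof (induction Z rule: finite_induct)
  case empty
  then show ?case by (intro exI[of _ 1]) auto
next
  case (insert z Z)
  let ?Q = "generate G (P \<union> Z)"
  have Pc: "P \<subseteq> carrier G" using P by (simp add: subgroup.subset)
  have PZ: "P \<union> Z \<subseteq> carrier G" and z: "z \<in> carrier G" using insert.prems Pc by auto
  have Q: "subgroup ?Q G" using generate_is_subgroup[OF PZ] .
  have Qc: "?Q \<subseteq> carrier G" using Q by (simp add: subgroup.subset)
  have split: "\<exists>p\<in>P. \<exists>b::int. \<exists>w\<in>?Q. t = p \<otimes> (z [^] (b * k)) \<otimes> (w [^] k)"
    if t: "t \<in> insert z Z" for t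
  proof -
    obtain p w where p: "p \<in> P" and w: "w \<in> generate G (insert z (P \<union> Z))" and e: "t = p \<otimes> w [^] k"
      using insert.prems(2)[OF t] by auto
    obtain b :: int and w' where w': "w' \<in> ?Q" "w = z [^] b \<otimes> w'"
      using generate_insert[OF PZ z w] by blast
    have "t = p \<otimes> (z [^] (b * k)) \<otimes> (w' [^] k)"
      using e w' z p Pc Qc by (auto simp: int_pow_distrib int_pow_pow m_assoc subset_iff)
    then show ?thesis using p w' by blast
  qed
  obtain p b w where p: "p \<in> P" and w: "w \<in> ?Q" and e: "z = p \<otimes> (z [^] (b * k)) \<otimes> (w [^] k)"
    using split[of z] by blast
  \<comment> \<open>Moving \<open>z [^] (b * k)\<close> to the left turns the relation for
    \<open>z\<close> into one for \<open>z [^] s\<close>. Since \<open>s\<close> is 1 modulo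
    \<open>k\<close>, it plays the part of a unit at \<open>k\<close>.\<close>
  define s where "s = 1 - b * k"
  have pc: "p \<in> carrier G" and wc: "w \<in> carrier G" using p w Pc Qc by auto
  have zs: "z [^] s = p \<otimes> (w [^] k)"
  proof -
    have "z [^] s = z \<otimes> inv (z [^] (b * k))" using z by (simp add: s_def int_pow_diff)
    also have "\<dots> = p \<otimes> (z [^] (b * k)) \<otimes> (w [^] k) \<otimes> inv (z [^] (b * k))" using e by simp
    also have "\<dots> = p \<otimes> (w [^] k) \<otimes> ((z [^] (b * k)) \<otimes> inv (z [^] (b * k)))"
      using pc wc z by (simp add: m_ac)
    finally show ?thesis using pc wc z by simp
  qed
  \<comment> \<open>The \<open>s\<close>-th power of the relation for \<open>t\<close> contains
    \<open>z\<close> only through \<open>z [^] s\<close>, which can be replaced. The missing factor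
    \<open>t [^] (b * k)\<close> is itself a \<open>k\<close>-th power, and
    \<open>s + b * k = 1\<close>.\<close>
  have IH: "\<exists>q\<in>P. \<exists>v\<in>?Q. t = q \<otimes> v [^] k" if t: "t \<in> Z" for t
  proof -
    obtain p1 c w1 where p1: "p1 \<in> P" and w1: "w1 \<in> ?Q"
      and e1: "t = p1 \<otimes> (z [^] (c * k)) \<otimes> (w1 [^] k)"
      using split[of t] t by blast
    have cc: "p1 \<in> carrier G" "w1 \<in> carrier G" "t \<in> carrier G" using p1 w1 Pc Qc t PZ by auto
    have tQ: "t \<in> ?Q" using t by (simp add: generate.incl)
    have "t = t [^] s \<otimes> t [^] (b * k)"
      using cc by (simp add: int_pow_mult[symmetric] s_def)
    also have "t [^] s = p1 [^] s \<otimes> ((z [^] s) [^] (c * k)) \<otimes> ((w1 [^] s) [^] k)"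
      using cc z by (subst e1) (simp add: int_pow_distrib int_pow_pow mult.commute)
    also have "\<dots> = p1 [^] s \<otimes> ((p [^] (c * k)) \<otimes> (((w [^] c) [^] k) [^] k)) \<otimes> ((w1 [^] s) [^] k)"
      using cc pc wc by (simp add: zs int_pow_distrib int_pow_pow ac_simps)
    also have "\<dots> \<otimes> t [^] (b * k) =
      (p1 [^] s \<otimes> p [^] (c * k)) \<otimes> ((w [^] c) [^] k \<otimes> w1 [^] s \<otimes> t [^] b) [^] k"
      using cc pc wc by (simp add: int_pow_distrib int_pow_pow m_ac)
    finally have "t = (p1 [^] s \<otimes> p [^] (c * k)) \<otimes> ((w [^] c) [^] k \<otimes> w1 [^] s \<otimes> t [^] b) [^] k" .
    moreover have "p1 [^] s \<otimes> p [^] (c * k) \<in> P"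
      using p p1 P by (simp add: subgroup_int_pow_closed subgroup.m_closed)
    moreover have "(w [^] c) [^] k \<otimes> w1 [^] s \<otimes> t [^] b \<in> ?Q"
      using w w1 tQ Q by (simp add: subgroup_int_pow_closed subgroup.m_closed)
    ultimately show ?thesis by blast
  qed
  obtain r where r: "k dvd r - 1" "\<forall>t\<in>Z. t [^] r \<in> P"
    using insert.IH[OF _ IH] insert.prems(1) by auto
  have rQ: "v [^] r \<in> P" if "v \<in> ?Q" for v
    by (rule generate_pow_in_subgroup[OF P PZ _ that]) (use r P in \<open>auto simp: subgroup_int_pow_closed\<close>)
  have "z [^] (s * r) = (p [^] r) \<otimes> ((w [^] r) [^] k)"
    using pc wc z by (simp add: int_pow_pow[symmetric] zs int_pow_distrib)
      (simp add: int_pow_pow mult.commute)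
  also have "\<dots> \<in> P"
    using rQ[OF w] p P by (simp add: subgroup_int_pow_closed subgroup.m_closed)
  finally have "z [^] (s * r) \<in> P" .
  moreover have "t [^] (s * r) \<in> P" if "t \<in> Z" for t
  proof -
    have "t [^] (s * r) = (t [^] r) [^] s" using that PZ by (auto simp: int_pow_pow mult.commute subset_iff)
    then show ?thesis using r that P by (simp add: subgroup_int_pow_closed)
  qed
  moreover have "k dvd s * r - 1"
  proof -
    have "s * r - 1 = (r - 1) - k * (b * r)" by (simp add: s_def algebra_simps)
    then show ?thesis using r by (metis dvd_diff dvd_triv_left)
  qed
  ultimately show ?case by blast
qed

text \<open>The property of the action on \<open>\<int>\<^sup>n\<close> that makes a lattice locally isomorphic to it at \<open>k\<close>
  isomorphic to it: invariant sublattices of index prime to \<open>k\<close> are images of equivariant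
  diagonal matrices.\<close>

definition diagonal_sublattices ::
  "nat \<Rightarrow> nat \<Rightarrow> (nat \<Rightarrow> (nat \<Rightarrow> int) \<Rightarrow> nat \<Rightarrow> int) \<Rightarrow> nat \<Rightarrow> bool" where
  "diagonal_sublattices n d act k \<longleftrightarrow>
    (\<forall>U r. U \<subseteq> zvec n \<and> (\<forall>u\<in>U. \<forall>v\<in>U. (\<lambda>i. u i + v i) \<in> U) \<and>
      (\<forall>u\<in>U. (\<lambda>i. - u i) \<in> U) \<and> (\<forall>j<d. \<forall>u\<in>U. act j u \<in> U) \<and>
      coprime r (int k) \<and> (\<forall>u\<in>zvec n. (\<lambda>i. r * u i) \<in> U) \<longrightarrow>
      (\<exists>g. (\<forall>i<n. g i \<noteq> 0) \<and> U = {u \<in> zvec n. \<forall>i<n. g i dvd u i} \<and>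
        (\<forall>j<d. \<forall>u\<in>zvec n. act j (\<lambda>i. g i * u i) = (\<lambda>i. g i * act j u i))))"

text \<open>What the sentences provide in \<open>H\<close>: \<open>A\<close> is the definable
  lattice and \<open>c j\<close> is conjugation by the \<open>j\<close>-th element of the
  complement. The action \<open>act\<close> on integer vectors is exact, but \<open>c\<close>
  follows it on \<open>y\<close> only up to \<open>d * k\<close>-th powers; likewise
  \<open>y\<close> generates only modulo \<open>d * k\<close> and is independent only modulo
  \<open>k\<close>.\<close>

locale mod_lattice = comm_group A for A (structure) +
  fixes n d k :: nat and act :: "nat \<Rightarrow> (nat \<Rightarrow> int) \<Rightarrow> nat \<Rightarrow> int" and mu :: "nat \<Rightarrow> nat \<Rightarrow> nat"
    and iv :: "nat \<Rightarrow> nat" and c :: "nat \<Rightarrow> 'a \<Rightarrow> 'a" and y :: "nat \<Rightarrow> 'a"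
  assumes k: "2 \<le> k" and d: "0 < d"
    and y [simp]: "i < n \<Longrightarrow> y i \<in> carrier A"
    and c_hom: "j < d \<Longrightarrow> c j \<in> hom A A"
    and c_comp: "i < d \<Longrightarrow> j < d \<Longrightarrow> v \<in> carrier A \<Longrightarrow> c i (c j v) = c (mu i j) v"
    and mu_bij: "i < d \<Longrightarrow> bij_betw (mu i) {..<d} {..<d}"
    and c_y: "j < d \<Longrightarrow> i < n \<Longrightarrow>
      \<exists>v\<in>carrier A. c j (y i) = zprod A y (act j (unitv i)) n \<otimes> (v [^] (d * k))"
    and act_zvec [simp]: "j < d \<Longrightarrow> u \<in> zvec n \<Longrightarrow> act j u \<in> zvec n"
    and act_add: "j < d \<Longrightarrow> u \<in> zvec n \<Longrightarrow> u' \<in> zvec n \<Longrightarrow>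
      act j (\<lambda>i. u i + u' i) = (\<lambda>i. act j u i + act j u' i)"
    and act_mu: "i < d \<Longrightarrow> j < d \<Longrightarrow> u \<in> zvec n \<Longrightarrow> act i (act j u) = act (mu i j) u"
    and iv [simp]: "j < d \<Longrightarrow> iv j < d"
    and act_iv: "j < d \<Longrightarrow> u \<in> zvec n \<Longrightarrow> act j (act (iv j) u) = u"
    and iv_act: "j < d \<Longrightarrow> u \<in> zvec n \<Longrightarrow> act (iv j) (act j u) = u"
    and spanning: "v \<in> carrier A \<Longrightarrow>
      \<exists>w\<in>carrier A. \<exists>a\<in>residue_box n (d * k). v = zprod A y a n \<otimes> (w [^] (d * k))"
    and indep: "a \<in> residue_box n k \<Longrightarrow> w \<in> carrier A \<Longrightarrow> zprod A y a n = w [^] k \<Longrightarrow> a = (\<lambda>_. 0)"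
    and tf: "v \<in> carrier A \<Longrightarrow> 0 < p \<Longrightarrow> v [^] (p::nat) = \<one> \<Longrightarrow> v = \<one>"
    and fg: "\<exists>X. finite X \<and> X \<subseteq> carrier A \<and> generate A X = carrier A"
begin

lemma zprod_y [simp]: "zprod A y u n \<in> carrier A" by simp

lemma c_closed [simp]: "j < d \<Longrightarrow> v \<in> carrier A \<Longrightarrow> c j v \<in> carrier A"
  using c_hom by (auto simp: hom_def)

lemma c_mult: "j < d \<Longrightarrow> v \<in> carrier A \<Longrightarrow> w \<in> carrier A \<Longrightarrow> c j (v \<otimes> w) = c j v \<otimes> c j w"
  using c_hom by (auto simp: hom_def)

lemma c_group_hom: "j < d \<Longrightarrow> group_hom A A (c j)"
  using c_hom by (simp add: group_hom_def group_hom_axioms_def)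

lemma c_pow: "j < d \<Longrightarrow> v \<in> carrier A \<Longrightarrow> c j (v [^] (m::nat)) = c j v [^] m"
  by (rule group_hom.hom_nat_pow[OF c_group_hom])

lemma c_int_pow: "j < d \<Longrightarrow> v \<in> carrier A \<Longrightarrow> c j (v [^] (m::int)) = c j v [^] m"
  by (rule group_hom.hom_int_pow[OF c_group_hom])

lemma c_inv: "j < d \<Longrightarrow> v \<in> carrier A \<Longrightarrow> c j (inv v) = inv c j v"
  by (rule group_hom.hom_inv[OF c_group_hom])

lemma c_one: "j < d \<Longrightarrow> c j \<one> = \<one>"
  by (rule group_hom.hom_one[OF c_group_hom])

lemma pow_inject:
  assumes "v \<in> carrier A" "w \<in> carrier A" "0 < p" "v [^] (p::nat) = w [^] p"
  shows "v = w"
proof -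
  have p: "(v \<otimes> inv w) [^] p = \<one>"
    using assms by (simp add: pow_mult_distrib m_comm nat_pow_inv)
  have "v \<otimes> inv w = \<one>" by (rule tf[OF _ _ p]) (use assms in auto)
  then show ?thesis using assms by (metis inv_closed inv_equality inv_inv)
qed

lemma int_pow_inject:
  assumes v: "v \<in> carrier A" "w \<in> carrier A" and "r \<noteq> 0" "v [^] (r::int) = w [^] r"
  shows "v = w"
proof (cases "r > 0")
  case True
  then have p: "v [^] nat r = w [^] nat r" using assms True by simp
  show ?thesis by (rule pow_inject[OF v _ p]) (use True in simp)
next
  case False
  have "v [^] (- r) = w [^] (- r)" using assms by (simp add: int_pow_neg)
  then have p: "v [^] nat (- r) = w [^] nat (- r)" using False by simp
  show ?thesis by (rule pow_inject[OF v _ p]) (use False assms in simp)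
qed

definition ph :: "(nat \<Rightarrow> int) \<Rightarrow> 'a" where "ph u = zprod A y u n"

lemma ph_closed [simp]: "ph u \<in> carrier A" by (simp add: ph_def)
lemma ph_add: "ph (\<lambda>i. u i + v i) = ph u \<otimes> ph v" by (simp add: ph_def zprod_add)
lemma ph_zero: "ph (\<lambda>_. 0) = \<one>" by (simp add: ph_def)
lemma ph_neg: "ph (\<lambda>i. - u i) = inv (ph u)"
  using ph_add[of "\<lambda>i. - u i" u] ph_zero by (simp add: inv_equality)
lemma ph_unitv: "i < n \<Longrightarrow> ph (unitv i) = y i" by (simp add: ph_def zprod_unitv)

lemma act_neg:
  assumes "j < d" "u \<in> zvec n" shows "act j (\<lambda>i. - u i) = (\<lambda>i. - act j u i)"
proof -
  have z: "act j (\<lambda>_. 0) = (\<lambda>_. 0)" using act_add[OF assms(1), of "\<lambda>_. 0" "\<lambda>_. 0"]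
    by (simp add: fun_eq_iff)
  have "(\<lambda>i. act j u i + act j (\<lambda>i. - u i) i) = (\<lambda>_. 0)"
    using act_add[OF assms zvec_neg[OF assms(2)]] z by simp
  then have "act j u i + act j (\<lambda>i. - u i) i = 0" for i by metis
  then show ?thesis by (simp add: fun_eq_iff eq_neg_iff_add_eq_0 add.commute)
qed

lemma act_zero: "j < d \<Longrightarrow> act j (\<lambda>_. 0) = (\<lambda>_. 0)"
  using act_add[of j "\<lambda>_. 0" "\<lambda>_. 0"] by (simp add: fun_eq_iff)

text \<open>The congruence passes from basis vectors to all vectors because both sides are additive
  in \<open>u\<close> and, \<open>A\<close> being abelian, the \<open>d * k\<close>-th powers form a
  subgroup.\<close>

lemma c_ph:
  assumes "j < d" "u \<in> zvec n"
  shows "\<exists>v\<in>carrier A. c j (ph u) = ph (act j u) \<otimes> (v [^] (d * k))"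
  using assms(2)
proof (induction rule: zvec_induct)
  case zero
  show ?case using assms by (intro bexI[of _ \<one>]) (simp_all add: ph_zero act_zero c_one)
next
  case (unitv i)
  then show ?case using c_y[OF assms(1)] by (simp add: ph_unitv) (simp add: ph_def)
next
  case (add u v)
  then obtain a b where a: "a \<in> carrier A" "c j (ph u) = ph (act j u) \<otimes> (a [^] (d * k))"
    and b: "b \<in> carrier A" "c j (ph v) = ph (act j v) \<otimes> (b [^] (d * k))" by blast
  then show ?case using add(1,2) assms(1)
    by (intro bexI[of _ "a \<otimes> b"]) (simp_all add: act_add ph_add c_mult pow_mult_distrib m_comm m_ac)
next
  case (neg u)
  then obtain a where a: "a \<in> carrier A" "c j (ph u) = ph (act j u) \<otimes> (a [^] (d * k))" by blast
  then show ?case using neg(1) assms(1)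
    by (intro bexI[of _ "inv a"]) (simp_all add: act_neg ph_neg c_inv inv_mult nat_pow_inv)
qed

section \<open>Averaging the lift of the basis\<close>

text \<open>The sum of all conjugates of the homomorphism \<open>ph\<close> under the finite group,
  acting on source and target at once; such a sum is equivariant.\<close>

definition avg :: "(nat \<Rightarrow> int) \<Rightarrow> 'a" where
  "avg u = finprod A (\<lambda>j. c j (ph (act (iv j) u))) {..<d}"

lemma avg_closed [simp]: "u \<in> zvec n \<Longrightarrow> avg u \<in> carrier A"
  unfolding avg_def by (intro finprod_closed) auto

lemma avg_add:
  assumes "u \<in> zvec n" "v \<in> zvec n"
  shows "avg (\<lambda>i. u i + v i) = avg u \<otimes> avg v"
proof -
  let ?f = "\<lambda>u j. c j (ph (act (iv j) u))"
  have c: "?f u \<in> {..<d} \<rightarrow> carrier A" for u by auto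
  have "avg (\<lambda>i. u i + v i) = finprod A (\<lambda>j. ?f u j \<otimes> ?f v j) {..<d}"
    unfolding avg_def using assms by (intro finprod_cong') (auto simp: act_add ph_add c_mult)
  also have "\<dots> = avg u \<otimes> avg v"
    unfolding avg_def by (rule finprod_multf) (rule c)+
  finally show ?thesis .
qed

lemma c_finprod:
  assumes "j < d" "finite I" "\<And>i. i \<in> I \<Longrightarrow> f i \<in> carrier A"
  shows "c j (finprod A f I) = finprod A (\<lambda>i. c j (f i)) I"
  using assms(2,3)
proof (induction I rule: finite_induct)
  case (insert i I)
  have "c j (finprod A f (insert i I)) = c j (f i \<otimes> finprod A f I)"
    using insert by (subst finprod_insert) auto
  also have "\<dots> = c j (f i) \<otimes> c j (finprod A f I)"
    using insert assms(1) by (intro c_mult finprod_closed) auto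
  also have "\<dots> = finprod A (\<lambda>i. c j (f i)) (insert i I)"
    using insert assms(1) by (subst finprod_insert) auto
  finally show ?case .
qed (simp add: c_one assms)

lemma c_avg:
  assumes m: "m < d" and u: "u \<in> zvec n"
  shows "c m (avg u) = avg (act m u)"
proof -
  \<comment> \<open>The inverse of a product is not given by a formula here: \<open>iv\<close> is
    known only through its action, so the equality comes from cancelling \<open>m\<close> and then
    \<open>j\<close>.\<close>
  have iv_eq: "act (iv (mu m j)) (act m u) = act (iv j) u" if j: "j < d" for j
  proof -
    have mj: "mu m j < d" using mu_bij[OF m] j by (auto simp: bij_betw_def)
    let ?z = "act (iv (mu m j)) (act m u)"
    have "act m (act j ?z) = act m u" using m j mj u by (simp add: act_mu[of m j] act_iv)
    then have "act j ?z = u" using iv_act[OF m, of "act j ?z"] iv_act[OF m, of u] m j mj u by simp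
    then show ?thesis using iv_act[OF j, of ?z] m mj u by simp
  qed
  have "c m (avg u) = finprod A (\<lambda>j. c m (c j (ph (act (iv j) u)))) {..<d}"
    unfolding avg_def using m by (intro c_finprod) auto
  also have "\<dots> = finprod A (\<lambda>j. c (mu m j) (ph (act (iv (mu m j)) (act m u)))) {..<d}"
  proof (intro finprod_cong')
    show "(\<lambda>j. c (mu m j) (ph (act (iv (mu m j)) (act m u)))) \<in> {..<d} \<rightarrow> carrier A"
      using mu_bij[OF m] by (auto simp: bij_betw_def intro!: c_closed)
  qed (auto simp: iv_eq c_comp m)
  also have "\<dots> = finprod A (\<lambda>j. c j (ph (act (iv j) (act m u)))) (mu m ` {..<d})"
    using mu_bij[OF m] by (subst finprod_reindex) (auto simp: bij_betw_def)
  also have "mu m ` {..<d} = {..<d}" using mu_bij[OF m] by (simp add: bij_betw_def)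
  finally show ?thesis by (simp add: avg_def)
qed

lemma finprod_mod_power:
  fixes m :: nat
  assumes "finite I" "p \<in> carrier A" "\<And>i. i \<in> I \<Longrightarrow> \<exists>v\<in>carrier A. f i = p \<otimes> (v [^] m)"
  shows "\<exists>v\<in>carrier A. finprod A f I = (p [^] card I) \<otimes> (v [^] m)"
  using assms(1,3)
proof (induction I rule: finite_induct)
  case empty
  then show ?case by (intro bexI[of _ \<one>]) auto
next
  case (insert i I)
  obtain v w where v: "v \<in> carrier A" "f i = p \<otimes> (v [^] m)"
    and w: "w \<in> carrier A" "finprod A f I = (p [^] card I) \<otimes> (w [^] m)"
    using insert by (metis insertCI)
  have fc: "f \<in> I \<rightarrow> carrier A" "f i \<in> carrier A"
    using insert.prems assms(2) by (fastforce intro: m_closed)+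
  have "finprod A f (insert i I) = f i \<otimes> finprod A f I"
    using insert fc by (intro finprod_insert) auto
  also have "\<dots> = (p [^] card (insert i I)) \<otimes> ((v \<otimes> w) [^] m)"
    using v w assms(2) insert by (simp add: pow_mult_distrib m_comm m_ac)
  finally show ?case using v w by blast
qed

text \<open>Each of the \<open>d\<close> factors of the average is \<open>ph u\<close> up to a
  \<open>d * k\<close>-th power. The factor \<open>d\<close> in this exponent is what allows a
  \<open>d\<close>-th root to be taken, with an error that is still a \<open>k\<close>-th
  power.\<close>

lemma root_exists:
  assumes u: "u \<in> zvec n"
  shows "\<exists>v\<in>carrier A. (ph u \<otimes> (v [^] k)) [^] d = avg u"
proof -
  have "\<exists>v\<in>carrier A. c j (ph (act (iv j) u)) = ph u \<otimes> (v [^] (d * k))" if "j \<in> {..<d}" for j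
    using c_ph[of j "act (iv j) u"] that u by (simp add: act_iv)
  from finprod_mod_power[of "{..<d}" "ph u" "\<lambda>j. c j (ph (act (iv j) u))" "d * k", OF _ _ this]
  obtain v where v: "v \<in> carrier A" "avg u = (ph u [^] d) \<otimes> (v [^] (d * k))"
    unfolding avg_def by auto
  then show ?thesis
    by (intro bexI[of _ v]) (simp_all add: pow_mult_distrib m_comm nat_pow_pow mult.commute)
qed

text \<open>The average divided by \<open>d\<close>. Torsion-freeness makes the root unique, and
  uniqueness alone yields additivity and equivariance.\<close>

definition eqv :: "(nat \<Rightarrow> int) \<Rightarrow> 'a" where
  "eqv u = (THE w. w \<in> carrier A \<and> w [^] d = avg u)"

lemma eqv_unique: "w \<in> carrier A \<Longrightarrow> w [^] d = avg u \<Longrightarrow> eqv u = w"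
  unfolding eqv_def using d by (intro the_equality) (simp, metis pow_inject)

lemma eqv_mod: "u \<in> zvec n \<Longrightarrow> \<exists>v\<in>carrier A. eqv u = ph u \<otimes> (v [^] k)"
  using root_exists[of u] by (metis eqv_unique ph_closed m_closed nat_pow_closed)

lemma eqv_closed [simp]: "u \<in> zvec n \<Longrightarrow> eqv u \<in> carrier A"
  using eqv_mod[of u] by auto

lemma eqv_pow: "u \<in> zvec n \<Longrightarrow> eqv u [^] d = avg u"
  using root_exists[of u] by (metis eqv_unique ph_closed m_closed nat_pow_closed)

lemma eqv_add:
  assumes "u \<in> zvec n" "v \<in> zvec n"
  shows "eqv (\<lambda>i. u i + v i) = eqv u \<otimes> eqv v"
  using assms by (intro eqv_unique) (simp_all add: pow_mult_distrib m_comm eqv_pow avg_add)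

lemma c_eqv:
  assumes "j < d" "u \<in> zvec n"
  shows "c j (eqv u) = eqv (act j u)"
  using assms by (intro eqv_unique[symmetric]) (simp_all add: c_pow[symmetric] eqv_pow c_avg)

lemma eqv_zero: "eqv (\<lambda>_. 0) = \<one>"
  using eqv_add[of "\<lambda>_. 0" "\<lambda>_. 0"] eqv_closed[OF zvec_zero] by simp

lemma eqv_neg: "u \<in> zvec n \<Longrightarrow> eqv (\<lambda>i. - u i) = inv (eqv u)"
  using eqv_add[of "\<lambda>i. - u i" u] eqv_zero by (simp add: inv_equality zvec_neg)

lemma eqv_scale_nat:
  assumes "u \<in> zvec n" shows "eqv (\<lambda>i. int m * u i) = eqv u [^] m"
proof (induction m)
  case (Suc m)
  have "eqv (\<lambda>i. int m * u i + u i) = eqv (\<lambda>i. int m * u i) \<otimes> eqv u"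
    using assms by (intro eqv_add zvec_scale)
  then show ?case using Suc by (simp add: algebra_simps)
qed (simp add: eqv_zero)

lemma eqv_scale:
  assumes "u \<in> zvec n" shows "eqv (\<lambda>i. r * u i) = eqv u [^] (r::int)"
proof (cases "r \<ge> 0")
  case True
  then show ?thesis using eqv_scale_nat[OF assms, of "nat r"] by simp
next
  case False
  then have "r = - int (nat (- r))" by simp
  then obtain m where r: "r = - int m" by blast
  have "eqv (\<lambda>i. - (int m * u i)) = inv (eqv u [^] m)"
    using assms by (simp add: eqv_neg zvec_scale eqv_scale_nat)
  then show ?thesis using assms by (simp add: r int_pow_neg_int)
qed

text \<open>A kernel element is divisible by \<open>k\<close> in the kernel, hence zero by infinite descent.\<close>

lemma eqv_trivial_kernel:
  assumes "u \<in> zvec n" "eqv u = \<one>"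
  shows "u = (\<lambda>_. 0)"
  using assms
proof (induction "\<Sum>i<n. nat \<bar>u i\<bar>" arbitrary: u rule: less_induct)
  case less
  obtain a v where a: "a \<in> residue_box n k" and v: "v \<in> zvec n" and u: "u = (\<lambda>i. a i + int k * v i)"
    using zvec_div_mod[OF less.prems(1), of k] k by auto
  have az: "a \<in> zvec n" using a by (rule residue_box_zvec)
  obtain w where w: "w \<in> carrier A" "eqv a = ph a \<otimes> (w [^] k)" using eqv_mod[OF az] by blast
  have e: "eqv u = eqv a \<otimes> (eqv v [^] k)"
    using az v by (simp add: u eqv_add zvec_scale eqv_scale_nat)
  then have "ph a \<otimes> ((w \<otimes> eqv v) [^] k) = \<one>"
    using less.prems w v by (simp add: pow_mult_distrib m_comm m_ac)
  then have "ph a = (inv (w \<otimes> eqv v)) [^] k"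
    using w v by (simp add: nat_pow_inv inv_equality[symmetric] del: inv_mult)
  then have a0: "a = (\<lambda>_. 0)" using w v by (intro indep[OF a]) (auto simp: ph_def)
  then have "eqv v [^] k = \<one>" using e less.prems v by (simp add: eqv_zero)
  then have ev: "eqv v = \<one>" using v k tf[of "eqv v" k] by simp
  show ?case
  proof (rule ccontr)
    assume u0: "u \<noteq> (\<lambda>_. 0)"
    then obtain i where "u i \<noteq> 0" by auto
    then have i: "v i \<noteq> 0" "i < n" using v by (auto simp: u a0 zvec_def) (meson leI)
    have "(\<Sum>i<n. nat \<bar>v i\<bar>) < (\<Sum>i<n. nat \<bar>u i\<bar>)"
    proof (rule sum_strict_mono_ex1)
      have *: "nat \<bar>u j\<bar> = k * nat \<bar>v j\<bar>" for j by (simp add: u a0 abs_mult nat_mult_distrib)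
      show "\<forall>j\<in>{..<n}. nat \<bar>v j\<bar> \<le> nat \<bar>u j\<bar>" using k by (simp add: *)
      show "\<exists>j\<in>{..<n}. nat \<bar>v j\<bar> < nat \<bar>u j\<bar>"
        using i k by (intro bexI[of _ i]) (auto simp: *)
    qed simp
    from less.hyps[OF this v ev] i show False by simp
  qed
qed

lemma eqv_inject:
  assumes "u \<in> zvec n" "v \<in> zvec n" "eqv u = eqv v"
  shows "u = v"
proof -
  have "eqv (\<lambda>i. u i + - v i) = \<one>"
    using eqv_add[OF assms(1) zvec_neg[OF assms(2)]] assms by (simp add: eqv_neg)
  then have "(\<lambda>i. u i + - v i) = (\<lambda>_. 0)"
    using assms by (intro eqv_trivial_kernel zvec_add zvec_neg)
  then show ?thesis by (simp add: fun_eq_iff)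
qed

lemma eqv_image_subgroup: "subgroup (eqv ` zvec n) A"
proof (rule subgroupI)
  show "eqv ` zvec n \<noteq> {}" using zvec_zero by blast
  show "inv a \<in> eqv ` zvec n" if "a \<in> eqv ` zvec n" for a
    using that by (auto simp: eqv_neg[symmetric] intro!: imageI zvec_neg)
  show "a \<otimes> b \<in> eqv ` zvec n" if "a \<in> eqv ` zvec n" "b \<in> eqv ` zvec n" for a b
    using that by (auto simp: eqv_add[symmetric] intro!: imageI zvec_add)
qed auto

section \<open>The index of the equivariant image and the isomorphism\<close>

text \<open>Modulo \<open>k\<close>-th powers \<open>eqv\<close> agrees with \<open>ph\<close>, so
  its image and the \<open>k\<close>-th powers together fill \<open>A\<close>. Nakayama's lemma then
  bounds the cokernel by an exponent that is 1 modulo \<open>k\<close>.\<close>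

lemma power_in_image: "\<exists>r. int k dvd r - 1 \<and> (\<forall>v\<in>carrier A. v [^] r \<in> eqv ` zvec n)"
proof -
  obtain X where X: "finite X" "X \<subseteq> carrier A" "generate A X = carrier A" using fg by blast
  let ?P = "eqv ` zvec n"
  have Pc: "?P \<subseteq> carrier A" by auto
  have g: "carrier A \<subseteq> generate A (?P \<union> X)"
    using X mono_generate[of X "?P \<union> X"] by auto
  have "\<exists>p\<in>?P. \<exists>w\<in>generate A (?P \<union> X). z = p \<otimes> w [^] int k" if "z \<in> X" for z
  proof -
    have "z \<in> carrier A" using X(2) that by blast
    from spanning[OF this] obtain w a where w: "w \<in> carrier A" and a: "a \<in> residue_box n (d * k)"
      and z: "z = zprod A y a n \<otimes> (w [^] (d * k))"
      by (elim bexE)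
    have az: "a \<in> zvec n" using a by (rule residue_box_zvec)
    obtain v where v: "v \<in> carrier A" "eqv a = ph a \<otimes> (v [^] k)" using eqv_mod[OF az] by blast
    have cancel: "p \<otimes> q = p \<otimes> t \<otimes> (inv t \<otimes> q)"
      if "p \<in> carrier A" "q \<in> carrier A" "t \<in> carrier A" for p q t
    proof -
      have "p \<otimes> t \<otimes> (inv t \<otimes> q) = p \<otimes> (t \<otimes> inv t) \<otimes> q"
        using that by (simp only: m_assoc m_closed inv_closed)
      then show ?thesis using that by simp
    qed
    have "z = eqv a \<otimes> (inv (v [^] k) \<otimes> (w [^] (d * k)))"
      unfolding z v(2) ph_def using v(1) w by (intro cancel) auto
    also have "inv (v [^] k) = inv v [^] k" using v by (simp only: nat_pow_inv)
    finally have "z = eqv a \<otimes> (inv v [^] k \<otimes> (w [^] (d * k)))" .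
    also have "inv v [^] k \<otimes> (w [^] (d * k)) = (inv v \<otimes> (w [^] d)) [^] k"
      using v w by (simp add: pow_mult_distrib m_comm nat_pow_pow)
    finally have "z = eqv a \<otimes> (inv v \<otimes> (w [^] d)) [^] int k"
      by (simp only: int_pow_int)
    moreover have "inv v \<otimes> (w [^] d) \<in> generate A (?P \<union> X)" using v w g by auto
    ultimately show ?thesis using az by blast
  qed
  from nakayama[OF X(1) eqv_image_subgroup X(2) this]
  obtain r where r: "int k dvd r - 1" "\<forall>z\<in>X. z [^] r \<in> ?P" by blast
  have "v [^] r \<in> ?P" if "v \<in> carrier A" for v
    using generate_pow_in_subgroup[OF eqv_image_subgroup X(2), of r v] r X that by auto
  then show ?thesis using r by blast
qed

text \<open>The map \<open>v \<mapsto> v [^] r\<close> embeds \<open>A\<close> equivariantly into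
  the image of \<open>eqv\<close>, hence into the integer vectors; its image there is invariant and
  contains all multiples of \<open>r\<close>, so \<open>diagonal_sublattices\<close> straightens
  it.\<close>

theorem equivariant_iso:
  assumes "diagonal_sublattices n d act k"
  shows "\<exists>\<theta>. (\<forall>u\<in>zvec n. \<forall>v\<in>zvec n. \<theta> (\<lambda>i. u i + v i) = \<theta> u \<otimes> \<theta> v) \<and>
    bij_betw \<theta> (zvec n) (carrier A) \<and> (\<forall>j<d. \<forall>u\<in>zvec n. c j (\<theta> u) = \<theta> (act j u))"
proof -
  obtain r where r: "int k dvd r - 1" and rP: "\<And>v. v \<in> carrier A \<Longrightarrow> v [^] r \<in> eqv ` zvec n"
    using power_in_image by blast
  have r0: "r \<noteq> 0" using r k by (auto dest: zdvd_imp_le)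
  have cop: "coprime r (int k)"
  proof (rule coprimeI)
    fix q assume q: "q dvd r" "q dvd int k"
    have "r - (r - 1) = 1" by simp
    then show "is_unit q" using q r by (metis dvd_diff dvd_trans)
  qed
  \<comment> \<open>The lattice \<open>A\<close>, seen inside the integer vectors after taking
    \<open>r\<close>-th powers.\<close>
  define U where "U = {u \<in> zvec n. \<exists>v\<in>carrier A. eqv u = v [^] r}"
  have "U \<subseteq> zvec n" by (auto simp: U_def)
  moreover have "(\<lambda>i. u i + v i) \<in> U" if uv: "u \<in> U" "v \<in> U" for u v
  proof -
    obtain a b where "a \<in> carrier A" "b \<in> carrier A" "eqv u = a [^] r" "eqv v = b [^] r"
      using uv by (auto simp: U_def)
    then show ?thesis using uv unfolding U_def
      by (auto simp: eqv_add zvec_add int_pow_distrib intro!: bexI[of _ "a \<otimes> b"])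
  qed
  moreover have "(\<lambda>i. - u i) \<in> U" if uv: "u \<in> U" for u
  proof -
    obtain a where "a \<in> carrier A" "eqv u = a [^] r" using uv by (auto simp: U_def)
    then show ?thesis using uv unfolding U_def
      by (auto simp: eqv_neg zvec_neg int_pow_inv intro!: bexI[of _ "inv a"])
  qed
  moreover have "act j u \<in> U" if uv: "j < d" "u \<in> U" for j u
  proof -
    obtain a where "a \<in> carrier A" "eqv u = a [^] r" using uv by (auto simp: U_def)
    then show ?thesis using uv unfolding U_def
      by (auto simp: c_eqv[symmetric] c_int_pow intro!: bexI[of _ "c j a"])
  qed
  moreover have "(\<lambda>i. r * u i) \<in> U" if "u \<in> zvec n" for u
    using that unfolding U_def by (auto simp: eqv_scale zvec_scale)
  ultimately have "U \<subseteq> zvec n \<and> (\<forall>u\<in>U. \<forall>v\<in>U. (\<lambda>i. u i + v i) \<in> U) \<and>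
      (\<forall>u\<in>U. (\<lambda>i. - u i) \<in> U) \<and> (\<forall>j<d. \<forall>u\<in>U. act j u \<in> U) \<and>
      coprime r (int k) \<and> (\<forall>u\<in>zvec n. (\<lambda>i. r * u i) \<in> U)"
    using cop by (intro conjI ballI allI impI)
  from assms[unfolded diagonal_sublattices_def, THEN spec, THEN spec, THEN mp, OF this]
  obtain g where g: "\<forall>i<n. g i \<noteq> 0" and U: "U = {u \<in> zvec n. \<forall>i<n. g i dvd u i}"
    and g_act: "\<And>j u. j < d \<Longrightarrow> u \<in> zvec n \<Longrightarrow> act j (\<lambda>i. g i * u i) = (\<lambda>i. g i * act j u i)"
    by blast
  \<comment> \<open>Scale by the diagonal matrix into \<open>U\<close>, apply \<open>eqv\<close>,
    then take the unique \<open>r\<close>-th root.\<close>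
  define \<theta> where "\<theta> u = (THE v. v \<in> carrier A \<and> v [^] r = eqv (\<lambda>i. g i * u i))" for u
  have \<theta>_eq: "\<theta> u = v" if "v \<in> carrier A" "v [^] r = eqv (\<lambda>i. g i * u i)" for u v
    unfolding \<theta>_def using that r0 by (intro the_equality) (simp, metis int_pow_inject)
  have \<theta>: "\<theta> u \<in> carrier A \<and> \<theta> u [^] r = eqv (\<lambda>i. g i * u i)" if "u \<in> zvec n" for u
  proof -
    have "(\<lambda>i. g i * u i) \<in> U" using that by (simp add: U zvec_mult)
    then obtain v where "v \<in> carrier A" "eqv (\<lambda>i. g i * u i) = v [^] r" by (auto simp: U_def)
    then show ?thesis using \<theta>_eq by metis
  qed
  have gu: "(\<lambda>i. g i * u i) = (\<lambda>i. g i * v i) \<Longrightarrow> u = v" if "u \<in> zvec n" "v \<in> zvec n" for u v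
  proof
    fix i
    assume "(\<lambda>i. g i * u i) = (\<lambda>i. g i * v i)"
    then have "g i * u i = g i * v i" by meson
    then show "u i = v i" using g that by (cases "i < n") (auto simp: zvec_def)
  qed
  have "\<theta> (\<lambda>i. u i + v i) = \<theta> u \<otimes> \<theta> v" if "u \<in> zvec n" "v \<in> zvec n" for u v
    using \<theta>[OF that(1)] \<theta>[OF that(2)] that
    by (intro \<theta>_eq) (simp_all add: int_pow_distrib distrib_left eqv_add zvec_mult)
  moreover have "bij_betw \<theta> (zvec n) (carrier A)"
  proof (rule bij_betwI')
    show "(\<theta> u = \<theta> v) = (u = v)" if "u \<in> zvec n" "v \<in> zvec n" for u v
    proof
      assume "\<theta> u = \<theta> v"
      then have "eqv (\<lambda>i. g i * u i) = eqv (\<lambda>i. g i * v i)" using \<theta> that by metis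
      then have "(\<lambda>i. g i * u i) = (\<lambda>i. g i * v i)"
        using eqv_inject[OF zvec_mult[OF that(1)] zvec_mult[OF that(2)]] by blast
      then show "u = v" by (rule gu[OF that])
    qed simp
    show "\<theta> u \<in> carrier A" if "u \<in> zvec n" for u using \<theta> that by blast
    show "\<exists>u\<in>zvec n. v = \<theta> u" if v: "v \<in> carrier A" for v
    proof -
      obtain u where u: "u \<in> zvec n" "eqv u = v [^] r" using rP[OF v] by force
      then have "u \<in> U" using v by (auto simp: U_def)
      then have dv: "\<forall>i<n. g i dvd u i" by (simp add: U)
      define w where "w i = u i div g i" for i
      have w: "w \<in> zvec n" using u by (simp add: w_def zvec_def)
      have "(\<lambda>i. g i * w i) = u"
      proof
        show "g i * w i = u i" for i
          using dv u by (cases "i < n") (auto simp: w_def zvec_def)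
      qed
      then have "\<theta> w = v" using v u by (intro \<theta>_eq) auto
      then show ?thesis using w by blast
    qed
  qed
  moreover have "c j (\<theta> u) = \<theta> (act j u)" if "j < d" "u \<in> zvec n" for j u
    using \<theta>[OF that(2)] that
    by (intro \<theta>_eq[symmetric]) (simp_all add: c_int_pow[symmetric] c_eqv zvec_mult g_act)
  ultimately show ?thesis by blast
qed

end

section \<open>Groups split over a lattice\<close>

text \<open>A semidirect product in normal form \<open>th u \<otimes> x j\<close>. The index of the
  identity is left open, and the laws for \<open>act\<close> are not assumed: they follow from
  conjugation in \<open>G\<close>. The group is determined up to isomorphism by \<open>n\<close>,
  \<open>d\<close>, \<open>act\<close> and \<open>mu\<close>.\<close>

locale lattice_split = group G for G (structure) +
  fixes n d :: nat and th :: "(nat \<Rightarrow> int) \<Rightarrow> 'a" and x :: "nat \<Rightarrow> 'a"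
    and act :: "nat \<Rightarrow> (nat \<Rightarrow> int) \<Rightarrow> nat \<Rightarrow> int" and mu :: "nat \<Rightarrow> nat \<Rightarrow> nat"
  assumes th_closed [simp]: "u \<in> zvec n \<Longrightarrow> th u \<in> carrier G"
    and x_closed [simp]: "j < d \<Longrightarrow> x j \<in> carrier G"
    and th_add: "u \<in> zvec n \<Longrightarrow> v \<in> zvec n \<Longrightarrow> th (\<lambda>i. u i + v i) = th u \<otimes> th v"
    and mu_less [simp]: "i < d \<Longrightarrow> j < d \<Longrightarrow> mu i j < d"
    and x_mult: "i < d \<Longrightarrow> j < d \<Longrightarrow> x i \<otimes> x j = x (mu i j)"
    and one_x: "\<exists>j<d. x j = \<one>"
    and act_zvec [simp]: "j < d \<Longrightarrow> u \<in> zvec n \<Longrightarrow> act j u \<in> zvec n"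
    and x_th: "j < d \<Longrightarrow> u \<in> zvec n \<Longrightarrow> x j \<otimes> th u = th (act j u) \<otimes> x j"
    and split_inject: "u \<in> zvec n \<Longrightarrow> v \<in> zvec n \<Longrightarrow> i < d \<Longrightarrow> j < d \<Longrightarrow>
      th u \<otimes> x i = th v \<otimes> x j \<Longrightarrow> u = v \<and> i = j"
    and split_surj: "g \<in> carrier G \<Longrightarrow> \<exists>u\<in>zvec n. \<exists>j<d. g = th u \<otimes> x j"
begin

lemma th_zero: "th (\<lambda>_. 0) = \<one>"
  using th_add[of "\<lambda>_. 0" "\<lambda>_. 0"] th_closed[OF zvec_zero] by simp

lemma th_inject: "u \<in> zvec n \<Longrightarrow> v \<in> zvec n \<Longrightarrow> th u = th v \<Longrightarrow> u = v"
  using one_x split_inject by metis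

lemma x_inject: "i < d \<Longrightarrow> j < d \<Longrightarrow> x i = x j \<Longrightarrow> i = j"
  using split_inject[of "\<lambda>_. 0" "\<lambda>_. 0" i j] by simp

lemma th_neg: "u \<in> zvec n \<Longrightarrow> th (\<lambda>i. - u i) = inv (th u)"
  using th_add[of "\<lambda>i. - u i" u] th_zero by (simp add: inv_equality zvec_neg)

lemma th_scale_nat: "u \<in> zvec n \<Longrightarrow> th (\<lambda>i. int m * u i) = th u [^] m"
proof (induction m)
  case (Suc m)
  have "th (\<lambda>i. int m * u i + u i) = th (\<lambda>i. int m * u i) \<otimes> th u"
    using Suc.prems by (intro th_add zvec_scale)
  then show ?case using Suc by (simp add: algebra_simps)
qed (simp add: th_zero)

lemma th_scale:
  assumes "u \<in> zvec n" shows "th (\<lambda>i. r * u i) = th u [^] (r::int)"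
proof (cases "r \<ge> 0")
  case True
  then show ?thesis using th_scale_nat[OF assms, of "nat r"] by simp
next
  case False
  then have "r = - int (nat (- r))" by simp
  then obtain m where r: "r = - int m" by blast
  have "th (\<lambda>i. - (int m * u i)) = inv (th u [^] m)"
    using assms by (simp add: th_neg zvec_scale th_scale_nat)
  then show ?thesis using assms by (simp add: r int_pow_neg_int)
qed

lemma zprod_th:
  assumes "u \<in> zvec n"
  shows "zprod G (\<lambda>i. th (unitv i)) u n = th u"
proof -
  have "zprod G (\<lambda>i. th (unitv i)) u m = th (\<lambda>i. if i < m then u i else 0)" if "m \<le> n" for m
    using that
  proof (induction m)
    case (Suc m)
    have m: "unitv m \<in> zvec n" using Suc.prems by (simp add: zvec_unitv)
    have "th (\<lambda>i. (if i < m then u i else 0) + u m * unitv m i) =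
      th (\<lambda>i. if i < m then u i else 0) \<otimes> th (\<lambda>i. u m * unitv m i)"
      by (rule th_add[OF _ zvec_scale[OF m]]) (use Suc.prems in \<open>auto simp: zvec_def\<close>)
    moreover have "(\<lambda>i. (if i < m then u i else 0) + u m * unitv m i) =
      (\<lambda>i. if i < Suc m then u i else 0)"
      by (auto simp: unitv_def fun_eq_iff less_Suc_eq)
    ultimately show ?case using Suc by (simp add: th_scale m)
  qed (simp add: th_zero)
  from this[of n] have "zprod G (\<lambda>i. th (unitv i)) u n = th (\<lambda>i. if i < n then u i else 0)" by blast
  moreover have "(\<lambda>i. if i < n then u i else 0) = u"
    using assms by (auto simp: zvec_def fun_eq_iff)
  ultimately show ?thesis by simp
qed

lemma split_mult:
  assumes "u \<in> zvec n" "v \<in> zvec n" "i < d" "j < d"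
  shows "(th u \<otimes> x i) \<otimes> (th v \<otimes> x j) = th (\<lambda>l. u l + act i v l) \<otimes> x (mu i j)"
proof -
  have "(th u \<otimes> x i) \<otimes> (th v \<otimes> x j) = th u \<otimes> (x i \<otimes> th v) \<otimes> x j"
    using assms by (simp add: m_assoc)
  also have "\<dots> = (th u \<otimes> th (act i v)) \<otimes> (x i \<otimes> x j)"
    using assms by (simp add: x_th m_assoc)
  finally show ?thesis using assms by (simp add: th_add x_mult)
qed

lemma conj_th:
  assumes "j < d" "u \<in> zvec n" shows "x j \<otimes> th u \<otimes> inv (x j) = th (act j u)"
  using assms by (simp add: x_th m_assoc)

lemma act_add:
  assumes "j < d" "u \<in> zvec n" "v \<in> zvec n"
  shows "act j (\<lambda>i. u i + v i) = (\<lambda>i. act j u i + act j v i)"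
proof (rule th_inject)
  have "th (act j (\<lambda>i. u i + v i)) = x j \<otimes> (th u \<otimes> th v) \<otimes> inv (x j)"
    using assms conj_th[OF assms(1) zvec_add[OF assms(2,3)]] by (simp add: th_add)
  also have "\<dots> = (x j \<otimes> th u) \<otimes> (inv (x j) \<otimes> x j) \<otimes> (th v \<otimes> inv (x j))"
    using assms by (simp add: m_assoc)
  also have "\<dots> = (x j \<otimes> th u \<otimes> inv (x j)) \<otimes> (x j \<otimes> th v \<otimes> inv (x j))"
    using assms by (simp only: m_assoc m_closed inv_closed th_closed x_closed)
  finally show "th (act j (\<lambda>i. u i + v i)) = th (\<lambda>i. act j u i + act j v i)"
    using assms by (simp add: conj_th th_add)
qed (use assms in \<open>auto simp: zvec_add\<close>)

lemma act_mu:
  assumes "i < d" "j < d" "u \<in> zvec n"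
  shows "act i (act j u) = act (mu i j) u"
proof (rule th_inject)
  have "th (act i (act j u)) \<otimes> x (mu i j) = x i \<otimes> (th (act j u) \<otimes> x j)"
    using assms by (simp add: x_mult[symmetric] x_th m_assoc[symmetric])
  also have "\<dots> = (x i \<otimes> x j) \<otimes> th u" using assms by (simp add: x_th[symmetric] m_assoc)
  also have "\<dots> = th (act (mu i j) u) \<otimes> x (mu i j)" using assms by (simp add: x_mult x_th)
  finally show "th (act i (act j u)) = th (act (mu i j) u)" using assms by simp
qed (use assms in auto)

definition j0 :: nat where "j0 = (SOME j. j < d \<and> x j = \<one>)"

lemma j0 [simp]: "j0 < d" "x j0 = \<one>"
  using someI_ex[OF one_x] by (auto simp: j0_def)

lemma d_pos: "0 < d" using j0 by linarith

lemma mu_j0: "j < d \<Longrightarrow> mu j0 j = j" "j < d \<Longrightarrow> mu j j0 = j"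
  using x_mult[of j0 j] x_mult[of j j0] by (auto intro!: x_inject)

lemma act_j0: "u \<in> zvec n \<Longrightarrow> act j0 u = u"
  using x_th[of j0 u] by (intro th_inject) auto

lemma mu_bij:
  assumes "i < d" shows "bij_betw (mu i) {..<d} {..<d}"
proof -
  have "inj_on (mu i) {..<d}"
  proof (rule inj_onI)
    fix a b assume ab: "a \<in> {..<d}" "b \<in> {..<d}" "mu i a = mu i b"
    then have "x i \<otimes> x a = x i \<otimes> x b" using assms by (simp add: x_mult)
    then have "x a = x b" using ab assms by simp
    then show "a = b" using ab by (intro x_inject) auto
  qed
  moreover have "mu i ` {..<d} \<subseteq> {..<d}" using assms by auto
  ultimately show ?thesis using endo_inj_surj[of "{..<d}" "mu i"] by (simp add: bij_betw_def)
qed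

definition iv :: "nat \<Rightarrow> nat" where "iv j = inv_into {..<d} (mu j) j0"

lemma iv [simp]:
  assumes "j < d" shows "iv j < d" "mu j (iv j) = j0" "mu (iv j) j = j0"
proof -
  have "j0 \<in> mu j ` {..<d}" using mu_bij[OF assms] by (simp add: bij_betw_def)
  then show iv: "iv j < d" "mu j (iv j) = j0"
    using inv_into_into[of j0 "mu j" "{..<d}"] f_inv_into_f[of j0 "mu j" "{..<d}"]
    by (auto simp: iv_def)
  have "x j \<otimes> x (iv j) = \<one>" using iv assms by (simp add: x_mult)
  then have "x (iv j) = inv (x j)" using iv assms by (metis inv_comm inv_equality x_closed)
  then have "x (iv j) \<otimes> x j = x j0" using assms by simp
  then show "mu (iv j) j = j0" using iv assms by (intro x_inject) (auto simp: x_mult)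
qed

lemma act_iv: "j < d \<Longrightarrow> u \<in> zvec n \<Longrightarrow> act j (act (iv j) u) = u"
  by (simp add: act_mu act_j0)

lemma iv_act: "j < d \<Longrightarrow> u \<in> zvec n \<Longrightarrow> act (iv j) (act j u) = u"
  by (simp add: act_mu act_j0)

lemma x_subgroup: "subgroup (x ` {..<d}) G"
proof (rule subgroupI)
  show "inv a \<in> x ` {..<d}" if a: "a \<in> x ` {..<d}" for a
  proof -
    obtain j where j: "j < d" "a = x j" using a by auto
    have "x (iv j) \<otimes> x j = \<one>" using j by (simp add: x_mult)
    then have "inv a = x (iv j)" using j by (simp add: inv_equality)
    then show ?thesis using j by simp
  qed
qed (use d_pos in \<open>auto simp: x_mult\<close>)

text \<open>Lagrange's theorem in the complement, which is a subgroup of order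
  \<open>d\<close>.\<close>

lemma x_pow:
  assumes "j < d" shows "x j [^] (m::nat) \<in> x ` {..<d}" "x j [^] d = \<one>"
proof -
  interpret F: group "G\<lparr>carrier := x ` {..<d}\<rparr>"
    using x_subgroup by (rule subgroup.subgroup_is_group) (rule group_axioms)
  have c: "Coset.order (G\<lparr>carrier := x ` {..<d}\<rparr>) = d"
    using x_inject by (simp add: order_def card_image inj_on_def)
  have "x j [^]\<^bsub>G\<lparr>carrier := x ` {..<d}\<rparr>\<^esub> m \<in> x ` {..<d}"
    using F.nat_pow_closed[of "x j" m] assms by simp
  then show "x j [^] m \<in> x ` {..<d}" by (simp add: nat_pow_consistent[symmetric])
  show "x j [^] d = \<one>"
    using F.pow_order_eq_1[of "x j"] assms c by (simp add: nat_pow_consistent[symmetric])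
qed

lemma split_pow:
  assumes "u \<in> zvec n" "j < d"
  shows "\<exists>v\<in>zvec n. (th u \<otimes> x j) [^] (m::nat) = th v \<otimes> (x j [^] m)"
proof (induction m)
  case 0
  then show ?case by (intro bexI[of _ "\<lambda>_. 0"]) (auto simp: th_zero)
next
  case (Suc m)
  then obtain v where v: "v \<in> zvec n" "(th u \<otimes> x j) [^] m = th v \<otimes> (x j [^] m)" by blast
  obtain i where i: "i < d" "x j [^] m = x i" using x_pow(1)[OF assms(2), of m] by auto
  have "(th u \<otimes> x j) [^] Suc m = th (\<lambda>l. v l + act i u l) \<otimes> x (mu i j)"
    using v i assms by (simp add: split_mult)
  also have "x (mu i j) = x j [^] Suc m" using i assms by (simp add: x_mult)
  finally show ?case using v i assms by (intro bexI[OF _ zvec_add[of v n "act i u"]]) auto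
qed

lemma span_set_eq: "span_set G n d (\<lambda>i. th (unitv i)) = th ` zvec n"
proof (intro equalityI subsetI)
  fix v assume "v \<in> span_set G n d (\<lambda>i. th (unitv i))"
  then obtain a h where a: "a \<in> residue_box n d" and h: "h \<in> carrier G" and v: "v = th a \<otimes> (h [^] d)"
    by (auto simp: span_set_def zprod_th residue_box_zvec)
  obtain u j where u: "u \<in> zvec n" "j < d" "h = th u \<otimes> x j" using split_surj[OF h] by blast
  then obtain w where w: "w \<in> zvec n" "h [^] d = th w"
    using split_pow[of u j d] x_pow(2)[of j] by auto
  have "v = th (\<lambda>i. a i + w i)" using v w residue_box_zvec[OF a] by (simp add: th_add)
  then show "v \<in> th ` zvec n" using w residue_box_zvec[OF a] by (simp add: zvec_add)
next
  fix v assume "v \<in> th ` zvec n"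
  then obtain u where u: "u \<in> zvec n" "v = th u" by blast
  obtain a w where a: "a \<in> residue_box n d" "w \<in> zvec n" "u = (\<lambda>i. a i + int d * w i)"
    using zvec_div_mod[OF u(1) d_pos] .
  have "v = zprod G (\<lambda>i. th (unitv i)) a n \<otimes> (th w [^] d)"
    using u a residue_box_zvec[OF a(1)] by (simp add: th_add zvec_scale th_scale_nat zprod_th)
  then show "v \<in> span_set G n d (\<lambda>i. th (unitv i))"
    unfolding span_set_def using a(1) th_closed[OF a(2)] by blast
qed

text \<open>The component of \<open>v\<close> in the complement has order dividing both
  \<open>p\<close> and \<open>d\<close>, hence is trivial, and the lattice itself has no
  torsion.\<close>

lemma torsion_free:
  assumes "0 < p" "coprime p d" "v \<in> carrier G" "v [^] (p::nat) = \<one>"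
  shows "v = \<one>"
proof -
  obtain u j where u: "u \<in> zvec n" "j < d" "v = th u \<otimes> x j" using split_surj[OF assms(3)] by blast
  obtain w where w: "w \<in> zvec n" "v [^] p = th w \<otimes> (x j [^] p)" using split_pow[OF u(1,2)] u by blast
  obtain i where i: "i < d" "x j [^] p = x i" using x_pow(1)[OF u(2), of p] by auto
  have "th w \<otimes> x i = th (\<lambda>_. 0) \<otimes> x j0" using assms w i by (simp add: th_zero)
  then have "x j [^] p = \<one>" using split_inject w i by (metis j0 zvec_zero)
  then have "ord (x j) dvd p" using u by (simp add: pow_eq_id)
  moreover have "ord (x j) dvd d" using u x_pow(2) by (simp add: pow_eq_id[symmetric])
  ultimately have "ord (x j) = 1" using assms(2) by (metis coprime_common_divisor_nat)
  then have "x j = \<one>" using u ord_eq_1 by simp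
  then have v: "v = th u" using u by simp
  then have "th (\<lambda>i. int p * u i) = th (\<lambda>_. 0)" using assms u by (simp add: th_scale_nat th_zero)
  then have "(\<lambda>i. int p * u i) = (\<lambda>_. 0)" using u by (intro th_inject zvec_scale) auto
  then have "u = (\<lambda>_. 0)" using assms(1) by (auto simp: fun_eq_iff)
  then show ?thesis by (simp add: v th_zero)
qed

lemma mod_split:
  assumes "0 < k"
  shows "mod_split G n d k act mu (\<lambda>i. th (unitv i)) x"
  unfolding mod_split_def span_set_eq
proof (intro conjI)
  show "\<forall>v\<in>carrier G. \<forall>w\<in>carrier G. v \<in> th ` zvec n \<and> w \<in> th ` zvec n \<longrightarrow>
      v \<otimes> w \<in> th ` zvec n \<and> inv v \<in> th ` zvec n \<and> v \<otimes> w = w \<otimes> v"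
    by (auto simp: th_add[symmetric] th_neg[symmetric] zvec_add zvec_neg add.commute)
  show "\<forall>v\<in>carrier G. v \<in> th ` zvec n \<longrightarrow>
      (\<forall>j\<in>{..<d}. x j \<otimes> v \<otimes> inv x j \<in> th ` zvec n)"
    by (auto simp: conj_th)
  show "\<forall>v\<in>carrier G. \<exists>j\<in>{..<d}. v \<otimes> inv x j \<in> th ` zvec n"
  proof
    fix v assume "v \<in> carrier G"
    then obtain u j where u: "u \<in> zvec n" "j < d" "v = th u \<otimes> x j" using split_surj by blast
    then have "v \<otimes> inv x j = th u" by (simp add: m_assoc)
    then show "\<exists>j\<in>{..<d}. v \<otimes> inv x j \<in> th ` zvec n" using u by auto
  qed
  show "\<forall>i\<in>{..<d}. \<forall>j\<in>{..<d}. i = j \<or> x i \<otimes> inv x j \<notin> th ` zvec n"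
  proof (intro ballI disjCI)
    fix i j assume ij: "i \<in> {..<d}" "j \<in> {..<d}" and "\<not> x i \<otimes> inv x j \<notin> th ` zvec n"
    then obtain u where u: "u \<in> zvec n" "x i \<otimes> inv x j = th u" by blast
    then have "x i = th u \<otimes> x j" using ij inv_solve_right'[of "th u" "x i" "x j"] by auto
    then have "th (\<lambda>_. 0) \<otimes> x i = th u \<otimes> x j" using ij u by (simp add: th_zero)
    then show "i = j" using split_inject[of "\<lambda>_. 0" u i j] ij u by simp
  qed
  show "\<forall>i\<in>{..<d}. \<forall>j\<in>{..<d}. x i \<otimes> x j = x (mu i j)" by (simp add: x_mult)
  show "\<forall>j\<in>{..<d}. \<forall>i\<in>{..<n}. \<exists>v\<in>carrier G. v \<in> th ` zvec n \<and>
      x j \<otimes> th (unitv i) \<otimes> inv x j =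
        zprod G (\<lambda>i. th (unitv i)) (act j (unitv i)) n \<otimes> (v [^] (d * k))"
  \<comment> \<open>In \<open>G\<close> itself the action on the basis is exact, so the error term
    is the power of the identity.\<close>
  proof (intro ballI bexI[of _ \<one>] conjI)
    show "\<one> \<in> th ` zvec n" using th_zero zvec_zero by (metis imageI)
  qed (auto simp: conj_th zvec_unitv zprod_th)
  show "\<forall>v\<in>carrier G. v \<in> th ` zvec n \<longrightarrow> (\<exists>w\<in>carrier G. w \<in> th ` zvec n \<and>
      (\<exists>a\<in>residue_box n (d * k). v = zprod G (\<lambda>i. th (unitv i)) a n \<otimes> (w [^] (d * k))))"
  proof (intro ballI impI)
    fix v assume "v \<in> th ` zvec n"
    then obtain u where u: "u \<in> zvec n" "v = th u" by blast
    obtain a w where a: "a \<in> residue_box n (d * k)" "w \<in> zvec n" "u = (\<lambda>i. a i + int (d * k) * w i)"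
      using zvec_div_mod[OF u(1), of "d * k"] d_pos assms by auto
    have "v = zprod G (\<lambda>i. th (unitv i)) a n \<otimes> (th w [^] (d * k))"
      using u a residue_box_zvec[OF a(1)] by (simp add: th_add zvec_scale th_scale_nat zprod_th del: of_nat_mult)
    then show "\<exists>w\<in>carrier G. w \<in> th ` zvec n \<and>
      (\<exists>a\<in>residue_box n (d * k). v = zprod G (\<lambda>i. th (unitv i)) a n \<otimes> (w [^] (d * k)))"
      using a by (intro bexI[of _ "th w"]) auto
  qed
  show "\<forall>a\<in>residue_box n k - {\<lambda>_. 0}. \<not> (\<exists>w\<in>carrier G. w \<in> th ` zvec n \<and>
      zprod G (\<lambda>i. th (unitv i)) a n = w [^] k)"
  proof (intro ballI notI, elim bexE conjE)
    fix a w assume a: "a \<in> residue_box n k - {\<lambda>_. 0}" and w: "w \<in> th ` zvec n"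
      and e: "zprod G (\<lambda>i. th (unitv i)) a n = w [^] k"
    have az: "a \<in> zvec n" using a residue_box_zvec by blast
    obtain u where u: "u \<in> zvec n" "w = th u" using w by blast
    have "th a = th (\<lambda>i. int k * u i)" using e u az by (simp add: zprod_th th_scale_nat)
    then have "a = (\<lambda>i. int k * u i)" using az u by (intro th_inject zvec_scale) auto
    then have au: "a i = int k * u i" for i by simp
    have "a i = 0" for i
    proof (cases "i < n")
      case True
      then have "0 \<le> a i" "a i < int k" using a by (auto simp: residue_box_def)
      then have "a i mod int k = a i" by simp
      then show ?thesis using au[of i] by simp
    next
      case False
      then show ?thesis using az by (simp add: zvec_def)
    qed
    then show False using a by (auto simp: fun_eq_iff)
  qed
  show "\<forall>v\<in>carrier G. v \<in> th ` zvec n \<longrightarrow> v [^] d = \<one> \<longrightarrow> v = \<one>"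
  proof (intro ballI impI)
    fix v assume "v \<in> th ` zvec n" and e: "v [^] d = \<one>"
    then obtain u where u: "u \<in> zvec n" "v = th u" by blast
    then have "th (\<lambda>i. int d * u i) = th (\<lambda>_. 0)" using e by (simp add: th_scale_nat th_zero)
    then have "(\<lambda>i. int d * u i) = (\<lambda>_. 0)" using u by (intro th_inject zvec_scale) auto
    then have "u = (\<lambda>_. 0)" using d_pos by (auto simp: fun_eq_iff)
    then show "v = \<one>" by (simp add: u th_zero)
  qed
  show "\<forall>i\<in>{..<n}. th (unitv i) \<in> th ` zvec n" by (auto simp: zvec_unitv)
qed

lemma split_bij: "bij_betw (\<lambda>(u, j). th u \<otimes> x j) (zvec n \<times> {..<d}) (carrier G)"
proof (rule bij_betwI')
  show "((\<lambda>(u, j). th u \<otimes> x j) a = (\<lambda>(u, j). th u \<otimes> x j) b) = (a = b)"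
    if "a \<in> zvec n \<times> {..<d}" "b \<in> zvec n \<times> {..<d}" for a b
    using that split_inject by (cases a; cases b) auto
qed (use split_surj in fastforce)+

end

section \<open>Uniqueness and transport of splittings\<close>

text \<open>By \<open>split_mult\<close> the product of two normal forms is computed from
  \<open>act\<close> and \<open>mu\<close> alone, so matching normal forms is a
  homomorphism.\<close>

lemma lattice_split_iso:
  assumes "lattice_split G n d th x act mu" "lattice_split H n d th' x' act mu"
  shows "G \<cong> H"
proof -
  interpret G: lattice_split G n d th x act mu by fact
  interpret H: lattice_split H n d th' x' act mu by fact
  let ?B = "zvec n \<times> {..<d}"
  let ?p = "\<lambda>(u, j). th u \<otimes>\<^bsub>G\<^esub> x j" and ?q = "\<lambda>(u, j). th' u \<otimes>\<^bsub>H\<^esub> x' j"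
  define f where "f = ?q \<circ> inv_into ?B ?p"
  have f: "f (th u \<otimes>\<^bsub>G\<^esub> x j) = th' u \<otimes>\<^bsub>H\<^esub> x' j" if "u \<in> zvec n" "j < d" for u j
  proof -
    have "inv_into ?B ?p (?p (u, j)) = (u, j)"
      by (rule inv_into_f_f) (use G.split_bij that in \<open>auto simp: bij_betw_def\<close>)
    then show ?thesis by (simp add: f_def)
  qed
  have "bij_betw f (carrier G) (carrier H)"
    unfolding f_def by (rule bij_betw_trans[OF bij_betw_inv_into[OF G.split_bij] H.split_bij])
  moreover have "f \<in> hom G H"
  proof (rule homI)
    fix a b assume a: "a \<in> carrier G" and b: "b \<in> carrier G"
    obtain u i where u: "u \<in> zvec n" "i < d" "a = th u \<otimes>\<^bsub>G\<^esub> x i" using G.split_surj[OF a] by blast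
    obtain v j where v: "v \<in> zvec n" "j < d" "b = th v \<otimes>\<^bsub>G\<^esub> x j" using G.split_surj[OF b] by blast
    show "f a \<in> carrier H" using u by (simp add: f)
    have "f (a \<otimes>\<^bsub>G\<^esub> b) = f (th (\<lambda>l. u l + act i v l) \<otimes>\<^bsub>G\<^esub> x (mu i j))"
      using u v by (simp only: G.split_mult)
    also have "\<dots> = th' (\<lambda>l. u l + act i v l) \<otimes>\<^bsub>H\<^esub> x' (mu i j)"
      using u v by (intro f zvec_add) auto
    also have "\<dots> = f a \<otimes>\<^bsub>H\<^esub> f b" using u v by (simp only: f H.split_mult)
    finally show "f (a \<otimes>\<^bsub>G\<^esub> b) = f a \<otimes>\<^bsub>H\<^esub> f b" .
  qed
  ultimately show ?thesis by (auto simp: is_iso_def iso_def)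
qed

lemma lattice_split_transfer:
  assumes "lattice_split G n d th x act mu" "f \<in> iso G H" "group H"
  shows "lattice_split H n d (f \<circ> th) (f \<circ> x) act mu"
proof -
  interpret G: lattice_split G n d th x act mu by fact
  interpret H: group H by fact
  interpret f: group_hom G H f
    using assms(2) by unfold_locales (auto simp: iso_def)
  have bij: "bij_betw f (carrier G) (carrier H)" using assms(2) by (simp add: iso_def)
  then have inj: "f a = f b \<Longrightarrow> a = b" if "a \<in> carrier G" "b \<in> carrier G" for a b
    using that by (auto simp: bij_betw_def inj_on_def)
  show ?thesis
  proof unfold_locales
    show "\<exists>j<d. (f \<circ> x) j = \<one>\<^bsub>H\<^esub>" using G.one_x by auto
    show "(f \<circ> x) j \<otimes>\<^bsub>H\<^esub> (f \<circ> th) u = (f \<circ> th) (act j u) \<otimes>\<^bsub>H\<^esub> (f \<circ> x) j"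
      if "j < d" "u \<in> zvec n" for j u
      using that G.x_th[OF that] by (simp flip: f.hom_mult)
    show "u = v \<and> i = j" if "u \<in> zvec n" "v \<in> zvec n" "i < d" "j < d"
      "(f \<circ> th) u \<otimes>\<^bsub>H\<^esub> (f \<circ> x) i = (f \<circ> th) v \<otimes>\<^bsub>H\<^esub> (f \<circ> x) j" for u v i j
      using that by (intro G.split_inject inj) auto
    show "\<exists>u\<in>zvec n. \<exists>j<d. g = (f \<circ> th) u \<otimes>\<^bsub>H\<^esub> (f \<circ> x) j" if "g \<in> carrier H" for g
    proof -
      obtain a where a: "a \<in> carrier G" "g = f a" using bij \<open>g \<in> carrier H\<close> by (auto simp: bij_betw_def)
      then obtain u j where "u \<in> zvec n" "j < d" "a = th u \<otimes>\<^bsub>G\<^esub> x j" using G.split_surj by blast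
      then show ?thesis using a by (intro bexI[of _ u] exI[of _ j]) auto
    qed
  qed (auto simp: G.th_add G.x_mult f.hom_mult[symmetric] simp del: f.hom_mult)
qed

section \<open>Recovering a splitting from the sentences\<close>

lemma zprod_carrier_update:
  assumes "group G" "subgroup D G" "\<And>i. i < n \<Longrightarrow> y i \<in> D"
  shows "zprod (G\<lparr>carrier := D\<rparr>) y u n = zprod G y u n"
  using assms(3) by (induction n) (simp_all add: group.int_pow_consistent[OF assms(1,2)])

text \<open>If \<open>p\<close> shares the factor \<open>g > 1\<close> with \<open>d\<close>, then
  \<open>(v [^] (p div g)) [^] d\<close> is a power of \<open>v [^] p\<close>, hence trivial.
  Absence of \<open>d\<close>-torsion in \<open>D\<close> then replaces \<open>p\<close> by the
  smaller exponent \<open>p div g\<close>.\<close>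

lemma torsion_free_from_coprime:
  fixes G (structure)
  assumes "group G" and D: "subgroup D G"
    and d: "0 < d" "\<And>v. v \<in> D \<Longrightarrow> v [^] d = \<one> \<Longrightarrow> v = \<one>"
    and cop: "\<And>p v. 0 < p \<Longrightarrow> coprime p d \<Longrightarrow> v \<in> carrier G \<Longrightarrow> v [^] (p::nat) = \<one> \<Longrightarrow> v = \<one>"
    and v: "v \<in> D" "0 < p" "v [^] (p::nat) = \<one>"
  shows "v = \<one>"
  using v(2,3)
proof (induction p rule: less_induct)
  case (less p)
  interpret group G by fact
  have vc: "v \<in> carrier G" using v D subgroup.subset by blast
  show ?case
  proof (cases "coprime p d")
    case True
    then show ?thesis using cop less vc by blast
  next
    case False
    define g where "g = gcd p d"
    have g: "1 < g" using False less.prems coprime_iff_gcd_eq_1[of p d]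
      by (metis g_def gcd_pos_nat less_one nat_neq_iff)
    obtain q where q: "p = q * g" using g_def by (metis dvd_def gcd_dvd1 mult.commute)
    obtain e where e: "d = g * e" using g_def by (metis dvd_def gcd_dvd2)
    have "g dvd d" "d dvd d" using e by auto
    have q0: "0 < q" "q < p" using less.prems g q by auto
    have "v [^] (q * d) = (v [^] p) [^] e"
      using vc by (simp add: q e nat_pow_pow mult.assoc del: pow_nat)
    then have "v [^] (q * d) = \<one>" using less.prems by simp
    then have "(v [^] q) [^] d = \<one>" using vc by (simp add: nat_pow_pow)
    have "v [^] q = \<one>"
    proof (rule d(2))
      show "v [^] q \<in> D"
        using subgroup_int_pow_closed[OF D v(1), of "int q"] by (simp add: int_pow_int)
    qed fact
    then show ?thesis using less.IH q0 by blast
  qed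
qed

text \<open>The complement \<open>x\<close> is kept as it is; the parameters \<open>y\<close> need
  not be a basis of the lattice of \<open>H\<close>, so the lattice map is replaced by the
  isomorphism that \<open>equivariant_iso\<close> supplies.\<close>

lemma lattice_split_if_mod_split:
  fixes H (structure)
  assumes G: "lattice_split G n d th x0 act mu" and "group H"
    and y: "\<And>i. i < n \<Longrightarrow> y i \<in> carrier H" and x: "\<And>j. j < d \<Longrightarrow> x j \<in> carrier H"
    and ms: "mod_split H n d k act mu y x"
    and tf: "\<And>p v. 0 < p \<Longrightarrow> coprime p d \<Longrightarrow> v \<in> carrier H \<Longrightarrow> v [^] (p::nat) = \<one> \<Longrightarrow> v = \<one>"
    and diag: "diagonal_sublattices n d act k" and k: "2 \<le> k"
    and fg: "finitely_generated_group H"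
  shows "\<exists>\<theta>. lattice_split H n d \<theta> x act mu"
proof -
  interpret G: lattice_split G n d th x0 act mu by fact
  interpret H: group H by fact
  define D where "D = span_set H n d y"
  note ms = ms[unfolded mod_split_def, folded D_def]
  note c1 = ms[THEN conjunct1]
    and c2 = ms[THEN conjunct2, THEN conjunct1]
    and c3 = ms[THEN conjunct2, THEN conjunct2, THEN conjunct1]
    and c4 = ms[THEN conjunct2, THEN conjunct2, THEN conjunct2, THEN conjunct1]
    and c5 = ms[THEN conjunct2, THEN conjunct2, THEN conjunct2, THEN conjunct2, THEN conjunct1]
    and c6 = ms[THEN conjunct2, THEN conjunct2, THEN conjunct2, THEN conjunct2, THEN conjunct2, THEN conjunct1]
    and c7 = ms[THEN conjunct2, THEN conjunct2, THEN conjunct2, THEN conjunct2, THEN conjunct2, THEN conjunct2, THEN conjunct1]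
    and c8 = ms[THEN conjunct2, THEN conjunct2, THEN conjunct2, THEN conjunct2, THEN conjunct2, THEN conjunct2, THEN conjunct2, THEN conjunct1]
    and c9 = ms[THEN conjunct2, THEN conjunct2, THEN conjunct2, THEN conjunct2, THEN conjunct2, THEN conjunct2, THEN conjunct2, THEN conjunct2, THEN conjunct1]
    and c10 = ms[THEN conjunct2, THEN conjunct2, THEN conjunct2, THEN conjunct2, THEN conjunct2, THEN conjunct2, THEN conjunct2, THEN conjunct2, THEN conjunct2]
  have Dc: "D \<subseteq> carrier H" using y by (auto simp: D_def span_set_def)
  have D_closed: "v \<in> D \<Longrightarrow> w \<in> D \<Longrightarrow> v \<otimes> w \<in> D"
    and D_comm: "v \<in> D \<Longrightarrow> w \<in> D \<Longrightarrow> v \<otimes> w = w \<otimes> v" for v w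
    using c1 Dc by (simp_all add: subset_iff)
  have D_inv: "v \<in> D \<Longrightarrow> inv v \<in> D" for v
    using c1[THEN bspec, THEN bspec, of v v] Dc by auto
  have conj_D: "j < d \<Longrightarrow> v \<in> D \<Longrightarrow> x j \<otimes> v \<otimes> inv x j \<in> D" for j v
    using c2 Dc by blast
  have coset: "v \<in> carrier H \<Longrightarrow> \<exists>j<d. v \<otimes> inv x j \<in> D" for v
    using c3 by blast
  have coset_unique: "i < d \<Longrightarrow> j < d \<Longrightarrow> x i \<otimes> inv x j \<in> D \<Longrightarrow> i = j" for i j
    using c4 by blast
  have x_mult: "i < d \<Longrightarrow> j < d \<Longrightarrow> x i \<otimes> x j = x (mu i j)" for i j
    using c5 by blast
  have D_conj_y: "j < d \<Longrightarrow> i < n \<Longrightarrow> \<exists>v\<in>D. x j \<otimes> y i \<otimes> inv x j =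
      zprod H y (act j (unitv i)) n \<otimes> (v [^] (d * k))" for i j
    using c6 by blast
  have D_spanning: "v \<in> D \<Longrightarrow> \<exists>w\<in>D. \<exists>a\<in>residue_box n (d * k). v = zprod H y a n \<otimes> (w [^] (d * k))" for v
    using c7 Dc by blast
  have D_indep: "a \<in> residue_box n k \<Longrightarrow> w \<in> D \<Longrightarrow> zprod H y a n = w [^] k \<Longrightarrow> a = (\<lambda>_. 0)" for a w
    using c8 Dc by blast
  have D_tf: "v \<in> D \<Longrightarrow> v [^] d = \<one> \<Longrightarrow> v = \<one>" for v
    using c9 Dc by blast
  have yD: "i < n \<Longrightarrow> y i \<in> D" for i using c10 by blast

  have one_D: "\<one> \<in> D"
  proof -
    have "(\<lambda>_. 0) \<in> residue_box n d" using G.d_pos by (auto simp: residue_box_def)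
    then have "zprod H y (\<lambda>_. 0) n \<otimes> (\<one> [^] d) \<in> D"
      unfolding D_def span_set_def using H.one_closed by blast
    then show ?thesis using y by simp
  qed
  have D: "subgroup D H"
    using Dc one_D by (intro H.subgroupI) (auto intro: D_closed D_inv)
  let ?A = "H\<lparr>carrier := D\<rparr>"
  have "comm_group ?A"
  proof (rule group.group_comm_groupI)
    show "group ?A" using D by (rule subgroup.subgroup_is_group) (rule H.group_axioms)
  qed (use D_comm in auto)
  then interpret A: comm_group ?A .

  \<comment> \<open>Since \<open>mu j0 j0 = j0\<close>, this element is idempotent.\<close>
  have x_j0: "x G.j0 = \<one>"
    using x_mult[of G.j0 G.j0] x[of G.j0] by (simp add: G.mu_j0)
  have x_inv: "inv x j = x (G.iv j)" if "j < d" for j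
    using x_mult[of "G.iv j" j] that x x_j0 by (intro H.inv_equality) auto
  have conj_comp: "x i \<otimes> (x j \<otimes> v \<otimes> inv x j) \<otimes> inv x i =
      x (mu i j) \<otimes> v \<otimes> inv x (mu i j)" if "i < d" "j < d" "v \<in> carrier H" for i j v
    using that x by (simp add: x_mult[symmetric] H.inv_mult_group H.m_assoc)
  have conj_mult: "x j \<otimes> (v \<otimes> w) \<otimes> inv x j =
      (x j \<otimes> v \<otimes> inv x j) \<otimes> (x j \<otimes> w \<otimes> inv x j)"
    if "j < d" "v \<in> carrier H" "w \<in> carrier H" for j v w
  proof -
    have "(x j \<otimes> v \<otimes> inv x j) \<otimes> (x j \<otimes> w \<otimes> inv x j) =
      x j \<otimes> v \<otimes> (inv x j \<otimes> x j) \<otimes> (w \<otimes> inv x j)"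
      using that x by (simp only: H.m_assoc H.m_closed H.inv_closed)
    then show ?thesis using that x by (simp add: H.m_assoc)
  qed

  text \<open>The components in \<open>D\<close> of the generators of \<open>H\<close>, together with their conjugates, generate
    \<open>D\<close>.\<close>

  have fgD: "\<exists>Y. finite Y \<and> Y \<subseteq> D \<and> generate ?A Y = D"
  proof -
    obtain X where X: "finite X" "X \<subseteq> carrier H" "generate H X = carrier H"
      using fg by (auto simp: finitely_generated_group_def)
    obtain J where J: "h \<in> carrier H \<Longrightarrow> J h < d \<and> h \<otimes> inv x (J h) \<in> D" for h
      using coset by metis
    let ?c = "\<lambda>j v. x j \<otimes> v \<otimes> inv x j"
    let ?p = "\<lambda>h. h \<otimes> inv x (J h)"
    \<comment> \<open>All conjugates are included so that the complement normalises
      \<open>E\<close>. Then \<open>E\<close> times the complement is a subgroup containing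
      \<open>X\<close>, hence everything.\<close>
    define Y where "Y = (\<lambda>(j, h). ?c j (?p h)) ` ({..<d} \<times> X)"
    have YD: "Y \<subseteq> D" using J X by (auto simp: Y_def intro!: conj_D)
    have YH: "Y \<subseteq> carrier H" using YD Dc by blast
    define E where "E = generate H Y"
    have E: "subgroup E H" unfolding E_def by (rule H.generate_is_subgroup[OF YH])
    have EH: "E \<subseteq> carrier H" using E by (rule subgroup.subset)
    have ED: "E \<subseteq> D" unfolding E_def using H.generate_subgroup_incl[OF YD D] .
    have Y_conj: "?c i v \<in> Y" if i: "i < d" and v: "v \<in> Y" for i v
    proof -
      obtain j h where jh: "j < d" "h \<in> X" "v = ?c j (?p h)" using v by (auto simp: Y_def)
      have "?p h \<in> carrier H" using J[of h] jh X Dc by blast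
      then have "?c i v = ?c (mu i j) (?p h)" using i jh by (simp only: conj_comp)
      then show ?thesis using i jh by (auto simp: Y_def)
    qed
    have E_conj: "?c i v \<in> E" if i: "i < d" and v: "v \<in> E" for i v
      using v unfolding E_def
    proof (induction rule: generate.induct)
      case one
      then show ?case using x[OF i] by (simp add: generate.one)
    next
      case (incl h)
      then show ?case using Y_conj[OF i] by (simp add: generate.incl)
    next
      case (inv h)
      have "h \<in> carrier H" using inv YH by blast
      then have "?c i (inv h) = inv ?c i h" using x[OF i] by (simp add: H.inv_mult_group H.m_assoc)
      then show ?case using Y_conj[OF i inv] by (simp add: generate.inv)
    next
      case (eng h1 h2)
      have "h1 \<in> carrier H" "h2 \<in> carrier H" using eng EH by (auto simp: E_def)
      then show ?case using generate.eng[OF eng.IH] conj_mult[OF i] by simp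
    qed
    have split: "\<exists>e\<in>E. \<exists>j<d. g = e \<otimes> x j" if "g \<in> generate H X" for g
      using that
    proof (induction rule: generate.induct)
      case one
      show ?case using subgroup.one_closed[OF E] x_j0
        by (intro bexI[of _ "\<one>"] exI[of _ G.j0]) auto
    next
      case (incl h)
      then have h: "h \<in> carrier H" using X by blast
      have "?c G.j0 (?p h) \<in> Y" unfolding Y_def using incl by (auto intro!: image_eqI[of _ _ "(G.j0, h)"])
      then have "?p h \<in> E" using h J[OF h] x x_j0 by (simp add: E_def generate.incl)
      moreover have "h = ?p h \<otimes> x (J h)" using h J[OF h] x by (simp add: H.m_assoc)
      ultimately show ?case using J[OF h] by blast
    next
      case (inv h)
      then have h: "h \<in> carrier H" using X by blast
      have "?c G.j0 (?p h) \<in> Y" unfolding Y_def using inv by (auto intro!: image_eqI[of _ _ "(G.j0, h)"])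
      then have pE: "?p h \<in> E" using h J[OF h] x x_j0 by (simp add: E_def generate.incl)
      let ?i = "G.iv (J h)"
      have i: "?i < d" and xi: "x ?i = inv x (J h)" using J[OF h] x_inv by auto
      have "inv h = ?c ?i (inv ?p h) \<otimes> x ?i"
        using h J[OF h] x by (simp add: xi H.inv_mult_group H.m_assoc H.inv_solve_left)
      moreover have "?c ?i (inv ?p h) \<in> E"
        using E_conj[OF i] pE subgroup.m_inv_closed[OF E] by blast
      ultimately show ?case using i by blast
    next
      case (eng h1 h2)
      then obtain e1 e2 i j where e: "e1 \<in> E" "e2 \<in> E" "i < d" "j < d"
        "h1 = e1 \<otimes> x i" "h2 = e2 \<otimes> x j" by blast
      have ec: "e1 \<in> carrier H" "e2 \<in> carrier H" using e EH by auto
      have "h1 \<otimes> h2 = (e1 \<otimes> ?c i e2) \<otimes> (x i \<otimes> x j)"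
        using e ec x by (simp add: H.m_assoc H.inv_solve_left)
      then have "h1 \<otimes> h2 = (e1 \<otimes> ?c i e2) \<otimes> x (mu i j)" using e by (simp add: x_mult)
      moreover have "e1 \<otimes> ?c i e2 \<in> E" using e E_conj subgroup.m_closed[OF E] by blast
      ultimately show ?case using e G.mu_less by blast
    qed
    \<comment> \<open>An element \<open>e \<otimes> x j\<close> of \<open>D\<close> with
      \<open>e\<close> in \<open>E\<close> has \<open>x j\<close> in \<open>D\<close>, and
      \<open>coset_unique\<close> leaves only the identity.\<close>
    have "D \<subseteq> E"
    proof
      fix v assume v: "v \<in> D"
      obtain e j where e: "e \<in> E" "j < d" "v = e \<otimes> x j" using split[of v] v X Dc by blast
      have ec: "e \<in> carrier H" "v \<in> carrier H" "e \<in> D" using e EH v Dc ED by auto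
      have "x j = inv e \<otimes> v" using e ec x by (simp add: H.inv_solve_left)
      moreover have "inv e \<otimes> v \<in> D" using ec v by (intro D_closed D_inv)
      ultimately have "x j \<in> D" by (rule ssubst)
      then have "x j \<otimes> inv x G.j0 \<in> D" using x[OF e(2)] x_j0 by simp
      then have "j = G.j0" using e by (intro coset_unique) auto
      then show "v \<in> E" using e ec x_j0 by simp
    qed
    then have "E = D" using ED by blast
    then have "generate ?A Y = D" using H.generate_consistent[OF YD D] by (simp add: E_def)
    moreover have "finite Y" using X by (simp add: Y_def)
    ultimately show ?thesis using YD by blast
  qed

  have zp: "zprod ?A y u n = zprod H y u n" for u
    by (rule zprod_carrier_update[OF H.group_axioms D yD])
  have np: "v [^]\<^bsub>?A\<^esub> (m::nat) = v [^] m" for v m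
    by (simp only: H.nat_pow_consistent[symmetric])
  interpret M: mod_lattice ?A n d k act mu G.iv "\<lambda>j v. x j \<otimes> v \<otimes> inv x j" y
  proof (intro mod_lattice.intro mod_lattice_axioms.intro)
    show "comm_group ?A" by (rule A.comm_group_axioms)
    show "(\<lambda>v. x j \<otimes> v \<otimes> inv x j) \<in> hom ?A ?A" if "j < d" for j
      using that by (intro homI) (auto simp: conj_D conj_mult subsetD[OF Dc])
    show "x i \<otimes> (x j \<otimes> v \<otimes> inv x j) \<otimes> inv x i =
      x (mu i j) \<otimes> v \<otimes> inv x (mu i j)" if "i < d" "j < d" "v \<in> carrier ?A" for i j v
      using that Dc by (intro conj_comp) auto
    show "\<exists>v\<in>carrier ?A. x j \<otimes> y i \<otimes> inv x j =
      zprod ?A y (act j (unitv i)) n \<otimes>\<^bsub>?A\<^esub> (v [^]\<^bsub>?A\<^esub> (d * k))" if "j < d" "i < n" for i j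
      using D_conj_y[OF that] unfolding zp np by simp
    show "\<exists>w\<in>carrier ?A. \<exists>a\<in>residue_box n (d * k). v = zprod ?A y a n \<otimes>\<^bsub>?A\<^esub> (w [^]\<^bsub>?A\<^esub> (d * k))"
      if "v \<in> carrier ?A" for v
      using D_spanning[of v] that unfolding zp np by simp
    show "a = (\<lambda>_. 0)"
      if "a \<in> residue_box n k" "w \<in> carrier ?A" "zprod ?A y a n = w [^]\<^bsub>?A\<^esub> k" for a w
      using D_indep[of a w] that unfolding zp np by simp
    show "v = \<one>\<^bsub>?A\<^esub>" if v: "v \<in> carrier ?A" "0 < p" "v [^]\<^bsub>?A\<^esub> p = \<one>\<^bsub>?A\<^esub>" for v and p :: nat
    proof -
      have "v = \<one>"
      proof (rule torsion_free_from_coprime[OF H.group_axioms D G.d_pos D_tf tf])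
        show "v [^] p = \<one>" using v(3) unfolding np by simp
      qed (use v in simp_all)
      then show ?thesis by simp
    qed
    show "\<exists>Y. finite Y \<and> Y \<subseteq> carrier ?A \<and> generate ?A Y = carrier ?A" using fgD by simp
  qed (use k G.d_pos yD G.mu_bij G.act_add G.act_mu G.act_iv G.iv_act in auto)

  obtain \<theta> where \<theta>: "\<forall>u\<in>zvec n. \<forall>v\<in>zvec n. \<theta> (\<lambda>i. u i + v i) = \<theta> u \<otimes> \<theta> v"
    "bij_betw \<theta> (zvec n) D"
    "\<forall>j<d. \<forall>u\<in>zvec n. x j \<otimes> \<theta> u \<otimes> inv x j = \<theta> (act j u)"
    using M.equivariant_iso[OF diag] by auto
  note \<theta>_add = \<theta>(1)[rule_format] and \<theta>_bij = \<theta>(2) and \<theta>_conj = \<theta>(3)[rule_format]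
  have \<theta>_D: "\<theta> u \<in> D" "\<theta> u \<in> carrier H" if "u \<in> zvec n" for u
    using \<theta>_bij that Dc by (auto simp: bij_betw_def)
  have "lattice_split H n d \<theta> x act mu"
  proof unfold_locales
    show "\<exists>j<d. x j = \<one>" using x_j0 by (intro exI[of _ G.j0]) auto
    show "x j \<otimes> \<theta> u = \<theta> (act j u) \<otimes> x j" if "j < d" "u \<in> zvec n" for j u
      using that x \<theta>_D by (simp add: \<theta>_conj[symmetric] H.m_assoc)
    show "u = v \<and> i = j" if a: "u \<in> zvec n" "v \<in> zvec n" "i < d" "j < d"
      "\<theta> u \<otimes> x i = \<theta> v \<otimes> x j" for u v i j
    proof -
      note c = \<theta>_D(2)[OF a(1)] \<theta>_D(2)[OF a(2)] x[OF a(3)] x[OF a(4)]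
      have "x i = inv \<theta> u \<otimes> (\<theta> v \<otimes> x j)" using a(5) c by (metis H.inv_solve_left H.m_closed)
      then have "x i \<otimes> inv x j = inv \<theta> u \<otimes> \<theta> v" using c by (simp add: H.m_assoc)
      then have "i = j" using a \<theta>_D by (intro coset_unique) (auto intro!: D_closed D_inv)
      then have "\<theta> u = \<theta> v" using a(5) c by simp
      then show ?thesis using \<open>i = j\<close> \<theta>_bij a by (auto simp: bij_betw_def inj_on_def)
    qed
    show "\<exists>u\<in>zvec n. \<exists>j<d. g = \<theta> u \<otimes> x j" if g: "g \<in> carrier H" for g
    proof -
      obtain j where j: "j < d" "g \<otimes> inv x j \<in> D" using coset[OF g] by blast
      then obtain u where u: "u \<in> zvec n" "g \<otimes> inv x j = \<theta> u"
        using \<theta>_bij by (auto simp: bij_betw_def)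
      have "g = (g \<otimes> inv x j) \<otimes> x j" using g x j by (simp add: H.m_assoc)
      then show ?thesis using u j by auto
    qed
  qed (use \<theta>_D x \<theta>_add x_mult in auto)
  then show ?thesis by blast
qed

text \<open>The splitting sentence supplies the parameters in \<open>H\<close> once; the torsion
  sentences, one for each exponent prime to \<open>d\<close>, do not refer to them and can be added
  afterwards.\<close>

theorem lattice_split_first_order_rigid:
  assumes G: "lattice_split G n d th x act mu" and diag: "diagonal_sublattices n d act k" "2 \<le> k"
    and H: "finitely_generated_group H" "elementarily_equivalent H G"
  shows "H \<cong> G"
proof -
  interpret G: lattice_split G n d th x act mu by fact
  interpret H: group H using H by (simp add: finitely_generated_group_def)
  have ne: "carrier G \<noteq> {}" "carrier H \<noteq> {}" by auto
  note mu = G.mu_less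
  have eq: "models G \<phi> \<Longrightarrow> sentence \<phi> \<Longrightarrow> models H \<phi>" for \<phi>
    using H(2) by (simp add: elementarily_equivalent_def)
  have "mod_split G n d k act mu (\<lambda>i. th (unitv i)) x" using diag(2) by (intro G.mod_split) simp
  then have "models G (mod_split_sentence n d k act mu)"
    by (intro iffD2[OF models_mod_split_sentence] mu ne exI[of _ "\<lambda>i. th (unitv i)"] exI[of _ x])
      (auto simp: zvec_unitv)
  from eq[OF this sentence_mod_split_sentence[where mu = mu, OF mu]]
  obtain y x' where y: "\<And>i. i < n \<Longrightarrow> y i \<in> carrier H" and x': "\<And>j. j < d \<Longrightarrow> x' j \<in> carrier H"
    and ms: "mod_split H n d k act mu y x'"
    using iffD1[OF models_mod_split_sentence[where mu = mu, OF mu ne(2)]] by blast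
  have tf: "v = \<one>\<^bsub>H\<^esub>" if "0 < p" "coprime p d" "v \<in> carrier H" "v [^]\<^bsub>H\<^esub> (p::nat) = \<one>\<^bsub>H\<^esub>" for p v
  proof -
    have "models G (torsion_free_sentence p)"
      using G.torsion_free[OF that(1,2)] by (simp add: models_torsion_free_sentence[OF ne(1)])
    from eq[OF this sentence_torsion_free_sentence] show ?thesis
      using that by (simp add: models_torsion_free_sentence[OF ne(2)])
  qed
  have "\<exists>\<theta>. lattice_split H n d \<theta> x' act mu"
    by (rule lattice_split_if_mod_split[OF G H.group_axioms _ _ ms _ diag H(1)])
      (use y x' tf in auto)
  then obtain \<theta> where "lattice_split H n d \<theta> x' act mu" ..
  then show ?thesis using G by (rule lattice_split_iso)
qed

no_notation Matrix.scalar_prod (infix \<open>\<bullet>\<close> 70)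

section \<open>Discrete affine reflection groups\<close>

text \<open>Pigeonhole for a finite cover of a totally bounded set by balls of radius
  \<open>e / 2\<close>.\<close>

lemma infinite_close_subset:
  fixes f :: "'i \<Rightarrow> 'e::euclidean_space"
  assumes "infinite A" "bounded (f ` A)" "0 < e"
  shows "\<exists>B\<subseteq>A. infinite B \<and> (\<forall>x\<in>B. \<forall>y\<in>B. dist (f x) (f y) < e)"
proof -
  have "compact (closure (f ` A))" using assms(2) by simp
  then have "\<forall>e>0. \<exists>K. finite K \<and> closure (f ` A) \<subseteq> (\<Union>k\<in>K. ball k e)"
    by (simp add: compact_eq_totally_bounded)
  from this[THEN spec, THEN mp, OF half_gt_zero[OF assms(3)]]
  obtain K where K: "finite K" "closure (f ` A) \<subseteq> (\<Union>k\<in>K. ball k (e / 2))"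
    by (elim exE conjE)
  have "A \<subseteq> (\<Union>k\<in>K. {x \<in> A. f x \<in> ball k (e / 2)})"
  proof
    fix x assume "x \<in> A"
    then have "f x \<in> closure (f ` A)" by (intro subsetD[OF closure_subset] imageI)
    from subsetD[OF K(2) this] show "x \<in> (\<Union>k\<in>K. {x \<in> A. f x \<in> ball k (e / 2)})"
      using \<open>x \<in> A\<close> by (elim UN_E) auto
  qed
  then have "infinite (\<Union>k\<in>K. {x \<in> A. f x \<in> ball k (e / 2)})"
    using assms(1) finite_subset by blast
  then obtain k where "k \<in> K" and inf: "infinite {x \<in> A. f x \<in> ball k (e / 2)}"
    using K(1) by auto
  have "dist (f x) (f y) < e" if "f x \<in> ball k (e / 2)" "f y \<in> ball k (e / 2)" for x y
    using that dist_triangle_half_r[of k "f x" e "f y"] by simp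
  then show ?thesis using inf by (intro exI[of _ "{x \<in> A. f x \<in> ball k (e / 2)}"]) auto
qed

lemma finite_if_separated:
  fixes A :: "'e::euclidean_space set"
  assumes "bounded A" "0 < e" "\<And>x y. x \<in> A \<Longrightarrow> y \<in> A \<Longrightarrow> x \<noteq> y \<Longrightarrow> e \<le> dist x y"
  shows "finite A"
proof (rule ccontr)
  assume "infinite A"
  then obtain B where B: "B \<subseteq> A" "infinite B" "\<forall>x\<in>B. \<forall>y\<in>B. dist x y < e"
    using infinite_close_subset[of A "\<lambda>x. x" e] assms by auto
  then obtain x where "x \<in> B" by (metis finite.emptyI ex_in_conv)
  then have "B \<subseteq> {x}" using B assms(3) by (metis insertCI not_less subset_eq)
  then show False using B(2) finite_subset by blast
qed

section \<open>Reflections with unit normals\<close>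

text \<open>For unit normals the formula has no denominator, and a mirror determines
  \<open>(a, b)\<close> up to a common sign.\<close>

definition rfl :: "'e::euclidean_space \<Rightarrow> real \<Rightarrow> 'e \<Rightarrow> 'e" where
  "rfl a b = (\<lambda>x. x - (2 * (a \<bullet> x - b)) *\<^sub>R a)"

definition lrfl :: "'e::euclidean_space \<Rightarrow> 'e \<Rightarrow> 'e" where
  "lrfl a = (\<lambda>x. x - (2 * (a \<bullet> x)) *\<^sub>R a)"

definition lin_part :: "('e::euclidean_space \<Rightarrow> 'e) \<Rightarrow> 'e \<Rightarrow> 'e" where
  "lin_part g = (\<lambda>x. g x - g 0)"

lemma unit_inner: "norm (a::'e::euclidean_space) = 1 \<Longrightarrow> a \<bullet> a = 1"
  by (simp add: norm_eq_1)

lemma affine_reflection_rfl: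
  assumes "affine_reflection f"
  shows "\<exists>a b. norm a = 1 \<and> f = rfl a b"
proof -
  obtain a b where a: "a \<noteq> 0" and f: "f = (\<lambda>x. x - (2 * (a \<bullet> x - b) / (a \<bullet> a)) *\<^sub>R a)"
    using assms by (auto simp: affine_reflection_def)
  define c where "c = norm a"
  have c: "c \<noteq> 0" "a \<bullet> a = c * c" using a by (simp_all add: c_def norm_eq_sqrt_inner)
  have "f = rfl ((1 / c) *\<^sub>R a) (b / c)"
    using c by (simp add: f rfl_def fun_eq_iff field_simps)
  moreover have "norm ((1 / c) *\<^sub>R a) = 1" using a by (simp add: c_def)
  ultimately show ?thesis by blast
qed

lemma rfl_involution: "norm a = 1 \<Longrightarrow> rfl a b (rfl a b x) = x"
  by (simp add: rfl_def inner_diff_right unit_inner algebra_simps flip: scaleR_add_left)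

lemma rfl_neg: "rfl (- a) (- b) = rfl a b"
  by (simp add: rfl_def algebra_simps)

lemma lin_part_rfl: "lin_part (rfl a b) = lrfl a"
  by (simp add: lin_part_def rfl_def lrfl_def algebra_simps fun_eq_iff flip: scaleR_add_left)

lemma lrfl_linear: "linear (lrfl a)"
  by (intro linearI) (simp_all add: lrfl_def inner_add_right algebra_simps)

lemma lrfl_inner: "norm a = 1 \<Longrightarrow> lrfl a x \<bullet> lrfl a y = x \<bullet> y"
  by (simp add: lrfl_def inner_diff_left inner_diff_right unit_inner inner_commute algebra_simps)

lemma lrfl_involution: "norm a = 1 \<Longrightarrow> lrfl a (lrfl a x) = x"
  by (simp add: lrfl_def inner_diff_right unit_inner algebra_simps flip: scaleR_add_left)

lemma rfl_inject:
  assumes "norm a = 1" "norm a' = 1" "rfl a b = rfl a' b'"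
  shows "(a' = a \<and> b' = b) \<or> (a' = - a \<and> b' = - b)"
proof -
  have e: "(2 * (a \<bullet> x - b)) *\<^sub>R a = (2 * (a' \<bullet> x - b')) *\<^sub>R a'" for x
    using fun_cong[OF assms(3), of x] by (simp add: rfl_def)
  \<comment> \<open>The point \<open>(b + 1 / 2) *\<^sub>R a\<close> is moved by exactly
    \<open>a\<close>, so comparing the two displacements there expresses \<open>a\<close> as a
    multiple of \<open>a'\<close>.\<close>
  define c where "c = 2 * (a' \<bullet> ((b + 1 / 2) *\<^sub>R a) - b')"
  have ca: "a = c *\<^sub>R a'"
    using e[of "(b + 1 / 2) *\<^sub>R a"] assms by (simp add: c_def unit_inner)
  then have "\<bar>c\<bar> = 1" using assms by (metis norm_scaleR mult.right_neutral)
  then consider "c = 1" | "c = -1" by linarith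
  then show ?thesis
  proof cases
    case 1
    then have "a = a'" using ca by simp
    moreover have "2 * b = 2 * b'" using e[of 0] calculation assms by auto
    ultimately show ?thesis by simp
  next
    case 2
    then have "a' = - a" using ca by simp
    moreover have "(2 * (- b)) *\<^sub>R a = (2 * b') *\<^sub>R a" using e[of 0] calculation by simp
    then have "2 * (- b) = 2 * b'" using assms(1) by (metis norm_zero scaleR_cancel_right zero_neq_one)
    ultimately show ?thesis by simp
  qed
qed

section \<open>Local finiteness of a discrete reflection group\<close>

locale discrete_reflection_group =
  fixes \<Gamma> :: "('e::euclidean_space \<Rightarrow> 'e) set"
  assumes discrete_reflection: "discrete_affine_reflection_group \<Gamma>"
begin

abbreviation "Iso \<equiv> isometry_group :: ('e \<Rightarrow> 'e) monoid"

lemma subgroup_\<Gamma>: "subgroup \<Gamma> Iso"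
proof -
  obtain R where R: "R \<subseteq> Collect affine_reflection" "\<Gamma> = generate Iso R"
    using discrete_reflection unfolding discrete_affine_reflection_group_def by blast
  then have "R \<subseteq> carrier Iso" using affine_reflection_isometry by blast
  then show ?thesis using R group.generate_is_subgroup[OF group_isometry_group] by blast
qed

lemma id_\<Gamma>: "id \<in> \<Gamma>"
  using subgroup.one_closed[OF subgroup_\<Gamma>] by (simp add: isometry_group_def)

lemma comp_\<Gamma>: "g \<in> \<Gamma> \<Longrightarrow> h \<in> \<Gamma> \<Longrightarrow> g \<circ> h \<in> \<Gamma>"
  using subgroup.m_closed[OF subgroup_\<Gamma>] by (simp add: isometry_group_def)

lemma \<Gamma>_carrier: "g \<in> \<Gamma> \<Longrightarrow> bij g" "g \<in> \<Gamma> \<Longrightarrow> dist (g x) (g y) = dist x y"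
  using subgroup.subset[OF subgroup_\<Gamma>] by (auto simp: isometry_group_def)

lemma inv_\<Gamma>:
  assumes "g \<in> \<Gamma>"
  shows "\<exists>h\<in>\<Gamma>. (\<forall>x. h (g x) = x) \<and> (\<forall>x. g (h x) = x)"
proof -
  interpret I: group Iso by (rule group_isometry_group)
  have g: "g \<in> carrier Iso" using assms subgroup.subset[OF subgroup_\<Gamma>] by blast
  let ?h = "inv\<^bsub>Iso\<^esub> g"
  have "?h \<otimes>\<^bsub>Iso\<^esub> g = \<one>\<^bsub>Iso\<^esub>" "g \<otimes>\<^bsub>Iso\<^esub> ?h = \<one>\<^bsub>Iso\<^esub>" using g by auto
  then have "?h \<circ> g = id" "g \<circ> ?h = id" by (simp_all add: isometry_group_def)
  then show ?thesis
    using subgroup.m_inv_closed[OF subgroup_\<Gamma> assms] by (metis comp_apply id_apply)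
qed

text \<open>No case for inverses arises because the generators are involutions.\<close>

lemma \<Gamma>_induct [consumes 1, case_names id rfl comp]:
  assumes "g \<in> \<Gamma>" and id: "P id" and rfl: "\<And>a b. norm a = 1 \<Longrightarrow> rfl a b \<in> \<Gamma> \<Longrightarrow> P (rfl a b)"
    and comp: "\<And>g h. g \<in> \<Gamma> \<Longrightarrow> h \<in> \<Gamma> \<Longrightarrow> P g \<Longrightarrow> P h \<Longrightarrow> P (g \<circ> h)"
  shows "P g"
proof -
  interpret I: group Iso by (rule group_isometry_group)
  obtain R where R: "R \<subseteq> Collect affine_reflection" "\<Gamma> = generate Iso R"
    using discrete_reflection unfolding discrete_affine_reflection_group_def by blast
  have PR: "P h" "inv\<^bsub>Iso\<^esub> h = h" if h: "h \<in> R" for h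
  proof -
    obtain a b where a: "norm a = 1" "h = rfl a b" using affine_reflection_rfl R h by blast
    then show "P h" using rfl[of a b] R h generate.incl[of h R] by auto
    have "h \<otimes>\<^bsub>Iso\<^esub> h = \<one>\<^bsub>Iso\<^esub>"
      using a by (simp add: isometry_group_def fun_eq_iff rfl_involution)
    moreover have "h \<in> carrier Iso" using R h affine_reflection_isometry by blast
    ultimately show "inv\<^bsub>Iso\<^esub> h = h" by (simp add: I.inv_equality)
  qed
  show ?thesis
    using assms(1) unfolding R(2)
  proof (induction rule: generate.induct)
    case one
    then show ?case using id by (simp add: isometry_group_def id_def)
  next
    case (eng h1 h2)
    then have "P (h1 \<circ> h2)" using R by (intro comp) auto
    then show ?case by (simp add: isometry_group_def o_def)
  qed (use PR in auto)
qed

lemma \<Gamma>_apply: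
  shows "g x = lin_part g x + g 0" by (simp add: lin_part_def)

lemma lin_part_\<Gamma>:
  assumes "g \<in> \<Gamma>"
  shows "linear (lin_part g) \<and> (\<forall>x y. lin_part g x \<bullet> lin_part g y = x \<bullet> y)"
  using assms
proof (induction rule: \<Gamma>_induct)
  case id
  then show ?case by (simp add: lin_part_def linear_id[unfolded id_def])
next
  case (rfl a b)
  then show ?case by (simp add: lin_part_rfl lrfl_linear lrfl_inner)
next
  case (comp g h)
  have e: "lin_part (g \<circ> h) = lin_part g \<circ> lin_part h"
  proof
    fix x
    have "lin_part g (h x) - lin_part g (h 0) = lin_part g (h x - h 0)"
      using comp by (simp add: linear_diff)
    then show "lin_part (g \<circ> h) x = (lin_part g \<circ> lin_part h) x" by (simp add: lin_part_def)
  qed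
  show ?case unfolding e using comp linear_compose[of "lin_part h" "lin_part g"] by (simp add: o_def)
qed

lemma lin_part_linear: "g \<in> \<Gamma> \<Longrightarrow> linear (lin_part g)"
  and lin_part_inner: "g \<in> \<Gamma> \<Longrightarrow> lin_part g x \<bullet> lin_part g y = x \<bullet> y"
  using lin_part_\<Gamma> by auto

lemma lin_part_norm: "g \<in> \<Gamma> \<Longrightarrow> norm (lin_part g x) = norm x"
  by (simp add: norm_eq_sqrt_inner lin_part_inner)

lemma lin_part_diff: "g \<in> \<Gamma> \<Longrightarrow> lin_part g (x - y) = g x - g y"
  using linear_diff[OF lin_part_linear, of g x y] by (simp add: lin_part_def)

lemma lin_part_comp: "g \<in> \<Gamma> \<Longrightarrow> lin_part (g \<circ> h) x = lin_part g (lin_part h x)"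
  using lin_part_diff[of g "h x" "h 0"] by (simp add: lin_part_def)

text \<open>A basic neighbourhood of the identity constrains only finitely many points. Infinitely
  many elements with bounded \<open>g 0\<close> stay bounded at each of these points, so repeated
  pigeonholing leaves infinitely many that nearly agree there; their quotients lie in the
  neighbourhood and are the identity.\<close>

lemma locally_finite: "finite {g \<in> \<Gamma>. norm (g 0) \<le> r}"
proof (rule ccontr)
  let ?A = "{g \<in> \<Gamma>. norm (g 0) \<le> r}"
  assume inf: "infinite ?A"
  have "id isolated_in \<Gamma>"
    using discrete_reflection id_\<Gamma> by (simp add: discrete_affine_reflection_group_def discrete_def)
  then obtain U where U: "open U" "U \<inter> \<Gamma> = {id}" by (auto simp: isolated_in_def)
  then have "openin (product_topology (\<lambda>i. euclidean) UNIV) U" "id \<in> U"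
    by (auto simp: open_fun_def)
  from product_topology_open_contains_basis[OF this]
  obtain X :: "'e \<Rightarrow> 'e set" where X: "id \<in> (\<Pi>\<^sub>E i\<in>UNIV. X i)" "\<And>i. open (X i)"
    "finite {i. X i \<noteq> UNIV}" "(\<Pi>\<^sub>E i\<in>UNIV. X i) \<subseteq> U"
    by (auto simp: open_openin[symmetric])
  define I where "I = {i. X i \<noteq> UNIV}"
  have fI: "finite I" using X(3) by (simp add: I_def)
  have "\<forall>i. \<exists>e>0. ball i e \<subseteq> X i"
    using X(1,2) by (auto simp: PiE_iff) (metis id_apply open_contains_ball)
  then obtain e where e: "\<And>i. 0 < e i" "\<And>i. ball i (e i) \<subseteq> X i" by metis
  define \<epsilon> where "\<epsilon> = Min (insert 1 (e ` I))"
  have \<epsilon>: "0 < \<epsilon>" "\<And>i. i \<in> I \<Longrightarrow> \<epsilon> \<le> e i" using fI e(1) by (auto simp: \<epsilon>_def)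
  have close_id: "g = id" if "g \<in> \<Gamma>" "\<And>i. i \<in> I \<Longrightarrow> dist (g i) i < \<epsilon>" for g
  proof -
    have "g i \<in> X i" for i
    proof (cases "i \<in> I")
      case True
      then have "g i \<in> ball i (e i)" using that(2)[OF True] \<epsilon>(2)[OF True] by (simp add: dist_commute)
      then show ?thesis using e by blast
    qed (simp add: I_def)
    then have "g \<in> U" using X(4) by (auto simp: PiE_iff)
    then show ?thesis using that(1) U(2) by blast
  qed
  have "\<exists>B\<subseteq>?A. infinite B \<and> (\<forall>i\<in>I. \<forall>g\<in>B. \<forall>h\<in>B. dist (g i) (h i) < \<epsilon>)"
    using fI
  proof (induction I rule: finite_induct)
    case empty
    then show ?case using inf by blast
  next
    case (insert i I)
    then obtain B where B: "B \<subseteq> ?A" "infinite B" "\<forall>i\<in>I. \<forall>g\<in>B. \<forall>h\<in>B. dist (g i) (h i) < \<epsilon>" by blast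
    have "bounded ((\<lambda>g. g i) ` B)"
    proof (rule boundedI)
      fix v assume "v \<in> (\<lambda>g. g i) ` B"
      then obtain g where g: "g \<in> \<Gamma>" "norm (g 0) \<le> r" "v = g i" using B by blast
      have "norm (g i) \<le> norm (lin_part g i) + norm (g 0)"
        using norm_triangle_ineq[of "lin_part g i" "g 0"] by (simp add: lin_part_def)
      then show "norm v \<le> norm i + r" using g by (simp add: lin_part_norm)
    qed
    from infinite_close_subset[OF B(2) this \<epsilon>(1)] obtain C where
      "C \<subseteq> B" "infinite C" "\<forall>g\<in>C. \<forall>h\<in>C. dist (g i) (h i) < \<epsilon>" by blast
    then show ?case using B by (intro exI[of _ C]) (auto simp: subset_iff)
  qed
  then obtain B where B: "B \<subseteq> ?A" "infinite B" "\<forall>i\<in>I. \<forall>g\<in>B. \<forall>h\<in>B. dist (g i) (h i) < \<epsilon>" by blast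
  have "g = h" if gh: "g \<in> B" "h \<in> B" for g h
  proof -
    have "g \<in> \<Gamma>" "h \<in> \<Gamma>" using gh B by auto
    then obtain k where k: "k \<in> \<Gamma>" "\<And>x. k (h x) = x" "\<And>x. h (k x) = x" using inv_\<Gamma> by metis
    have "dist ((k \<circ> g) i) i < \<epsilon>" if "i \<in> I" for i
      using \<Gamma>_carrier(2)[OF k(1), of "g i" "h i"] B(3) gh that k(2) by simp
    then have "k \<circ> g = id" using close_id[of "k \<circ> g"] comp_\<Gamma> k(1) \<open>g \<in> \<Gamma>\<close> by blast
    then have "k (g x) = x" for x by (metis comp_apply id_apply)
    then show "g = h" using k(3) by (metis ext)
  qed
  moreover obtain g where "g \<in> B" using B(2) by (metis ex_in_conv finite.emptyI)
  ultimately have "B \<subseteq> {g}" by blast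
  then show False using B(2) finite_subset by blast
qed

lemma locally_finite_at: "finite {g \<in> \<Gamma>. norm (g x - y) \<le> r}"
proof (rule finite_subset[OF _ locally_finite[of "norm x + norm y + r"]], safe)
  fix g assume g: "g \<in> \<Gamma>" "norm (g x - y) \<le> r"
  have "g 0 = (g x - y) + y - lin_part g x" by (simp add: lin_part_def)
  then have "norm (g 0) \<le> norm (g x - y) + norm y + norm (lin_part g x)"
    using norm_triangle_ineq4[of "(g x - y) + y" "lin_part g x"] norm_triangle_ineq[of "g x - y" y]
    by simp
  then show "norm (g 0) \<le> norm x + norm y + r" using g by (simp add: lin_part_norm)
qed

section \<open>Affine roots\<close>

text \<open>A pair is read as the affine function \<open>a \<bullet> x - b\<close>, a vector of
  \<open>'e \<times> real\<close>, so linear cone arguments apply to affine mirrors. Each mirror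
  contributes two opposite pairs.\<close>

definition roots :: "('e \<times> real) set" where
  "roots = {(a, b). norm a = 1 \<and> rfl a b \<in> \<Gamma>}"

lemma roots_neg: "(a, b) \<in> roots \<Longrightarrow> (- a, - b) \<in> roots"
  by (simp add: roots_def rfl_neg)

lemma roots_image:
  assumes g: "g \<in> \<Gamma>" and r: "(a, b) \<in> roots"
  shows "(lin_part g a, b + lin_part g a \<bullet> g 0) \<in> roots"
proof -
  obtain h where h: "h \<in> \<Gamma>" "\<And>x. h (g x) = x" "\<And>x. g (h x) = x" using inv_\<Gamma>[OF g] by blast
  have "rfl (lin_part g a) (b + lin_part g a \<bullet> g 0) x = (g \<circ> rfl a b \<circ> h) x" for x
  proof -
    let ?y = "h x"
    have x: "x = lin_part g ?y + g 0" using h(3)[of x] \<Gamma>_apply[of g ?y] by simp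
    have "lin_part g a \<bullet> x - (b + lin_part g a \<bullet> g 0) = a \<bullet> ?y - b"
      by (subst x) (simp add: inner_add_right lin_part_inner[OF g])
    then have "rfl (lin_part g a) (b + lin_part g a \<bullet> g 0) x = x - (2 * (a \<bullet> ?y - b)) *\<^sub>R lin_part g a"
      by (simp add: rfl_def)
    also have "\<dots> = lin_part g (rfl a b ?y) + g 0"
      by (subst x) (simp add: rfl_def linear_diff[OF lin_part_linear[OF g]]
          linear_scale[OF lin_part_linear[OF g]])
    finally show ?thesis by (simp add: lin_part_def)
  qed
  then have "rfl (lin_part g a) (b + lin_part g a \<bullet> g 0) = g \<circ> rfl a b \<circ> h" by blast
  moreover have "g \<circ> rfl a b \<circ> h \<in> \<Gamma>" using g h r by (auto simp: roots_def intro!: comp_\<Gamma>)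
  ultimately show ?thesis using r by (simp add: roots_def lin_part_norm[OF g])
qed

text \<open>\<open>rfl a b\<close> moves the origin by \<open>2 * b\<close> along a unit vector, so
  bounded offsets fall under local finiteness, and a reflection has at most two roots.\<close>

lemma finite_roots: "finite {(a, b) \<in> roots. \<bar>b\<bar> \<le> r}"
proof -
  let ?F = "{g \<in> \<Gamma>. norm (g 0) \<le> 2 * r}"
  have fib: "finite {(a, b). norm a = 1 \<and> rfl a b = g}" (is "finite ?S") for g :: "'e \<Rightarrow> 'e"
  proof (cases "?S = {}")
    case False
    then obtain a b where "norm a = 1" "rfl a b = g" by auto
    then have "z \<in> {(a, b), (- a, - b)}" if "z \<in> ?S" for z
      using that rfl_inject[of a "fst z" b "snd z"] by (auto simp: prod_eq_iff)
    then have "?S \<subseteq> {(a, b), (- a, - b)}" by blast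
    then show ?thesis by (rule finite_subset) simp
  qed (metis finite.emptyI)
  have "{(a, b) \<in> roots. \<bar>b\<bar> \<le> r} \<subseteq> (\<Union>g\<in>?F. {(a, b). norm a = 1 \<and> rfl a b = g})"
    by (auto simp: roots_def rfl_def)
  then show ?thesis using locally_finite fib by (auto intro: finite_subset)
qed

lemma countable_roots: "countable roots"
proof -
  have "roots \<subseteq> (\<Union>n::nat. {(a, b) \<in> roots. \<bar>b\<bar> \<le> real n})"
    using real_arch_simple by fastforce
  moreover have "countable (\<Union>n::nat. {(a, b) \<in> roots. \<bar>b\<bar> \<le> real n})"
    using finite_roots by (intro countable_UN) (auto intro: countable_finite)
  ultimately show ?thesis by (rule countable_subset)
qed

end

text \<open>Countably many hyperplanes form a null set.\<close>

lemma generic_point: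
  fixes R :: "('e::euclidean_space \<times> real) set"
  assumes "countable R" "\<And>a b. (a, b) \<in> R \<Longrightarrow> a \<noteq> 0"
  shows "\<exists>p. \<forall>(a, b)\<in>R. a \<bullet> p \<noteq> b"
proof -
  let ?F = "(\<lambda>(a, b). {x. a \<bullet> x = b}) ` R"
  have "negligible (\<Union>?F)"
    using assms by (intro negligible_countable_Union) (auto intro!: negligible_hyperplane)
  then have "\<Union>?F \<noteq> UNIV" using non_negligible_UNIV by metis
  then obtain p where "p \<notin> \<Union>?F" by blast
  then show ?thesis by (intro exI[of _ p]) auto
qed

section \<open>Indecomposable elements\<close>

definition ncone :: "'v::real_vector set \<Rightarrow> 'v set" where
  "ncone X = {\<Sum>x\<in>X. c x *\<^sub>R x | c. \<forall>x\<in>X. 0 \<le> c x}"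

text \<open>Simple roots without a lattice: coefficients are real since normals have length one, and
  indecomposability is tested against two other elements only.\<close>

definition indec :: "'v::real_vector set \<Rightarrow> 'v set" where
  "indec Q = {x \<in> Q. \<not> (\<exists>c>0. \<exists>d>0. \<exists>y\<in>Q - {x}. \<exists>z\<in>Q - {x}. x = c *\<^sub>R y + d *\<^sub>R z)}"

lemma ncone_scale: "v \<in> ncone X \<Longrightarrow> 0 \<le> r \<Longrightarrow> r *\<^sub>R v \<in> ncone X"
proof -
  assume "v \<in> ncone X" "0 \<le> r"
  then obtain c where "v = (\<Sum>x\<in>X. c x *\<^sub>R x)" "\<forall>x\<in>X. 0 \<le> c x" by (auto simp: ncone_def)
  then show "r *\<^sub>R v \<in> ncone X" unfolding ncone_def using \<open>0 \<le> r\<close>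
    by (intro CollectI exI[of _ "\<lambda>x. r * c x"]) (simp add: scaleR_sum_right)
qed

lemma ncone_add: "v \<in> ncone X \<Longrightarrow> w \<in> ncone X \<Longrightarrow> v + w \<in> ncone X"
proof -
  assume "v \<in> ncone X" "w \<in> ncone X"
  then obtain c d where "v = (\<Sum>x\<in>X. c x *\<^sub>R x)" "\<forall>x\<in>X. 0 \<le> c x"
    "w = (\<Sum>x\<in>X. d x *\<^sub>R x)" "\<forall>x\<in>X. 0 \<le> d x" by (auto simp: ncone_def)
  then show "v + w \<in> ncone X" unfolding ncone_def
    by (intro CollectI exI[of _ "\<lambda>x. c x + d x"]) (simp add: sum.distrib scaleR_add_left)
qed

lemma ncone_mono:
  assumes "finite Y" "X \<subseteq> Y" shows "ncone X \<subseteq> ncone Y"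
proof
  fix v assume "v \<in> ncone X"
  then obtain c where c: "v = (\<Sum>x\<in>X. c x *\<^sub>R x)" "\<forall>x\<in>X. 0 \<le> c x" by (auto simp: ncone_def)
  have "v = (\<Sum>x\<in>Y. (if x \<in> X then c x else 0) *\<^sub>R x)"
    using assms c(1) by (simp add: sum.mono_neutral_cong_right[of Y X])
  then show "v \<in> ncone Y" unfolding ncone_def using c(2)
    by (intro CollectI exI[of _ "\<lambda>x. if x \<in> X then c x else 0"]) auto
qed

lemma ncone_member:
  assumes "finite X" "x \<in> X" shows "x \<in> ncone X"
proof -
  have "x = (\<Sum>y\<in>X. (if y = x then 1 else 0) *\<^sub>R y)"
    using assms by (simp add: if_distrib[of "\<lambda>c. c *\<^sub>R _"] sum.delta cong: if_cong)
  then show ?thesis unfolding ncone_def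
    by (intro CollectI exI[of _ "\<lambda>y. if y = x then 1 else 0"]) auto
qed

lemma ncone_linear_zero:
  assumes "linear f" "\<And>x. x \<in> X \<Longrightarrow> f x = (0::real)" "v \<in> ncone X"
  shows "f v = 0"
  using assms by (auto simp: ncone_def linear_sum linear_scale)

text \<open>A generating subset of least size consists of indecomposables. A decomposition of
  \<open>x\<close> rewrites as \<open>x = e x *\<^sub>R x\<close> plus a combination of the others:
  if \<open>e x < 1\<close> then \<open>x\<close> can be solved for and dropped; otherwise
  positivity of \<open>f\<close> kills the other coefficients and makes a summand proportional to
  \<open>x\<close>.\<close>

lemma indec_generates:
  fixes Q :: "'v::real_vector set" and f :: "'v \<Rightarrow> real"
  assumes "finite Q" and f: "linear f" "\<And>x. x \<in> Q \<Longrightarrow> 0 < f x"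
    and multiple: "\<And>x c. x \<in> Q \<Longrightarrow> 0 < c \<Longrightarrow> c *\<^sub>R x \<in> Q \<Longrightarrow> c = 1"
  shows "Q \<subseteq> ncone (indec Q)"
proof -
  have "Q \<subseteq> Q \<and> Q \<subseteq> ncone Q" using assms(1) ncone_member by blast
  then obtain D where D: "D \<subseteq> Q" "Q \<subseteq> ncone D"
    and min: "\<And>E. E \<subseteq> Q \<and> Q \<subseteq> ncone E \<Longrightarrow> card D \<le> card E"
    using ex_has_least_nat[of "\<lambda>D. D \<subseteq> Q \<and> Q \<subseteq> ncone D" Q card] by blast
  have fD: "finite D" using D(1) assms(1) finite_subset by blast
  have "D \<subseteq> indec Q"
  proof
    fix x assume x: "x \<in> D"
    show "x \<in> indec Q"
    proof (rule ccontr)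
      assume "x \<notin> indec Q"
      then obtain c d y z where cd: "0 < c" "0 < d" and yz: "y \<in> Q - {x}" "z \<in> Q - {x}"
        and xe: "x = c *\<^sub>R y + d *\<^sub>R z"
        using x D(1) unfolding indec_def by blast
      obtain b where b: "y = (\<Sum>w\<in>D. b w *\<^sub>R w)" "\<forall>w\<in>D. 0 \<le> b w"
        using yz D(2) by (auto simp: ncone_def)
      obtain g where g: "z = (\<Sum>w\<in>D. g w *\<^sub>R w)" "\<forall>w\<in>D. 0 \<le> g w"
        using yz D(2) by (auto simp: ncone_def)
      define e where "e w = c * b w + d * g w" for w
      have e0: "0 \<le> e w" if "w \<in> D" for w using that b(2) g(2) cd by (simp add: e_def)
      have "x = (\<Sum>w\<in>D. e w *\<^sub>R w)"
        using xe b(1) g(1) by (simp add: e_def scaleR_sum_right sum.distrib scaleR_add_left)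
      then have xs: "x = e x *\<^sub>R x + (\<Sum>w\<in>D - {x}. e w *\<^sub>R w)"
        using sum.remove[OF fD x, of "\<lambda>w. e w *\<^sub>R w"] by simp
      show False
      proof (cases "e x < 1")
        case True
        let ?s = "\<Sum>w\<in>D - {x}. e w *\<^sub>R w"
        have "(1 - e x) *\<^sub>R x = ?s" using xs by (simp add: scaleR_diff_left algebra_simps)
        moreover have "(1 / (1 - e x)) *\<^sub>R ((1 - e x) *\<^sub>R x) = x" using True by simp
        moreover have "?s \<in> ncone (D - {x})" unfolding ncone_def using e0 by blast
        ultimately have xc: "x \<in> ncone (D - {x})" using ncone_scale[of ?s "D - {x}" "1 / (1 - e x)"] True by simp
        have "Q \<subseteq> ncone (D - {x})"
        proof
          fix q assume "q \<in> Q"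
          then obtain h where h: "q = (\<Sum>w\<in>D. h w *\<^sub>R w)" "\<forall>w\<in>D. 0 \<le> h w"
            using D(2) by (auto simp: ncone_def)
          have "q = h x *\<^sub>R x + (\<Sum>w\<in>D - {x}. h w *\<^sub>R w)"
            using sum.remove[OF fD x, of "\<lambda>w. h w *\<^sub>R w"] h(1) by simp
          moreover have "(\<Sum>w\<in>D - {x}. h w *\<^sub>R w) \<in> ncone (D - {x})"
            unfolding ncone_def using h(2) by blast
          ultimately show "q \<in> ncone (D - {x})" using xc h(2) x by (metis ncone_add ncone_scale)
        qed
        then have "card D \<le> card (D - {x})" using D(1) by (intro min) blast
        then show False using fD x by (metis card_Diff1_less not_less)
      next
        case False
        have fx: "f x = e x * f x + (\<Sum>w\<in>D - {x}. e w * f w)"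
          using arg_cong[OF xs, of f] f(1) by (simp add: linear_add linear_scale linear_sum)
        have nn: "0 \<le> e w * f w" if "w \<in> D - {x}" for w
          using that e0 f(2) D(1) by (intro mult_nonneg_nonneg) (auto intro: less_imp_le)
        have "f x \<le> e x * f x" using False f(2)[of x] x D(1) by auto
        moreover have "0 \<le> (\<Sum>w\<in>D - {x}. e w * f w)" by (rule sum_nonneg) (rule nn)
        ultimately have "(\<Sum>w\<in>D - {x}. e w * f w) = 0" using fx by linarith
        then have "\<forall>w\<in>D - {x}. e w * f w = 0" using fD nn by (subst (asm) sum_nonneg_eq_0_iff) auto
        then have ez: "e w = 0" if "w \<in> D - {x}" for w using that f(2)[of w] D(1) by fastforce
        have bz: "b w = 0" if "w \<in> D - {x}" for w
        proof -
          have "c * b w + d * g w = 0" "0 \<le> c * b w" "0 \<le> d * g w"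
            using ez[OF that] that b(2) g(2) cd by (auto simp: e_def)
          then have "c * b w = 0" by linarith
          then show ?thesis using cd by simp
        qed
        have "y = b x *\<^sub>R x + (\<Sum>w\<in>D - {x}. b w *\<^sub>R w)"
          using sum.remove[OF fD x, of "\<lambda>w. b w *\<^sub>R w"] b(1) by simp
        then have y: "y = b x *\<^sub>R x" using bz by simp
        have "0 < b x * f x" using f(2)[of y] yz(1) y f(1) by (simp add: linear_scale)
        then have "0 < b x" using f(2)[of x] x D(1) zero_less_mult_pos2 by blast
        then have "b x = 1" using multiple[of x "b x"] x D(1) yz(1) y by auto
        then show False using y yz(1) by simp
      qed
    qed
  qed
  moreover have "finite (indec Q)" using assms(1) by (simp add: indec_def)
  ultimately show ?thesis using D(2) ncone_mono by blast
qed

text \<open>If \<open>B x y\<close> were positive, the reflected vector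
  \<open>z = y - (2 * B x y) *\<^sub>R x\<close> would decompose \<open>y\<close> when
  \<open>z\<close> is in \<open>Q\<close>, and \<open>x\<close> when \<open>- z\<close> is.\<close>

lemma indec_obtuse:
  fixes Q :: "'v::real_vector set" and f :: "'v \<Rightarrow> real" and B :: "'v \<Rightarrow> 'v \<Rightarrow> real"
  assumes f: "linear f" "\<And>x. x \<in> Q \<Longrightarrow> 0 < f x"
    and multiple: "\<And>x c. x \<in> Q \<Longrightarrow> 0 < c \<Longrightarrow> c *\<^sub>R x \<in> Q \<Longrightarrow> c = 1"
    and refl: "\<And>x y. x \<in> Q \<Longrightarrow> y \<in> Q \<Longrightarrow>
      y - (2 * B x y) *\<^sub>R x \<in> Q \<or> - (y - (2 * B x y) *\<^sub>R x) \<in> Q"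
    and x: "x \<in> indec Q" and y: "y \<in> indec Q" and "x \<noteq> y"
  shows "B x y \<le> 0"
proof (rule ccontr)
  assume "\<not> B x y \<le> 0"
  then have b: "0 < 2 * B x y" by simp
  define b where "b = 2 * B x y"
  have b0: "0 < b" using b by (simp add: b_def)
  have xQ: "x \<in> Q" and yQ: "y \<in> Q" using x y by (auto simp: indec_def)
  have x0: "x \<noteq> 0" using f xQ by (metis linear_0 less_irrefl)
  define z where "z = y - b *\<^sub>R x"
  consider "z \<in> Q" | "- z \<in> Q" using refl[OF xQ yQ] by (auto simp: z_def b_def)
  then show False
  proof cases
    case 1
    have ye: "y = 1 *\<^sub>R z + b *\<^sub>R x" by (simp add: z_def)
    have "z \<noteq> y" using x0 b0 by (simp add: z_def)
    moreover have "z \<in> Q - {y}" "x \<in> Q - {y}" "(0::real) < 1"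
      using 1 xQ \<open>x \<noteq> y\<close> \<open>z \<noteq> y\<close> by auto
    ultimately show False using y b0 ye unfolding indec_def by blast
  next
    case 2
    have e: "x = (1 / b) *\<^sub>R y + (1 / b) *\<^sub>R (- z)"
      using b0 by (simp add: z_def scaleR_diff_right)
    have "- z \<noteq> x"
    proof
      assume "- z = x"
      then have ye: "y = (b - 1) *\<^sub>R x" by (simp add: z_def algebra_simps)
      have "0 < (b - 1) * f x" using f(2)[OF yQ] f(1) ye by (simp add: linear_scale)
      then have "0 < b - 1" using f(2)[OF xQ] zero_less_mult_pos2 by blast
      then have "b - 1 = 1" using multiple[OF xQ] yQ ye by simp
      then show False using ye \<open>x \<noteq> y\<close> by simp
    qed
    then have "- z \<in> Q - {x}" "y \<in> Q - {x}" "0 < 1 / b" using 2 yQ \<open>x \<noteq> y\<close> b0 by auto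
    then show False using x e unfolding indec_def by blast
  qed
qed

section \<open>Finiteness of the set of directions\<close>

context discrete_reflection_group
begin

definition dirs :: "'e set" where "dirs = fst ` roots"

lemma roots_norm: "(a, b) \<in> roots \<Longrightarrow> norm a = 1"
  by (simp add: roots_def)

text \<open>An affine reflection acts on affine functions, hence on pairs, by a linear
  reflection.\<close>

lemma roots_rfl:
  assumes "(a, b) \<in> roots" "(a', b') \<in> roots"
  shows "(a', b') - (2 * (a \<bullet> a')) *\<^sub>R (a, b) \<in> roots"
proof -
  have "(lin_part (rfl a b) a', b' + lin_part (rfl a b) a' \<bullet> rfl a b 0) \<in> roots"
    using assms by (intro roots_image) (auto simp: roots_def)
  moreover have "lin_part (rfl a b) a' = a' - (2 * (a \<bullet> a')) *\<^sub>R a"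
    by (simp add: lin_part_rfl lrfl_def)
  moreover have "b' + (a' - (2 * (a \<bullet> a')) *\<^sub>R a) \<bullet> rfl a b 0 = b' - 2 * (a \<bullet> a') * b"
    using unit_inner[OF roots_norm[OF assms(1)]]
    by (simp add: rfl_def inner_diff_left inner_commute algebra_simps)
  ultimately show ?thesis by simp
qed

text \<open>Every point can be moved by \<open>\<Gamma>\<close> into the closed chamber of a generic point \<open>p\<close>. The roots
  vanishing at a point of that chamber are determined by the walls through this point, and
  there are only finitely many walls. So finitely many numbers occur as inner products of the
  normals of two intersecting mirrors.\<close>

lemma finite_dirs: "finite dirs"
proof -
  have "\<exists>p. \<forall>(a, b)\<in>roots. a \<bullet> p \<noteq> b"
    using countable_roots roots_norm by (intro generic_point) force+
  then obtain p where p: "\<And>a b. (a, b) \<in> roots \<Longrightarrow> a \<bullet> p \<noteq> b" by blast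
  define f where "f x l = fst l \<bullet> x - snd l" for x :: 'e and l :: "'e \<times> real"
  have lf: "linear (f x)" for x
    by (intro linearI) (auto simp: f_def inner_add_left algebra_simps)
  define P where "P = {l \<in> roots. 0 < f p l}"
  have PR: "l \<in> P \<Longrightarrow> l \<in> roots" for l by (simp add: P_def)
  have P: "l \<in> P \<or> - l \<in> P" if "l \<in> roots" for l
  proof (cases l)
    case (Pair a b)
    then show ?thesis using that p[of a b] roots_neg[of a b] by (auto simp: P_def f_def)
  qed
  have pos: "0 < f p l" if "l \<in> P" for l using that by (simp add: P_def)
  have mult: "c = 1" if "l \<in> P" "0 < c" "c *\<^sub>R l \<in> P" for l c
  proof -
    have "norm (fst l) = 1" "norm (c *\<^sub>R fst l) = 1"
      using that PR roots_norm by (metis prod.collapse, metis fst_scaleR prod.collapse)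
    then show ?thesis using \<open>0 < c\<close> by simp
  qed
  have refl: "l' - (2 * (fst l \<bullet> fst l')) *\<^sub>R l \<in> P \<or> - (l' - (2 * (fst l \<bullet> fst l')) *\<^sub>R l) \<in> P"
    if "l \<in> P" "l' \<in> P" for l l'
    using P[OF roots_rfl[of "fst l" "snd l" "fst l'" "snd l'"]] that PR by simp
  define S where "S = indec P"
  have obt: "fst l \<bullet> fst l' \<le> 0" if "l \<in> S" "l' \<in> S" "l \<noteq> l'" for l l'
  proof (rule indec_obtuse[where B = "\<lambda>l l'. fst l \<bullet> fst l'" and f = "f p" and Q = P])
    show "c = 1" if "k \<in> P" "0 < c" "c *\<^sub>R k \<in> P" for k c by (rule mult[OF that])
  qed (use that lf pos refl in \<open>simp_all add: S_def\<close>)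
  have SR: "l \<in> S \<Longrightarrow> norm (fst l) = 1" for l
    using PR roots_norm[of "fst l" "snd l"] by (auto simp: S_def indec_def)
  have "finite S"
  proof -
    have "inj_on fst S"
    proof (rule inj_onI, rule ccontr)
      fix l l' assume l: "l \<in> S" "l' \<in> S" "fst l = fst l'" "l \<noteq> l'"
      then have "fst l \<bullet> fst l \<le> 0" using obt[of l l'] by simp
      then show False using unit_inner[OF SR[OF l(1)]] by simp
    qed
    moreover have "finite (fst ` S)"
    \<comment> \<open>Distinct unit vectors with nonpositive inner product have distance at least
      the square root of 2, so 1 is a safe separation.\<close>
    proof (rule finite_if_separated[of _ 1])
      show "bounded (fst ` S)" using SR by (intro boundedI[of _ 1]) auto
      fix a a' assume a: "a \<in> fst ` S" "a' \<in> fst ` S" "a \<noteq> a'"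
      then obtain l l' where l: "l \<in> S" "l' \<in> S" "a = fst l" "a' = fst l'" "l \<noteq> l'" by auto
      have "(dist a a')\<^sup>2 = a \<bullet> a + a' \<bullet> a' - 2 * (a \<bullet> a')"
        by (simp add: dist_norm power2_norm_eq_inner inner_diff_left inner_diff_right inner_commute)
      moreover have "a \<bullet> a = 1" "a' \<bullet> a' = 1" using unit_inner[OF SR[OF l(1)]] unit_inner[OF SR[OF l(2)]] l by simp_all
      ultimately have "1\<^sup>2 \<le> (dist a a')\<^sup>2" using l obt[of l l'] by simp
      then show "1 \<le> dist a a'" by (rule power2_le_imp_le) simp
    qed simp
    ultimately show ?thesis using finite_imageD by blast
  qed
  define C where "C = {x. \<forall>l\<in>P. 0 \<le> f x l}"
  define Px where "Px x = {l \<in> P. f x l = 0}" for x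
  have finPx: "finite (Px x)" for x
  proof (rule finite_subset[OF _ finite_roots[of "norm x"]], safe)
    fix a b assume "(a, b) \<in> Px x"
    then have ab: "(a, b) \<in> roots" "b = a \<bullet> x" by (auto simp: Px_def P_def f_def)
    then show "\<bar>b\<bar> \<le> norm x" using Cauchy_Schwarz_ineq2[of a x] roots_norm[OF ab(1)] by simp
    show "(a, b) \<in> roots" by fact
  qed
  \<comment> \<open>\<open>P\<close> may be infinite, so cone generation is applied to the finite
    set \<open>Px x\<close>. On the chamber all of \<open>P\<close> is nonnegative at
    \<open>x\<close>, so in a decomposition of a root vanishing at \<open>x\<close> both summands
    vanish there too: indecomposable in \<open>Px x\<close> implies indecomposable in
    \<open>P\<close>.\<close>
  have Px_cone: "Px x \<subseteq> ncone (S \<inter> Px x)" if x: "x \<in> C" for x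
  proof -
    have "Px x \<subseteq> ncone (indec (Px x))"
      by (rule indec_generates[OF finPx lf[of p]]) (use pos mult in \<open>auto simp: Px_def\<close>)
    moreover have "indec (Px x) \<subseteq> S \<inter> Px x"
    proof (intro subsetI IntI)
      fix l assume l: "l \<in> indec (Px x)"
      then show lP: "l \<in> Px x" by (simp add: indec_def)
      show "l \<in> S"
      proof (rule ccontr)
        assume "l \<notin> S"
        then obtain c d y z where cd: "0 < c" "0 < d" and yz: "y \<in> P - {l}" "z \<in> P - {l}"
          and le: "l = c *\<^sub>R y + d *\<^sub>R z"
          using lP unfolding S_def indec_def Px_def by blast
        have "f x l = c * f x y + d * f x z" by (simp add: le linear_add[OF lf] linear_scale[OF lf])
        moreover have "f x l = 0" using lP by (simp add: Px_def)
        moreover have "0 \<le> f x y" "0 \<le> f x z" using x yz by (auto simp: C_def)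
        ultimately have "c * f x y = 0" "d * f x z = 0"
          using cd mult_nonneg_nonneg[of c "f x y"] mult_nonneg_nonneg[of d "f x z"] by linarith+
        then have "f x y = 0" "f x z = 0" using cd by auto
        then have "y \<in> Px x - {l}" "z \<in> Px x - {l}" using yz by (auto simp: Px_def)
        then show False using l le cd unfolding indec_def by blast
      qed
    qed
    ultimately show ?thesis using ncone_mono[of "S \<inter> Px x" "indec (Px x)"] finPx by blast
  qed
  have "inj_on (\<lambda>Q. S \<inter> Q) (Px ` C)"
  proof (rule inj_onI)
    have sub: "Px x \<subseteq> Px y" if "x \<in> C" "S \<inter> Px x = S \<inter> Px y" for x y
    proof
      fix l assume l: "l \<in> Px x"
      then have "l \<in> ncone (S \<inter> Px y)" using Px_cone[OF that(1)] that(2) by auto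
      then have "f y l = 0" by (rule ncone_linear_zero[OF lf, rotated]) (simp add: Px_def)
      then show "l \<in> Px y" using l by (simp add: Px_def)
    qed
    fix Q Q' assume "Q \<in> Px ` C" "Q' \<in> Px ` C" "S \<inter> Q = S \<inter> Q'"
    then show "Q = Q'" using sub by (metis (no_types, lifting) imageE subset_antisym)
  qed
  moreover have "(\<lambda>Q. S \<inter> Q) ` (Px ` C) \<subseteq> Pow S" by auto
  ultimately have finPC: "finite (Px ` C)"
    using \<open>finite S\<close> by (meson finite_Pow_iff inj_on_finite)
  \<comment> \<open>Take the point of the orbit nearest to \<open>p\<close>, which exists by local
    finiteness. A mirror separating it from \<open>p\<close> would reflect it to a nearer
    point.\<close>
  have to_C: "\<exists>g\<in>\<Gamma>. g y \<in> C" for y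
  proof -
    let ?A = "{g \<in> \<Gamma>. norm (g y - p) \<le> norm (y - p)}"
    have fA: "finite ?A" by (rule locally_finite_at)
    have idA: "id \<in> ?A" using id_\<Gamma> by simp
    have "\<exists>g\<in>?A. \<forall>h\<in>?A. norm (g y - p) \<le> norm (h y - p)"
    proof (rule bexI[of _ "arg_min_on (\<lambda>g. norm (g y - p)) ?A"])
      have ne: "?A \<noteq> {}" using idA by blast
      show "\<forall>h\<in>?A. norm (arg_min_on (\<lambda>g. norm (g y - p)) ?A y - p) \<le> norm (h y - p)"
        using arg_min_if_finite(2)[OF fA ne, of "\<lambda>g. norm (g y - p)"] by (meson not_less)
      show "arg_min_on (\<lambda>g. norm (g y - p)) ?A \<in> ?A" by (rule arg_min_if_finite(1)[OF fA ne])
    qed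
    then obtain g where g: "g \<in> ?A" and "\<forall>h\<in>?A. norm (g y - p) \<le> norm (h y - p)"
      by (elim bexE)
    note min = bspec[OF this(2)]
    have "g y \<in> C"
      unfolding C_def
    proof (safe, rule ccontr)
      fix a b assume ab: "(a, b) \<in> P" and neg: "\<not> 0 \<le> f (g y) (a, b)"
      have a: "(a, b) \<in> roots" "norm a = 1" using ab PR roots_norm by auto
      define v where "v = a \<bullet> g y - b"
      define w where "w = a \<bullet> p - b"
      have v: "v < 0" and w: "0 < w" using neg pos[OF ab] by (auto simp: v_def w_def f_def)
      let ?h = "rfl a b \<circ> g"
      have hy: "?h y - p = (g y - p) - (2 * v) *\<^sub>R a" by (simp add: rfl_def v_def)
      have "(norm (z - (2 * v) *\<^sub>R a))\<^sup>2 = (norm z)\<^sup>2 + 4 * (v * w)" if z: "a \<bullet> z = v - w" for z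
      proof -
        have "(norm (z - (2 * v) *\<^sub>R a))\<^sup>2 = z \<bullet> z - 4 * v * (a \<bullet> z) + 4 * v * v * (a \<bullet> a)"
          by (simp add: power2_norm_eq_inner inner_diff_left inner_diff_right inner_commute[of z a]
              algebra_simps)
        then show ?thesis
          unfolding z unit_inner[OF a(2)] by (simp add: power2_norm_eq_inner algebra_simps)
      qed
      moreover have "a \<bullet> (g y - p) = v - w" by (simp add: v_def w_def inner_diff_right)
      ultimately have "(norm (?h y - p))\<^sup>2 = (norm (g y - p))\<^sup>2 + 4 * (v * w)"
        unfolding hy by blast
      moreover have "v * w < 0" using v w by (rule mult_neg_pos)
      ultimately have "(norm (?h y - p))\<^sup>2 < (norm (g y - p))\<^sup>2" by linarith
      then have lt: "norm (?h y - p) < norm (g y - p)" by (rule power2_less_imp_less) simp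
      have "?h \<in> \<Gamma>" using a(1) g by (intro comp_\<Gamma>) (auto simp: roots_def)
      then have "?h \<in> ?A" using lt g by auto
      then show False using min[of ?h] lt by simp
    qed
    then show ?thesis using g by blast
  qed
  define IP where "IP = (\<Union>Q\<in>Px ` C. (\<lambda>(l, l'). fst l \<bullet> fst l') ` (Q \<times> Q))"
  have finIP: "finite IP" unfolding IP_def using finPC finPx by (intro finite_UN_I) auto
  \<comment> \<open>A root may have to be negated to become positive, which costs a sign; the values
    1 and -1 cover parallel mirrors, which need not meet.\<close>
  define V where "V = IP \<union> uminus ` IP \<union> {1, - 1}"
  have V: "a \<bullet> a' \<in> V" if r: "(a, b) \<in> roots" "(a', b') \<in> roots" for a b a' b'
  proof (cases "\<bar>a \<bullet> a'\<bar> = 1")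
    case True
    then show ?thesis by (auto simp: V_def abs_if split: if_splits)
  next
    case False
    define c where "c = a \<bullet> a'"
    have n: "a \<bullet> a = 1" "a' \<bullet> a' = 1" using r roots_norm unit_inner by blast+
    have c: "1 - c * c \<noteq> 0" using False by (simp add: c_def) (metis abs_1 abs_square_eq_1 power2_eq_square)
    \<comment> \<open>The intersection point of the two mirrors in the plane spanned by their
      normals, by Cramer's rule; the denominator is the Gram determinant.\<close>
    define y where "y = ((b - c * b') / (1 - c * c)) *\<^sub>R a + ((b' - c * b) / (1 - c * c)) *\<^sub>R a'"
    have "a \<bullet> y = ((b - c * b') + (b' - c * b) * c) / (1 - c * c)"
      using n by (simp add: y_def inner_add_right c_def[symmetric] add_divide_distrib)
    also have "(b - c * b') + (b' - c * b) * c = b * (1 - c * c)" by (simp add: algebra_simps)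
    finally have ay: "a \<bullet> y = b" using c by simp
    have "a' \<bullet> y = ((b - c * b') * c + (b' - c * b)) / (1 - c * c)"
      using n by (simp add: y_def inner_add_right inner_commute[of a' a] c_def[symmetric] add_divide_distrib)
    also have "(b - c * b') * c + (b' - c * b) = b' * (1 - c * c)" by (simp add: algebra_simps)
    finally have a'y: "a' \<bullet> y = b'" using c by simp
    obtain g where g: "g \<in> \<Gamma>" "g y \<in> C" using to_C by blast
    have vanish: "\<exists>s\<in>{1, - 1}. \<exists>l\<in>Px (g y). fst l = s *\<^sub>R lin_part g u"
      if u: "(u, q) \<in> roots" "u \<bullet> y = q" for u q
    proof -
      let ?l = "(lin_part g u, q + lin_part g u \<bullet> g 0)"
      have "?l \<in> roots" using roots_image[OF g(1) u(1)] .
      moreover have "lin_part g u \<bullet> g y = q + lin_part g u \<bullet> g 0"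
        using u(2) lin_part_inner[OF g(1), of u y] \<Gamma>_apply[of g y] by (simp add: inner_add_right)
      then have "f (g y) ?l = 0" "f (g y) (- ?l) = 0" by (simp_all add: f_def)
      ultimately have "?l \<in> Px (g y) \<or> - ?l \<in> Px (g y)" using P[of ?l] by (auto simp: Px_def)
      then show ?thesis
      proof
        assume "?l \<in> Px (g y)"
        then show ?thesis by (intro bexI[of _ 1] bexI[of _ ?l]) auto
      next
        assume "- ?l \<in> Px (g y)"
        then show ?thesis by (intro bexI[of _ "- 1"] bexI[of _ "- ?l"]) auto
      qed
    qed
    obtain s l where s: "s \<in> {1, - 1}" "l \<in> Px (g y)" "fst l = s *\<^sub>R lin_part g a"
      using vanish[OF r(1) ay] by blast
    obtain s' l' where s': "s' \<in> {1, - 1}" "l' \<in> Px (g y)" "fst l' = s' *\<^sub>R lin_part g a'"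
      using vanish[OF r(2) a'y] by blast
    have "fst l \<bullet> fst l' \<in> IP" unfolding IP_def using s s' g by force
    moreover have "fst l \<bullet> fst l' = s * s' * (a \<bullet> a')" using s s' by (simp add: lin_part_inner[OF g(1)])
    ultimately have "s * s' * (a \<bullet> a') \<in> IP" by simp
    then have "a \<bullet> a' \<in> IP \<or> - (a \<bullet> a') \<in> IP" using s(1) s'(1) by auto
    then show ?thesis unfolding V_def using image_iff by fastforce
  qed
  have finV: "finite V" using finIP by (simp add: V_def)
  \<comment> \<open>The squared distance of unit vectors is 2 minus twice their inner product, so
    finitely many inner products keep distinct directions apart. The inserted 1 keeps the minimum
    defined.\<close>
  define \<delta> where "\<delta> = Min (insert 1 ((\<lambda>v. 2 - 2 * v) ` {v \<in> V. v < 1}))"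
  have \<delta>: "0 < \<delta>" "\<And>v. v \<in> V \<Longrightarrow> v < 1 \<Longrightarrow> \<delta> \<le> 2 - 2 * v"
    using finV by (auto simp: \<delta>_def)
  show ?thesis
  proof (rule finite_if_separated[of _ "sqrt \<delta>"])
    show "bounded dirs" using roots_norm by (intro boundedI[of _ 1]) (force simp: dirs_def)
    fix a a' assume a: "a \<in> dirs" "a' \<in> dirs" "a \<noteq> a'"
    then obtain b b' where r: "(a, b) \<in> roots" "(a', b') \<in> roots" by (auto simp: dirs_def)
    have n: "a \<bullet> a = 1" "a' \<bullet> a' = 1" using r roots_norm unit_inner by blast+
    have d: "(dist a a')\<^sup>2 = 2 - 2 * (a \<bullet> a')"
      using n by (simp add: dist_norm power2_norm_eq_inner inner_diff_left inner_diff_right inner_commute)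
    have "0 < (dist a a')\<^sup>2" using a(3) by simp
    then have "\<delta> \<le> (dist a a')\<^sup>2" using \<delta>(2)[OF V[OF r]] d by simp
    then show "sqrt \<delta> \<le> dist a a'" using real_sqrt_le_mono by fastforce
  qed (use \<delta> in simp)
qed

end

section \<open>Translations and the stabilizer of a special point\<close>

text \<open>The least positive element generates, by division with remainder; \<open>c = 0\<close>
  is the trivial subgroup.\<close>

lemma discrete_real_subgroup:
  fixes Z :: "real set"
  assumes zero: "0 \<in> Z" and diff: "\<And>x y. x \<in> Z \<Longrightarrow> y \<in> Z \<Longrightarrow> x - y \<in> Z"
    and fin: "\<And>r. finite {x \<in> Z. \<bar>x\<bar> \<le> r}"
  shows "\<exists>c\<ge>0. \<forall>x. x \<in> Z \<longleftrightarrow> (\<exists>z::int. x = of_int z * c)"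
proof (cases "Z \<subseteq> {0}")
  case True
  then show ?thesis using zero by (intro exI[of _ 0]) auto
next
  case False
  have neg: "- x \<in> Z" if "x \<in> Z" for x using diff[OF zero that] by simp
  have add: "x + y \<in> Z" if "x \<in> Z" "y \<in> Z" for x y using diff[OF that(1) neg[OF that(2)]] by simp
  obtain w where w: "w \<in> Z" "0 < w"
    using False neg by (metis insertCI linorder_less_linear neg_0_less_iff_less subsetI)
  define P where "P = {x \<in> Z. 0 < x \<and> x \<le> w}"
  have fP: "finite P" by (rule finite_subset[OF _ fin[of w]]) (auto simp: P_def)
  have "w \<in> P" using w by (simp add: P_def)
  define c where "c = Min P"
  have "c \<in> P" using fP \<open>w \<in> P\<close> by (auto simp: c_def intro: Min_in)
  then have c: "c \<in> Z" "0 < c" "c \<le> w" by (auto simp: P_def)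
  have min: "c \<le> x" if "x \<in> Z" "0 < x" for x
  proof (cases "x \<le> w")
    case True
    then have "x \<in> P" using that by (simp add: P_def)
    then show ?thesis using fP by (simp add: c_def)
  qed (use c in linarith)
  have nmul: "of_nat k * c \<in> Z" for k
  proof (induction k)
    case (Suc k)
    then show ?case using add[OF Suc c(1)] by (simp add: distrib_right add.commute)
  qed (simp add: zero)
  have mul: "of_int z * c \<in> Z" for z
  proof (cases "z \<ge> 0")
    case True
    then show ?thesis using nmul[of "nat z"] by simp
  next
    case False
    then show ?thesis using neg[OF nmul[of "nat (- z)"]] by simp
  qed
  have "\<exists>z::int. x = of_int z * c" if "x \<in> Z" for x
  proof -
    define r where "r = x - of_int \<lfloor>x / c\<rfloor> * c"
    have rZ: "r \<in> Z" using diff[OF that mul] by (simp add: r_def)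
    have r: "0 \<le> r" "r < c"
      using c(2) floor_divide_lower[OF c(2), of x] floor_divide_upper[OF c(2), of x]
      by (simp_all add: r_def algebra_simps)
    then have "r = 0" using min[OF rZ] by linarith
    then show ?thesis by (auto simp: r_def)
  qed
  then show ?thesis using mul c(2) by (intro exI[of _ c]) auto
qed

lemma lrfl_conj: "norm a = 1 \<Longrightarrow> lrfl a (lrfl b (lrfl a y)) = lrfl (lrfl a b) y"
proof -
  assume a: "norm a = 1"
  have i: "b \<bullet> lrfl a y = lrfl a b \<bullet> y"
    using lrfl_inner[OF a, of b "lrfl a y"] by (simp add: lrfl_involution[OF a])
  have "lrfl a (lrfl b (lrfl a y)) = lrfl a (lrfl a y - (2 * (b \<bullet> lrfl a y)) *\<^sub>R b)"
    by (simp add: lrfl_def[of b])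
  also have "\<dots> = y - (2 * (b \<bullet> lrfl a y)) *\<^sub>R lrfl a b"
    by (simp add: linear_diff[OF lrfl_linear] linear_scale[OF lrfl_linear] lrfl_involution[OF a])
  finally show ?thesis by (simp add: i lrfl_def[of "lrfl a b"])
qed

lemma rfl_center: "rfl a (a \<bullet> o1) x = o1 + lrfl a (x - o1)"
  by (simp add: rfl_def lrfl_def inner_diff_right)

section \<open>Positive and simple directions\<close>

text \<open>The vector \<open>q\<close> avoids every linear mirror, so its sign splits the
  directions into positive and negative ones.\<close>

locale based_reflection_group = discrete_reflection_group \<Gamma> for \<Gamma> :: "('e::euclidean_space \<Rightarrow> 'e) set" +
  fixes q :: 'e
  assumes generic: "a \<in> dirs \<Longrightarrow> a \<bullet> q \<noteq> 0"
begin

lemma dirs_norm: "a \<in> dirs \<Longrightarrow> norm a = 1"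
  using roots_norm by (auto simp: dirs_def)

lemma dirs_neg: "a \<in> dirs \<Longrightarrow> - a \<in> dirs"
  using roots_neg by (force simp: dirs_def)

lemma dirs_rfl: "a \<in> dirs \<Longrightarrow> a' \<in> dirs \<Longrightarrow> lrfl a a' \<in> dirs"
  using roots_rfl by (force simp: dirs_def lrfl_def)

definition pos :: "'e set" where "pos = {a \<in> dirs. 0 < a \<bullet> q}"

definition simple :: "'e set" where "simple = indec pos"

lemma pos_dirs: "a \<in> pos \<Longrightarrow> a \<in> dirs" and pos_q: "a \<in> pos \<Longrightarrow> 0 < a \<bullet> q"
  by (simp_all add: pos_def)

lemma simple_pos: "a \<in> simple \<Longrightarrow> a \<in> pos"
  by (simp add: simple_def indec_def)

lemma simple_norm: "a \<in> simple \<Longrightarrow> norm a = 1"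
  using simple_pos pos_dirs dirs_norm by blast

lemma pos_or_neg: "a \<in> dirs \<Longrightarrow> a \<in> pos \<or> - a \<in> pos"
  using generic[of a] dirs_neg[of a] by (auto simp: pos_def)

lemma finite_simple: "finite simple"
  using finite_dirs by (auto simp: simple_def indec_def pos_def)

lemma linear_q: "linear (\<lambda>a. a \<bullet> q)"
  by (intro linearI) (simp_all add: inner_add_left)

lemma pos_multiple: "x \<in> pos \<Longrightarrow> 0 < c \<Longrightarrow> c *\<^sub>R x \<in> pos \<Longrightarrow> c = 1"
proof -
  assume "x \<in> pos" "0 < c" "c *\<^sub>R x \<in> pos"
  then have "norm x = 1" "norm (c *\<^sub>R x) = 1" using pos_dirs dirs_norm by blast+
  then show "c = 1" using \<open>0 < c\<close> by simp
qed

lemma pos_ncone: "pos \<subseteq> ncone simple"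
  unfolding simple_def
proof (rule indec_generates[OF _ linear_q])
  show "finite pos" using finite_dirs by (simp add: pos_def)
qed (use pos_q pos_multiple in auto)

lemma simple_obtuse: "a \<in> simple \<Longrightarrow> b \<in> simple \<Longrightarrow> a \<noteq> b \<Longrightarrow> a \<bullet> b \<le> 0"
proof (rule indec_obtuse[where B = inner and f = "\<lambda>a. a \<bullet> q" and Q = pos])
  show "y - (2 * (x \<bullet> y)) *\<^sub>R x \<in> pos \<or> - (y - (2 * (x \<bullet> y)) *\<^sub>R x) \<in> pos"
    if "x \<in> pos" "y \<in> pos" for x y
    using pos_or_neg[OF dirs_rfl[OF pos_dirs[OF that(1)] pos_dirs[OF that(2)]]]
    by (simp add: lrfl_def)
  show "c = 1" if "x \<in> pos" "0 < c" "c *\<^sub>R x \<in> pos" for x c by (rule pos_multiple[OF that])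
qed (use linear_q pos_q in \<open>auto simp: simple_def\<close>)

text \<open>Sort a relation by the signs of its coefficients into two equal vectors. Obtuse angles
  make their inner product, a square, nonpositive, so both vanish; pairing with \<open>q\<close>
  then excludes any nonzero coefficient.\<close>

lemma simple_independent:
  assumes "(\<Sum>a\<in>simple. c a *\<^sub>R a) = 0" "a \<in> simple"
  shows "c a = 0"
proof -
  define P where "P = {a \<in> simple. 0 < c a}"
  define N where "N = {a \<in> simple. c a < 0}"
  have fin: "finite P" "finite N" using finite_simple by (auto simp: P_def N_def)
  define w where "w = (\<Sum>a\<in>P. c a *\<^sub>R a)"
  have "(\<Sum>a\<in>simple. c a *\<^sub>R a) = (\<Sum>a\<in>P \<union> N. c a *\<^sub>R a)"
    using finite_simple by (intro sum.mono_neutral_right) (auto simp: P_def N_def)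
  also have "\<dots> = w + (\<Sum>a\<in>N. c a *\<^sub>R a)"
    unfolding w_def using fin by (intro sum.union_disjoint) (auto simp: P_def N_def)
  finally have w: "w = (\<Sum>a\<in>N. (- c a) *\<^sub>R a)"
    using assms(1) by (simp add: sum_negf eq_neg_iff_add_eq_0)
  have "w \<bullet> w = (\<Sum>a\<in>P. c a *\<^sub>R a) \<bullet> (\<Sum>a\<in>N. (- c a) *\<^sub>R a)"
    unfolding w[symmetric] w_def[symmetric] ..
  also have "\<dots> = (\<Sum>a\<in>P. \<Sum>b\<in>N. c a * (- c b) * (a \<bullet> b))"
    by (subst inner_sum_left)
      (simp only: inner_sum_right inner_scaleR_left inner_scaleR_right mult_ac)
  also have "\<dots> \<le> 0"
  proof (intro sum_nonpos)
    fix a b assume "a \<in> P" "b \<in> N"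
    then have "0 < c a" "0 < - c b" "a \<bullet> b \<le> 0" by (auto simp: P_def N_def intro!: simple_obtuse)
    then show "c a * (- c b) * (a \<bullet> b) \<le> 0" by (intro mult_nonneg_nonpos mult_nonneg_nonneg) simp_all
  qed
  finally have w0: "w = 0" by (metis inner_eq_zero_iff inner_ge_zero order_antisym)
  have "P = {}"
  proof (rule ccontr)
    assume "P \<noteq> {}"
    then have "0 < (\<Sum>a\<in>P. c a * (a \<bullet> q))"
      using fin pos_q simple_pos by (intro sum_pos) (auto simp: P_def)
    moreover have "w \<bullet> q = (\<Sum>a\<in>P. c a * (a \<bullet> q))" by (simp add: w_def inner_sum_left)
    ultimately show False using w0 by simp
  qed
  moreover have "N = {}"
  proof (rule ccontr)
    assume "N \<noteq> {}"
    then have "0 < (\<Sum>a\<in>N. (- c a) * (a \<bullet> q))"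
      using fin pos_q simple_pos by (intro sum_pos) (auto simp: N_def mult_neg_pos)
    moreover have "w \<bullet> q = (\<Sum>a\<in>N. (- c a) * (a \<bullet> q))" by (simp add: w inner_sum_left del: scaleR_minus_left)
    ultimately show False using w0 by simp
  qed
  ultimately show ?thesis using assms(2) by (auto simp: P_def N_def) (meson linorder_neqE_linordered_idom)
qed

text \<open>The special point is asked to lie on mirrors of the simple directions only. Independence
  makes these equations solvable, and \<open>rfl_W\<close> extends the property to all
  directions.\<close>

definition ob :: 'e where "ob = (SOME v. \<forall>a\<in>simple. (a, a \<bullet> v) \<in> roots)"

lemma ob: "a \<in> simple \<Longrightarrow> (a, a \<bullet> ob) \<in> roots"
proof -
  have "\<forall>a\<in>simple. \<exists>b. (a, b) \<in> roots" using simple_pos pos_dirs by (force simp: dirs_def)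
  then obtain \<beta> where \<beta>: "\<And>a. a \<in> simple \<Longrightarrow> (a, \<beta> a) \<in> roots" by metis
  have "independent simple"
    using simple_independent finite_simple by (auto simp: dependent_finite)
  then obtain g :: "'e \<Rightarrow> real" where g: "linear g" "\<And>a. a \<in> simple \<Longrightarrow> g a = \<beta> a"
    using linear_independent_extend by metis
  \<comment> \<open>The vector representing the functional \<open>g\<close> through the inner
    product.\<close>
  define v where "v = (\<Sum>i\<in>Basis. g i *\<^sub>R i)"
  have "a \<bullet> v = g a" for a
  proof -
    have "g a = g (\<Sum>i\<in>Basis. (a \<bullet> i) *\<^sub>R i)" by (simp add: euclidean_representation)
    then show ?thesis
      using g(1) by (simp add: v_def inner_sum_right linear_sum linear_scale mult.commute)
  qed
  then have "\<forall>a\<in>simple. (a, a \<bullet> v) \<in> roots" using \<beta> g(2) by metis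
  then have "\<forall>a\<in>simple. (a, a \<bullet> ob) \<in> roots" unfolding ob_def by (rule someI)
  then show "a \<in> simple \<Longrightarrow> (a, a \<bullet> ob) \<in> roots" by blast
qed

text \<open>A positive direction has positive inner product with some simple \<open>b\<close>,
  because its square is a nonnegative combination of such products. Unless it is \<open>b\<close>
  itself, reflecting it in \<open>b\<close> keeps it positive and lowers its
  \<open>q\<close>-value.\<close>

lemma pos_induct [consumes 1, case_names simple rfl]:
  assumes "a \<in> pos" and simple: "\<And>a. a \<in> simple \<Longrightarrow> P a"
    and rfl: "\<And>a b. a \<in> simple \<Longrightarrow> b \<in> pos \<Longrightarrow> P b \<Longrightarrow> P (lrfl a b)"
  shows "P a"
  using assms(1)
proof (induction "card {b \<in> pos. b \<bullet> q < a \<bullet> q}" arbitrary: a rule: less_induct)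
  case less
  show ?case
  proof (cases "a \<in> simple")
    case True
    then show ?thesis by (rule simple)
  next
    case False
    obtain c where c: "a = (\<Sum>b\<in>simple. c b *\<^sub>R b)" "\<forall>b\<in>simple. 0 \<le> c b"
      using pos_ncone less.prems by (auto simp: ncone_def)
    have na: "norm a = 1" using dirs_norm[OF pos_dirs[OF less.prems]] .
    have "(\<Sum>b\<in>simple. c b * (b \<bullet> a)) = a \<bullet> a" by (subst (2) c(1)) (simp add: inner_sum_left)
    then have "0 < (\<Sum>b\<in>simple. c b * (b \<bullet> a))" using unit_inner[OF na] by simp
    then obtain b where b: "b \<in> simple" "0 < c b * (b \<bullet> a)" by (meson not_less sum_nonpos)
    then have ba: "0 < b \<bullet> a" using c(2) zero_less_mult_pos by (metis less_le mult_zero_left)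
    have nb: "norm b = 1" using simple_norm b by blast
    define a' where "a' = lrfl b a"
    have a'd: "a' \<in> dirs"
      unfolding a'_def by (rule dirs_rfl[OF pos_dirs[OF simple_pos[OF b(1)]] pos_dirs[OF less.prems]])
    have a'p: "a' \<in> pos"
    proof (rule ccontr)
      assume "a' \<notin> pos"
      then have "- a' \<in> pos" using pos_or_neg a'd by blast
      then obtain d where d: "- a' = (\<Sum>b\<in>simple. d b *\<^sub>R b)" "\<forall>b\<in>simple. 0 \<le> d b"
        using pos_ncone by (auto simp: ncone_def)
      \<comment> \<open>Coefficients of the relation
        \<open>a - a' - (2 * (b \<bullet> a)) *\<^sub>R b = 0\<close> in simple directions.
        Independence leaves no term of \<open>a\<close> other than \<open>b\<close>, so
        \<open>a\<close> would be simple.\<close>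
      define e where "e x = c x + d x - (if x = b then 2 * (b \<bullet> a) else 0)" for x
      have "(\<Sum>x\<in>simple. (if x = b then 2 * (b \<bullet> a) else 0) *\<^sub>R x) = (2 * (b \<bullet> a)) *\<^sub>R b"
        using b(1) finite_simple by (subst sum.remove[of _ b]) (auto intro: sum.neutral)
      then have "(\<Sum>x\<in>simple. e x *\<^sub>R x) = a + (- a') - (2 * (b \<bullet> a)) *\<^sub>R b"
        unfolding e_def scaleR_diff_left scaleR_add_left sum_subtractf sum.distrib
        by (simp only: c(1)[symmetric] d(1)[symmetric])
      also have "\<dots> = 0" by (simp add: a'_def lrfl_def)
      finally have e: "e x = 0" if "x \<in> simple" for x using simple_independent that by blast
      have "c x = 0" if "x \<in> simple - {b}" for x
        using e[of x] that c(2) d(2) by (auto simp: e_def add_nonneg_eq_0_iff)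
      then have "a = c b *\<^sub>R b"
        using c(1) b(1) finite_simple by (subst (asm) sum.remove[of _ b]) auto
      moreover have "c b = 1" using na nb c(2) b(1) calculation by simp
      ultimately show False using False b by simp
    qed
    have lt: "a' \<bullet> q < a \<bullet> q"
      using ba pos_q[OF simple_pos[OF b(1)]] by (simp add: a'_def lrfl_def inner_diff_left)
    have "card {x \<in> pos. x \<bullet> q < a' \<bullet> q} < card {x \<in> pos. x \<bullet> q < a \<bullet> q}"
    proof (rule psubset_card_mono)
      show "finite {x \<in> pos. x \<bullet> q < a \<bullet> q}" using finite_dirs by (simp add: pos_def)
      have "a' \<in> {x \<in> pos. x \<bullet> q < a \<bullet> q} - {x \<in> pos. x \<bullet> q < a' \<bullet> q}" using a'p lt by simp
      then show "{x \<in> pos. x \<bullet> q < a' \<bullet> q} \<subset> {x \<in> pos. x \<bullet> q < a \<bullet> q}" using lt by auto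
    qed
    then have "P a'" using less.hyps a'p by blast
    then have "P (lrfl b a')" using b(1) a'p by (intro rfl)
    then show ?thesis by (simp add: a'_def lrfl_involution[OF nb])
  qed
qed

section \<open>The finite group fixing a special point\<close>

text \<open>Inverses need no clause because the generators are involutions.\<close>

inductive_set W :: "('e \<Rightarrow> 'e) set" where
  W_id: "id \<in> W"
| W_rfl: "a \<in> simple \<Longrightarrow> rfl a (a \<bullet> ob) \<in> W"
| W_comp: "g \<in> W \<Longrightarrow> h \<in> W \<Longrightarrow> g \<circ> h \<in> W"

lemma W_\<Gamma>: "g \<in> W \<Longrightarrow> g \<in> \<Gamma>"
proof (induction rule: W.induct)
  case (W_rfl a)
  then show ?case using ob by (auto simp: roots_def)
qed (rule id_\<Gamma>, rule comp_\<Gamma>)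

lemma W_ob: "g \<in> W \<Longrightarrow> g ob = ob"
  by (induction rule: W.induct) (auto simp: rfl_def)

lemma finite_W: "finite W"
  by (rule finite_subset[OF _ locally_finite_at[of ob ob 0]]) (use W_\<Gamma> W_ob in auto)

text \<open>Every positive direction arises from simple ones by simple reflections, and conjugating
  within \<open>W\<close> keeps mirrors passing through \<open>ob\<close>.\<close>

lemma rfl_W:
  assumes "a \<in> dirs" shows "rfl a (a \<bullet> ob) \<in> W"
proof -
  have *: "rfl a (a \<bullet> ob) \<in> W" if "a \<in> pos" for a
    using that
  proof (induction rule: pos_induct)
    case (rfl a b)
    have "rfl (lrfl a b) (lrfl a b \<bullet> ob) = rfl a (a \<bullet> ob) \<circ> (rfl b (b \<bullet> ob) \<circ> rfl a (a \<bullet> ob))"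
      by (auto simp: rfl_center lrfl_conj[OF simple_norm[OF rfl(1)]] fun_eq_iff)
    moreover have "\<dots> \<in> W" by (rule W.W_comp[OF W.W_rfl[OF rfl(1)] W.W_comp[OF rfl(3) W.W_rfl[OF rfl(1)]]])
    ultimately show ?case by (simp only:)
  qed (rule W.W_rfl)
  from pos_or_neg[OF assms] show ?thesis
  proof
    assume "- a \<in> pos"
    from *[OF this] show ?thesis using rfl_neg[of a "a \<bullet> ob"] by simp
  qed (rule *)
qed

section \<open>Translations\<close>

definition T :: "'e set" where "T = {t. (\<lambda>x. t + x) \<in> \<Gamma>}"

lemma T_zero: "0 \<in> T"
proof -
  have "(\<lambda>x::'e. 0 + x) = id" by auto
  then show ?thesis by (simp only: T_def mem_Collect_eq id_\<Gamma>)
qed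

lemma T_add:
  assumes "s \<in> T" "t \<in> T" shows "s + t \<in> T"
proof -
  have "(\<lambda>x. s + x) \<circ> (\<lambda>x. t + x) = (\<lambda>x. (s + t) + x)" by (auto simp: add.assoc)
  then show ?thesis using assms comp_\<Gamma> unfolding T_def mem_Collect_eq by metis
qed

lemma T_neg:
  assumes "t \<in> T" shows "- t \<in> T"
proof -
  obtain h where h: "h \<in> \<Gamma>" "\<And>x. h (t + x) = x" using inv_\<Gamma>[of "\<lambda>x. t + x"] assms by (auto simp: T_def)
  have "h y = - t + y" for y using h(2)[of "- t + y"] by simp
  then have "h = (\<lambda>x. - t + x)" by blast
  then show ?thesis using h(1) by (simp only: T_def mem_Collect_eq)
qed

lemma T_diff: "s \<in> T \<Longrightarrow> t \<in> T \<Longrightarrow> s - t \<in> T"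
  using T_add[OF _ T_neg] by fastforce

lemma T_lin_part:
  assumes "g \<in> \<Gamma>" "t \<in> T" shows "lin_part g t \<in> T"
proof -
  obtain h where h: "h \<in> \<Gamma>" "\<And>x. h (g x) = x" "\<And>x. g (h x) = x" using inv_\<Gamma>[OF assms(1)] by blast
  have "(g \<circ> ((\<lambda>x. t + x) \<circ> h)) x = lin_part g t + x" for x
    using lin_part_diff[OF assms(1), of "t + h x" "h x"] h(3) by (simp add: eq_diff_eq)
  then have "g \<circ> ((\<lambda>x. t + x) \<circ> h) = (\<lambda>x. lin_part g t + x)" by blast
  moreover have "g \<circ> ((\<lambda>x. t + x) \<circ> h) \<in> \<Gamma>"
    using assms h by (intro comp_\<Gamma>) (auto simp: T_def)
  ultimately show ?thesis by (simp add: T_def)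
qed

lemma T_finite: "finite {t \<in> T. norm t \<le> r}"
proof (rule finite_imageD)
  show "finite ((\<lambda>t x. t + x) ` {t \<in> T. norm t \<le> r})"
    by (rule finite_subset[OF _ locally_finite[of r]]) (auto simp: T_def)
  show "inj_on (\<lambda>t x. t + x) {t \<in> T. norm t \<le> r}"
    by (intro inj_onI) (metis add_right_cancel)
qed

text \<open>Every mirror has a parallel one through \<open>ob\<close>, and the product of two
  parallel reflections is a translation along the normal.\<close>

lemma root_translation:
  assumes "(a, b) \<in> roots" shows "(2 * (b - a \<bullet> ob)) *\<^sub>R a \<in> T"
    "rfl a b = (\<lambda>x. (2 * (b - a \<bullet> ob)) *\<^sub>R a + rfl a (a \<bullet> ob) x)"
proof -
  have n: "a \<bullet> a = 1" "norm a = 1" using roots_norm[OF assms] unit_inner by blast+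
  show 1: "rfl a b = (\<lambda>x. (2 * (b - a \<bullet> ob)) *\<^sub>R a + rfl a (a \<bullet> ob) x)"
    by (simp add: rfl_def fun_eq_iff algebra_simps flip: scaleR_add_left)
  have "rfl a (a \<bullet> ob) \<in> \<Gamma>" using assms by (intro W_\<Gamma> rfl_W) (force simp: dirs_def)
  then have "rfl a b \<circ> rfl a (a \<bullet> ob) \<in> \<Gamma>" using assms by (intro comp_\<Gamma>) (auto simp: roots_def)
  moreover have "rfl a b \<circ> rfl a (a \<bullet> ob) = (\<lambda>x. (2 * (b - a \<bullet> ob)) *\<^sub>R a + x)"
    by (simp add: 1 rfl_involution[OF n(2)] fun_eq_iff)
  ultimately show "(2 * (b - a \<bullet> ob)) *\<^sub>R a \<in> T" by (simp add: T_def)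
qed

text \<open>\<open>coroot a *\<^sub>R a\<close> generates the translations in the direction \<open>a\<close>; it is zero if \<open>a\<close> belongs to a
  finite factor of \<open>\<Gamma>\<close>.\<close>

definition coroot :: "'e \<Rightarrow> real" where
  "coroot a = (SOME c. 0 \<le> c \<and> (\<forall>x. x *\<^sub>R a \<in> T \<longleftrightarrow> (\<exists>z::int. x = of_int z * c)))"

lemma coroot:
  assumes "norm a = 1"
  shows "0 \<le> coroot a" "x *\<^sub>R a \<in> T \<longleftrightarrow> (\<exists>z::int. x = of_int z * coroot a)"
proof -
  have "\<exists>c\<ge>0. \<forall>x. x \<in> {x. x *\<^sub>R a \<in> T} \<longleftrightarrow> (\<exists>z::int. x = of_int z * c)"
  proof (rule discrete_real_subgroup)
    fix r
    show "finite {x \<in> {x. x *\<^sub>R a \<in> T}. \<bar>x\<bar> \<le> r}"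
    proof (rule finite_imageD)
      show "finite ((\<lambda>x. x *\<^sub>R a) ` {x \<in> {x. x *\<^sub>R a \<in> T}. \<bar>x\<bar> \<le> r})"
        by (rule finite_subset[OF _ T_finite[of r]]) (use assms in auto)
      show "inj_on (\<lambda>x. x *\<^sub>R a) {x \<in> {x. x *\<^sub>R a \<in> T}. \<bar>x\<bar> \<le> r}"
        using assms by (intro inj_onI) auto
    qed
  qed (use T_zero T_diff in \<open>auto simp: scaleR_diff_left\<close>)
  then have "\<exists>c. 0 \<le> c \<and> (\<forall>x. x *\<^sub>R a \<in> T \<longleftrightarrow> (\<exists>z::int. x = of_int z * c))" by simp
  from someI_ex[OF this] show "0 \<le> coroot a" "x *\<^sub>R a \<in> T \<longleftrightarrow> (\<exists>z::int. x = of_int z * coroot a)"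
    unfolding coroot_def by blast+
qed

end

section \<open>The splitting of a discrete affine reflection group\<close>

text \<open>The adjugate inverts up to the determinant, which is nonzero because the kernel is
  trivial.\<close>

lemma int_matrix_adjugate:
  fixes M :: "nat \<Rightarrow> nat \<Rightarrow> int"
  assumes inj: "\<And>u. (\<And>l. l < n \<Longrightarrow> (\<Sum>i<n. u i * M i l) = 0) \<Longrightarrow> \<forall>i<n. u i = 0"
  shows "\<exists>q B. q \<noteq> 0 \<and> (\<forall>u. \<forall>g<n. (\<Sum>l<n. B g l * (\<Sum>i<n. u i * M i l)) = q * u g)"
proof -
  \<comment> \<open>The transpose of \<open>M\<close>, since the sums run over the first
    index.\<close>
  define A where "A = Matrix.mat n n (\<lambda>(l, i). M i l)"
  have A: "A \<in> carrier_mat n n" by (simp add: A_def)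
  have Av: "vec_index (A *\<^sub>v v) l = (\<Sum>i<n. vec_index v i * M i l)" if "v \<in> carrier_vec n" "l < n" for v l
    using that by (simp add: A_def scalar_prod_def atLeast0LessThan mult.commute)
  have "Determinant.det A \<noteq> 0"
  proof
    assume "Determinant.det A = 0"
    then obtain v where v: "v \<in> carrier_vec n" "v \<noteq> 0\<^sub>v n" "A *\<^sub>v v = 0\<^sub>v n"
      using det_0_iff_vec_prod_zero[OF A] by blast
    have "\<forall>i<n. vec_index v i = 0"
    proof (rule inj)
      fix l assume l: "l < n"
      show "(\<Sum>i<n. vec_index v i * M i l) = 0" using Av[OF v(1) l] v(3) l by simp
    qed
    then show False using v by (metis eq_vecI carrier_vecD index_zero_vec)
  qed
  moreover have "(\<Sum>l<n. adj_mat A $$ (g, l) * (\<Sum>i<n. u i * M i l)) = Determinant.det A * u g"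
    if g: "g < n" for u g
  proof -
    let ?v = "Matrix.vec n u"
    have adj: "adj_mat A \<in> carrier_mat n n" "adj_mat A * A = Determinant.det A \<cdot>\<^sub>m 1\<^sub>m n"
      using adj_mat[OF A] by auto
    have "adj_mat A *\<^sub>v (A *\<^sub>v ?v) = (Determinant.det A \<cdot>\<^sub>m 1\<^sub>m n) *\<^sub>v ?v"
      using adj A by (metis assoc_mult_mat_vec vec_carrier)
    then have "vec_index (adj_mat A *\<^sub>v (A *\<^sub>v ?v)) g = Determinant.det A * u g"
      using g by (simp add: scalar_prod_def) (subst sum.remove[of _ g], auto intro: sum.neutral)
    moreover have "vec_index (adj_mat A *\<^sub>v (A *\<^sub>v ?v)) g =
      (\<Sum>l<n. adj_mat A $$ (g, l) * (\<Sum>i<n. u i * M i l))"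
      using g adj(1) A Av[of ?v] by (simp add: scalar_prod_def atLeast0LessThan row_def)
    ultimately show ?thesis by simp
  qed
  ultimately show ?thesis by (intro exI[of _ "Determinant.det A"] exI[of _ "\<lambda>g l. adj_mat A $$ (g, l)"]) auto
qed

context based_reflection_group
begin

section \<open>The coroot lattice in coordinates\<close>

text \<open>Directions with \<open>coroot a = 0\<close> would give zero basis vectors; without them
  \<open>tau\<close> is injective on \<open>zvec rk\<close>.\<close>

definition inf_simple :: "'e set" where "inf_simple = {a \<in> simple. 0 < coroot a}"

definition rk :: nat where "rk = card inf_simple"

definition en :: "nat \<Rightarrow> 'e" where "en = (SOME e. bij_betw e {0..<rk} inf_simple)"

definition tb :: "nat \<Rightarrow> 'e" where "tb i = coroot (en i) *\<^sub>R en i"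

definition tau :: "(nat \<Rightarrow> int) \<Rightarrow> 'e" where "tau u = (\<Sum>i<rk. of_int (u i) *\<^sub>R tb i)"

lemma en_bij: "bij_betw en {..<rk} inf_simple"
proof -
  have "finite inf_simple" using finite_simple by (simp add: inf_simple_def)
  from ex_bij_betw_nat_finite[OF this] have "bij_betw en {0..<rk} inf_simple"
    unfolding en_def rk_def by (rule someI_ex)
  then show ?thesis by (simp add: atLeast0LessThan)
qed

lemma en: "i < rk \<Longrightarrow> en i \<in> simple" "i < rk \<Longrightarrow> 0 < coroot (en i)" "i < rk \<Longrightarrow> norm (en i) = 1"
  using en_bij simple_norm by (auto simp: bij_betw_def inf_simple_def)

lemma tau_zero: "tau (\<lambda>_. 0) = 0" by (simp add: tau_def)

lemma tau_add: "tau (\<lambda>i. u i + v i) = tau u + tau v"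
  by (simp add: tau_def scaleR_add_left sum.distrib)

lemma tau_neg: "tau (\<lambda>i. - u i) = - tau u"
  by (simp add: tau_def sum_negf)

lemma tau_single: "l < rk \<Longrightarrow> tau (\<lambda>j. if j = l then z else 0) = of_int z *\<^sub>R tb l"
  unfolding tau_def by (subst sum.remove[of _ l]) (auto intro: sum.neutral)

lemma tau_T: "tau u \<in> T"
proof -
  have "of_int (u i) *\<^sub>R tb i \<in> T" if "i < rk" for i
    using coroot(2)[OF en(3)[OF that], of "of_int (u i) * coroot (en i)"] by (auto simp: tb_def)
  then have "(\<Sum>i<m. of_int (u i) *\<^sub>R tb i) \<in> T" if "m \<le> rk" for m
    using that by (induction m) (auto simp: T_zero intro: T_add)
  then show ?thesis by (simp add: tau_def)
qed

lemma tau_trivial_kernel: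
  assumes "tau u = 0" "i < rk" shows "u i = 0"
proof -
  define ix where "ix = the_inv_into {..<rk} en"
  have ix: "ix (en j) = j" if "j < rk" for j
    using en_bij that by (auto simp: ix_def bij_betw_def intro: the_inv_into_f_f)
  define c where "c a = (if a \<in> inf_simple then of_int (u (ix a)) * coroot a else 0)" for a
  have "(\<Sum>a\<in>simple. c a *\<^sub>R a) = (\<Sum>a\<in>inf_simple. c a *\<^sub>R a)"
    using finite_simple by (intro sum.mono_neutral_right) (auto simp: c_def inf_simple_def)
  also have "\<dots> = (\<Sum>j<rk. c (en j) *\<^sub>R en j)"
    using sum.reindex_bij_betw[OF en_bij, of "\<lambda>a. c a *\<^sub>R a"] by simp
  also have "\<dots> = tau u"
    unfolding tau_def
  proof (intro sum.cong HOL.refl)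
    fix j assume "j \<in> {..<rk}"
    then have "en j \<in> inf_simple" using en_bij by (auto simp: bij_betw_def)
    then show "c (en j) *\<^sub>R en j = of_int (u j) *\<^sub>R tb j"
      using ix \<open>j \<in> {..<rk}\<close> by (simp add: c_def tb_def)
  qed
  finally have "c (en i) = 0" using simple_independent[of c "en i"] assms en(1) by simp
  moreover have "en i \<in> inf_simple" using en_bij assms by (auto simp: bij_betw_def)
  ultimately show ?thesis using ix[OF assms(2)] en(2)[OF assms(2)] by (simp add: c_def)
qed

lemma tau_inject:
  assumes "u \<in> zvec rk" "v \<in> zvec rk" "tau u = tau v" shows "u = v"
proof
  fix i
  have "tau (\<lambda>i. u i + - v i) = 0" using assms(3) by (simp only: tau_add tau_neg) simp
  then have "u i + - v i = 0" if "i < rk" using tau_trivial_kernel that by blast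
  then show "u i = v i" using assms by (cases "i < rk") (auto simp: zvec_def)
qed

lemma simple_T:
  assumes a: "a \<in> simple" and c: "c *\<^sub>R a \<in> T" shows "c *\<^sub>R a \<in> tau ` zvec rk"
proof -
  obtain z :: int where z: "c = of_int z * coroot a" using coroot(2)[OF simple_norm[OF a]] c by blast
  show ?thesis
  proof (cases "coroot a = 0")
    case True
    then show ?thesis using z tau_zero by (auto intro!: image_eqI[of _ _ "\<lambda>_. 0"])
  next
    case False
    then have "a \<in> inf_simple" using a coroot(1)[OF simple_norm[OF a]] by (simp add: inf_simple_def)
    then obtain l where l: "l < rk" "a = en l" using en_bij by (auto simp: bij_betw_def)
    have "c *\<^sub>R a = tau (\<lambda>j. if j = l then z else 0)" using l z by (simp add: tau_single tb_def)
    then show ?thesis using l by (auto simp: zvec_def)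
  qed
qed

section \<open>Cartan integers and the action of reflections\<close>

text \<open>The multiple of \<open>tb l\<close> that the reflection in \<open>en l\<close> subtracts
  from \<open>tb i\<close>.\<close>

definition cartan :: "nat \<Rightarrow> nat \<Rightarrow> int" where
  "cartan i l = (SOME z. 2 * (en l \<bullet> tb i) = of_int z * coroot (en l))"

text \<open>A translation and its mirror image differ by a translation along the normal; this is
  where the integrality of the Cartan numbers comes from.\<close>

lemma reflection_T:
  assumes "a \<in> simple" "t \<in> T" shows "(2 * (a \<bullet> t)) *\<^sub>R a \<in> T"
proof -
  have "rfl a (a \<bullet> ob) \<in> \<Gamma>" using ob[OF assms(1)] by (simp add: roots_def)
  from T_lin_part[OF this assms(2)] have "t - lrfl a t \<in> T" using assms(2) by (simp add: lin_part_rfl T_diff)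
  then show ?thesis by (simp add: lrfl_def)
qed

lemma tb_T: "i < rk \<Longrightarrow> tb i \<in> T"
  using tau_T[of "\<lambda>j. if j = i then 1 else 0"] by (simp add: tau_single)

lemma cartan:
  assumes "i < rk" "l < rk" shows "2 * (en l \<bullet> tb i) = of_int (cartan i l) * coroot (en l)"
proof -
  have "\<exists>z::int. 2 * (en l \<bullet> tb i) = of_int z * coroot (en l)"
    using reflection_T[OF en(1)[OF assms(2)] tb_T[OF assms(1)]] coroot(2)[OF en(3)[OF assms(2)]] by blast
  then show ?thesis unfolding cartan_def by (rule someI_ex)
qed

lemma cartan_nonzero_sym:
  assumes "i < rk" "l < rk" shows "cartan i l \<noteq> 0 \<longleftrightarrow> cartan l i \<noteq> 0"
proof -
  have "cartan i l \<noteq> 0 \<longleftrightarrow> en l \<bullet> en i \<noteq> 0" if "i < rk" "l < rk" for i l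
    using cartan[OF that] en(2)[OF that(1)] en(2)[OF that(2)] by (auto simp: tb_def)
  then show ?thesis using assms by (simp add: inner_commute)
qed

lemma inner_tau:
  assumes "l < rk"
  shows "(2 * (en l \<bullet> tau u)) *\<^sub>R en l = of_int (\<Sum>i<rk. u i * cartan i l) *\<^sub>R tb l"
proof -
  have "2 * (en l \<bullet> tau u) = (\<Sum>i<rk. of_int (u i) * (2 * (en l \<bullet> tb i)))"
    by (simp add: tau_def inner_sum_right sum_distrib_left mult_ac)
  also have "\<dots> = (\<Sum>i<rk. of_int (u i * cartan i l) * coroot (en l))"
    using cartan[OF _ assms] by (intro sum.cong) simp_all
  also have "\<dots> = of_int (\<Sum>i<rk. u i * cartan i l) * coroot (en l)"
    by (simp add: sum_distrib_right)
  finally show ?thesis by (simp add: tb_def)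
qed

lemma lrfl_tau:
  assumes "l < rk"
  shows "lrfl (en l) (tau u) = tau (\<lambda>j. u j + - (if j = l then \<Sum>i<rk. u i * cartan i l else 0))"
  unfolding tau_add tau_neg tau_single[OF assms] by (simp add: lrfl_def inner_tau[OF assms])

text \<open>The reflection changes \<open>tau u\<close> by a translation along \<open>a\<close>, and
  there is none but zero.\<close>

lemma lrfl_tau_finite:
  assumes "a \<in> simple" "a \<notin> inf_simple" shows "lrfl a (tau u) = tau u"
proof -
  have "coroot a = 0" using assms coroot(1)[OF simple_norm[OF assms(1)]] by (simp add: inf_simple_def)
  then have "2 * (a \<bullet> tau u) = 0"
    using reflection_T[OF assms(1) tau_T] coroot(2)[OF simple_norm[OF assms(1)]] by auto
  then show ?thesis by (simp add: lrfl_def)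
qed

lemma W_tau:
  assumes "g \<in> W" "u \<in> zvec rk" shows "\<exists>v\<in>zvec rk. lin_part g (tau u) = tau v"
  using assms
proof (induction arbitrary: u rule: W.induct)
  case W_id
  then show ?case by (auto simp: lin_part_def)
next
  case (W_rfl a)
  have "lrfl a (tau u) \<in> tau ` zvec rk"
  proof (cases "a \<in> inf_simple")
    case True
    then obtain l where l: "l < rk" "a = en l" using en_bij by (auto simp: bij_betw_def)
    then show ?thesis using W_rfl(2)
      by (auto simp: lrfl_tau zvec_def intro!: imageI)
  next
    case False
    then show ?thesis using W_rfl by (auto simp: lrfl_tau_finite)
  qed
  then show ?case by (auto simp: lin_part_rfl)
next
  case (W_comp g h)
  obtain v where v: "v \<in> zvec rk" "lin_part h (tau u) = tau v" using W_comp by blast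
  obtain w where w: "w \<in> zvec rk" "lin_part g (tau v) = tau w" using W_comp v by blast
  have "lin_part (g \<circ> h) (tau u) = tau w"
    by (simp only: lin_part_comp[OF W_\<Gamma>[OF W_comp(1)]] v(2) w(2))
  then show ?case using w(1) by (rule bexI)
qed

text \<open>Elements of \<open>W\<close> carry the direction to a simple one; they preserve both
  \<open>T\<close> and the lattice \<open>tau\<close>.\<close>

lemma dirs_T:
  assumes "a \<in> dirs" "c *\<^sub>R a \<in> T" shows "c *\<^sub>R a \<in> tau ` zvec rk"
proof -
  have *: "c *\<^sub>R a \<in> tau ` zvec rk" if "a \<in> pos" "c *\<^sub>R a \<in> T" for a c
    using that
  proof (induction arbitrary: c rule: pos_induct)
    case (simple a)
    then show ?case by (rule simple_T)
  next
    case (rfl a b)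
    have g: "rfl a (a \<bullet> ob) \<in> W" using rfl(1) by (rule W.W_rfl)
    have e: "lrfl a (c *\<^sub>R lrfl a b) = c *\<^sub>R b"
      using simple_norm[OF rfl(1)] by (simp add: linear_scale[OF lrfl_linear] lrfl_involution)
    have "c *\<^sub>R b \<in> T" using T_lin_part[OF W_\<Gamma>[OF g] rfl.prems] by (simp add: lin_part_rfl e)
    then obtain u where u: "u \<in> zvec rk" "c *\<^sub>R b = tau u" using rfl.IH by blast
    have "c *\<^sub>R lrfl a b = lin_part (rfl a (a \<bullet> ob)) (tau u)"
      by (simp add: lin_part_rfl u(2)[symmetric] linear_scale[OF lrfl_linear])
    then show ?case using W_tau[OF g u(1)] by auto
  qed
  from pos_or_neg[OF assms(1)] show ?thesis
  proof
    assume "- a \<in> pos"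
    then show ?thesis using *[of "- a" "- c"] assms(2) by simp
  qed (use * assms in blast)
qed

text \<open>A reflection is a translation along its normal times the parallel reflection in
  \<open>W\<close>; products are sorted because \<open>W\<close> preserves the lattice.\<close>

lemma \<Gamma>_split: "g \<in> \<Gamma> \<Longrightarrow> \<exists>u\<in>zvec rk. \<exists>w\<in>W. g = (\<lambda>x. tau u + w x)"
proof (induction rule: \<Gamma>_induct)
  case id
  show ?case by (intro bexI[of _ "\<lambda>_. 0"] bexI[OF _ W.W_id]) (auto simp: tau_zero)
next
  case (rfl a b)
  then have r: "(a, b) \<in> roots" by (simp add: roots_def)
  then have a: "a \<in> dirs" by (force simp: dirs_def)
  obtain u where "u \<in> zvec rk" "(2 * (b - a \<bullet> ob)) *\<^sub>R a = tau u"
    using dirs_T[OF a root_translation(1)[OF r]] by blast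
  then show ?case using root_translation(2)[OF r] rfl_W[OF a] by metis
next
  case (comp g h)
  obtain u w where u: "u \<in> zvec rk" "w \<in> W" "g = (\<lambda>x. tau u + w x)" using comp.IH(1) by blast
  obtain v w' where v: "v \<in> zvec rk" "w' \<in> W" "h = (\<lambda>x. tau v + w' x)" using comp.IH(2) by blast
  obtain v' where v': "v' \<in> zvec rk" "lin_part w (tau v) = tau v'" using W_tau[OF u(2) v(1)] by blast
  have "(g \<circ> h) x = tau (\<lambda>i. u i + v' i) + (w \<circ> w') x" for x
    using lin_part_diff[OF W_\<Gamma>[OF u(2)], of "tau v + w' x" "w' x"]
    by (simp add: u(3) v(3) tau_add v'(2)[symmetric])
  then have "g \<circ> h = (\<lambda>x. tau (\<lambda>i. u i + v' i) + (w \<circ> w') x)" by blast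
  then show ?case using zvec_add[OF u(1) v'(1)] W.W_comp[OF u(2) v(2)] by blast
qed

section \<open>Numbering the finite group\<close>

definition ws :: "nat \<Rightarrow> 'e \<Rightarrow> 'e" where "ws = (SOME f. bij_betw f {0..<card W} W)"

definition wmu :: "nat \<Rightarrow> nat \<Rightarrow> nat" where "wmu i j = (THE l. l < card W \<and> ws l = ws i \<circ> ws j)"

definition wact :: "nat \<Rightarrow> (nat \<Rightarrow> int) \<Rightarrow> nat \<Rightarrow> int" where
  "wact j u = (THE v. v \<in> zvec rk \<and> lin_part (ws j) (tau u) = tau v)"

lemma ws_bij: "bij_betw ws {..<card W} W"
proof -
  from ex_bij_betw_nat_finite[OF finite_W] have "bij_betw ws {0..<card W} W"
    unfolding ws_def by (rule someI_ex)
  then show ?thesis by (simp add: atLeast0LessThan)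
qed

lemma ws_W: "j < card W \<Longrightarrow> ws j \<in> W"
  using ws_bij by (auto simp: bij_betw_def)

lemma ws_inject: "i < card W \<Longrightarrow> j < card W \<Longrightarrow> ws i = ws j \<Longrightarrow> i = j"
  using ws_bij by (auto simp: bij_betw_def inj_on_def)

lemma ws_surj: "w \<in> W \<Longrightarrow> \<exists>j<card W. ws j = w"
proof -
  assume "w \<in> W"
  then have "w \<in> ws ` {..<card W}" using ws_bij by (simp add: bij_betw_def)
  then show ?thesis by auto
qed

lemma wmu:
  assumes "i < card W" "j < card W" shows "wmu i j < card W" "ws (wmu i j) = ws i \<circ> ws j"
proof -
  obtain l where l: "l < card W" "ws l = ws i \<circ> ws j"
    using ws_surj[OF W.W_comp[OF ws_W[OF assms(1)] ws_W[OF assms(2)]]] by blast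
  have "wmu i j = l" unfolding wmu_def using l ws_inject by (intro the_equality) auto
  then show "wmu i j < card W" "ws (wmu i j) = ws i \<circ> ws j" using l by auto
qed

lemma wact_eq: "v \<in> zvec rk \<Longrightarrow> lin_part (ws j) (tau u) = tau v \<Longrightarrow> wact j u = v"
  unfolding wact_def by (intro the_equality) (auto intro: tau_inject)

lemma wact:
  assumes "j < card W" "u \<in> zvec rk"
  shows "wact j u \<in> zvec rk" "lin_part (ws j) (tau u) = tau (wact j u)"
  using W_tau[OF ws_W[OF assms(1)] assms(2)] wact_eq by auto

lemma lattice_split_\<Gamma>:
  "lattice_split (Iso\<lparr>carrier := \<Gamma>\<rparr>) rk (card W) (\<lambda>u x. tau u + x) ws wact wmu"
proof -
  let ?G = "Iso\<lparr>carrier := \<Gamma>\<rparr>"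
  interpret G: group ?G
    by (rule subgroup.subgroup_is_group[OF subgroup_\<Gamma> group_isometry_group])
  have mult: "g \<otimes>\<^bsub>?G\<^esub> h = (\<lambda>x. g (h x))" for g h by (auto simp: isometry_group_def fun_eq_iff)
  have one: "\<one>\<^bsub>?G\<^esub> = (\<lambda>x. x)" by (auto simp: isometry_group_def fun_eq_iff)
  show ?thesis
  proof unfold_locales
    show "(\<lambda>x. tau u + x) \<in> carrier ?G" for u using tau_T[of u] by (simp add: T_def)
    show "ws j \<in> carrier ?G" if "j < card W" for j using W_\<Gamma>[OF ws_W[OF that]] by simp
    show "(\<lambda>x. tau (\<lambda>i. u i + v i) + x) = (\<lambda>x. tau u + x) \<otimes>\<^bsub>?G\<^esub> (\<lambda>x. tau v + x)" for u v
      by (simp only: mult tau_add add.assoc)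
    show "wmu i j < card W" if "i < card W" "j < card W" for i j using wmu that by blast
    show "ws i \<otimes>\<^bsub>?G\<^esub> ws j = ws (wmu i j)" if "i < card W" "j < card W" for i j
      unfolding mult wmu(2)[OF that] by auto
    show "\<exists>j<card W. ws j = \<one>\<^bsub>?G\<^esub>" using ws_surj[OF W.W_id] unfolding one by (auto simp: id_def)
    show "wact j u \<in> zvec rk" if "j < card W" "u \<in> zvec rk" for j u using wact that by blast
    show "ws j \<otimes>\<^bsub>?G\<^esub> (\<lambda>x. tau u + x) = (\<lambda>x. tau (wact j u) + x) \<otimes>\<^bsub>?G\<^esub> ws j"
      if "j < card W" "u \<in> zvec rk" for j u
    proof -
      have e: "ws j (tau u + x) = tau (wact j u) + ws j x" for x
        using lin_part_diff[OF W_\<Gamma>[OF ws_W[OF that(1)]], of "tau u + x" x] wact(2)[OF that]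
        by (simp add: eq_diff_eq)
      show ?thesis by (simp only: mult e)
    qed
    show "u = v \<and> i = j" if a: "u \<in> zvec rk" "v \<in> zvec rk" "i < card W" "j < card W"
      "(\<lambda>x. tau u + x) \<otimes>\<^bsub>?G\<^esub> ws i = (\<lambda>x. tau v + x) \<otimes>\<^bsub>?G\<^esub> ws j" for u v i j
    proof -
      have e: "tau u + ws i x = tau v + ws j x" for x by (rule fun_cong[OF a(5)[unfolded mult]])
      \<comment> \<open>Evaluation at the common fixed point of \<open>W\<close> isolates the
        translations.\<close>
      have "tau u = tau v" using e[of ob] W_ob[OF ws_W[OF a(3)]] W_ob[OF ws_W[OF a(4)]] by simp
      then have "u = v" using tau_inject a by blast
      moreover have "ws i = ws j" using e \<open>tau u = tau v\<close> by auto
      ultimately show ?thesis using ws_inject a by blast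
    qed
    show "\<exists>u\<in>zvec rk. \<exists>j<card W. g = (\<lambda>x. tau u + x) \<otimes>\<^bsub>?G\<^esub> ws j" if g: "g \<in> carrier ?G" for g
    proof -
      obtain u w where u: "u \<in> zvec rk" "w \<in> W" "g = (\<lambda>x. tau u + w x)"
        using \<Gamma>_split[of g] g by auto
      obtain j where j: "j < card W" "ws j = w" using ws_surj[OF u(2)] by blast
      have "g = (\<lambda>x. tau u + x) \<otimes>\<^bsub>?G\<^esub> ws j" by (simp only: mult u(3) j(2))
      then show ?thesis using u(1) j(1) by blast
    qed
  qed
qed

text \<open>A vector killed by all Cartan sums is orthogonal to every basis vector, hence to
  itself.\<close>

lemma cartan_injective:
  assumes "\<And>l. l < rk \<Longrightarrow> (\<Sum>i<rk. u i * cartan i l) = 0"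
  shows "\<forall>i<rk. u i = 0"
proof -
  have "en l \<bullet> tau u = 0" if "l < rk" for l
    using inner_tau[OF that, of u] assms[OF that] en(3)[OF that] by auto
  then have "tau u \<bullet> tau u = 0"
    by (subst (1) tau_def) (simp add: inner_sum_left tb_def)
  then show ?thesis using tau_trivial_kernel by simp
qed

end

section \<open>Invariant sublattices of the coroot lattice\<close>

lemma int_subgroup_principal:
  fixes I :: "int set"
  assumes "0 \<in> I" "\<And>x y. x \<in> I \<Longrightarrow> y \<in> I \<Longrightarrow> x - y \<in> I"
  shows "\<exists>g\<ge>0. \<forall>z. z \<in> I \<longleftrightarrow> g dvd z"
proof -
  have "\<exists>c\<ge>0. \<forall>x. x \<in> real_of_int ` I \<longleftrightarrow> (\<exists>z::int. x = of_int z * c)"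
  proof (rule discrete_real_subgroup)
    show "finite {x \<in> real_of_int ` I. \<bar>x\<bar> \<le> r}" for r
    proof (rule finite_subset)
      show "{x \<in> real_of_int ` I. \<bar>x\<bar> \<le> r} \<subseteq> real_of_int ` {- \<lceil>r\<rceil>..\<lceil>r\<rceil>}"
        by (auto intro!: imageI) linarith+
    qed simp
    show "x - y \<in> real_of_int ` I" if xy: "x \<in> real_of_int ` I" "y \<in> real_of_int ` I" for x y
    proof -
      obtain a b where "a \<in> I" "b \<in> I" "x = of_int a" "y = of_int b" using xy by auto
      then show ?thesis using assms(2)[of a b] by (intro image_eqI[of _ _ "a - b"]) auto
    qed
  qed (use assms in force)
  then obtain c where c: "0 \<le> c" "\<And>x. x \<in> real_of_int ` I \<longleftrightarrow> (\<exists>z::int. x = of_int z * c)" by blast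
  have "c \<in> real_of_int ` I" using c(2)[of c] by (metis mult_1 of_int_1)
  then obtain g where g: "c = of_int g" by blast
  have "z \<in> I \<longleftrightarrow> g dvd z" for z
  proof -
    have "z \<in> I \<longleftrightarrow> real_of_int z \<in> real_of_int ` I" by auto
    also have "\<dots> \<longleftrightarrow> (\<exists>w::int. real_of_int z = real_of_int (w * g))" by (simp add: c(2) g)
    also have "\<dots> \<longleftrightarrow> g dvd z" by (simp only: of_int_eq_iff) (auto simp: dvd_def mult.commute)
    finally show ?thesis .
  qed
  then show ?thesis using c(1) g by auto
qed

context based_reflection_group
begin

text \<open>An invariant sublattice contains \<open>g i\<close> times the \<open>i\<close>-th coroot, where \<open>g\<close> is constant on
  the components of the diagram because \<open>r\<close>, and hence \<open>g\<close>, is prime to the nonzero Cartan integers; it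
  contains nothing else because \<open>g\<close> is also prime to the determinant of the Cartan matrix.\<close>

lemma diagonal_sublattices_\<Gamma>: "\<exists>k\<ge>2. diagonal_sublattices rk (card W) wact k"
proof -
  obtain qq B where qq: "qq \<noteq> 0"
    and B: "\<And>u j. j < rk \<Longrightarrow> (\<Sum>l<rk. B j l * (\<Sum>i<rk. u i * cartan i l)) = qq * u j"
    using int_matrix_adjugate[of rk cartan, OF cartan_injective] by blast
  \<comment> \<open>Zero Cartan integers are replaced by 1 to keep the product nonzero.\<close>
  define C where "C i l = (if cartan i l = 0 then 1 else \<bar>cartan i l\<bar>)" for i l
  have C: "1 \<le> C i l" for i l by (auto simp: C_def)
  define pr where "pr = (\<Prod>i<rk. \<Prod>l<rk. C i l)"
  have pr: "1 \<le> pr" unfolding pr_def using C by (intro prod_ge_1) auto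
  \<comment> \<open>Divisible by \<open>qq\<close> and by every nonzero Cartan integer; the factor 2
    ensures \<open>2 \<le> k\<close>.\<close>
  define k where "k = nat (2 * \<bar>qq\<bar> * pr)"
  have "2 * 1 * 1 \<le> 2 * \<bar>qq\<bar> * pr" using qq pr by (intro mult_mono) auto
  then have ge: "2 \<le> 2 * \<bar>qq\<bar> * pr" by simp
  then have k: "int k = 2 * \<bar>qq\<bar> * pr" unfolding k_def by (intro nat_0_le) linarith
  have "2 \<le> int k" using ge k by simp
  then have k2: "2 \<le> k" by simp
  have qk: "qq dvd int k" by (simp add: k)
  have ck: "cartan i l dvd int k" if "i < rk" "l < rk" "cartan i l \<noteq> 0" for i l
  proof -
    have "C i l dvd (\<Prod>l<rk. C i l)" using that by (intro dvd_prodI) auto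
    also have "\<dots> dvd pr" unfolding pr_def using that by (intro dvd_prodI) auto
    finally show ?thesis using that by (simp add: C_def k)
  qed
  have "diagonal_sublattices rk (card W) wact k"
    unfolding diagonal_sublattices_def
  proof (intro allI impI, elim conjE)
    fix U r
    assume Uz: "U \<subseteq> zvec rk" and "\<forall>u\<in>U. \<forall>v\<in>U. (\<lambda>i. u i + v i) \<in> U"
      and "\<forall>u\<in>U. (\<lambda>i. - u i) \<in> U" and "\<forall>j<card W. \<forall>u\<in>U. wact j u \<in> U"
      and cop: "coprime r (int k)" and "\<forall>u\<in>zvec rk. (\<lambda>i. r * u i) \<in> U"
    then have add: "\<And>u v. u \<in> U \<Longrightarrow> v \<in> U \<Longrightarrow> (\<lambda>i. u i + v i) \<in> U"
      and neg: "\<And>u. u \<in> U \<Longrightarrow> (\<lambda>i. - u i) \<in> U"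
      and act: "\<And>j u. j < card W \<Longrightarrow> u \<in> U \<Longrightarrow> wact j u \<in> U"
      and rU: "\<And>u. u \<in> zvec rk \<Longrightarrow> (\<lambda>i. r * u i) \<in> U" by blast+
    have zero: "(\<lambda>_. 0) \<in> U" using rU[OF zvec_zero] by simp
    have r0: "r \<noteq> 0" using cop k2 by auto
    define sv :: "nat \<Rightarrow> int \<Rightarrow> nat \<Rightarrow> int" where "sv l z = (\<lambda>j. if j = l then z else 0)" for l z
    have svz: "sv l z \<in> zvec rk" if "l < rk" for l z using that by (auto simp: sv_def zvec_def)
    have svr: "sv l r \<in> U" if "l < rk" for l
    proof -
      have "(\<lambda>i. r * sv l 1 i) = sv l r" by (auto simp: sv_def)
      then show ?thesis using rU[OF svz[OF that, of 1]] by simp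
    qed
    \<comment> \<open>\<open>g l\<close> generates the ideal of those \<open>z\<close> for which
      \<open>z\<close> times the \<open>l\<close>-th unit vector lies in \<open>U\<close>. Taking it
      nonnegative lets mutual divisibility give equality later.\<close>
    have "\<exists>g\<ge>0. \<forall>z. z \<in> {z. sv l z \<in> U} \<longleftrightarrow> g dvd z" for l
    proof (rule int_subgroup_principal)
      have "sv l 0 = (\<lambda>_. 0)" by (auto simp: sv_def)
      then show "0 \<in> {z. sv l z \<in> U}" using zero by simp
      show "x - y \<in> {z. sv l z \<in> U}" if "x \<in> {z. sv l z \<in> U}" "y \<in> {z. sv l z \<in> U}" for x y
      proof -
        have "(\<lambda>i. sv l x i + - sv l y i) = sv l (x - y)" by (auto simp: sv_def)
        then show ?thesis using add[OF _ neg, of "sv l x" "sv l y"] that by simp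
      qed
    qed
    then have "\<forall>l. \<exists>g. 0 \<le> g \<and> (\<forall>z. sv l z \<in> U \<longleftrightarrow> g dvd z)" by simp
    then obtain g where g0: "\<And>l. 0 \<le> g l" and g: "\<And>l z. sv l z \<in> U \<longleftrightarrow> g l dvd z" by metis
    have gr: "g l dvd r" if "l < rk" for l using svr[OF that] g by simp
    have gk: "coprime (g l) c" if "l < rk" "c dvd int k" for l c
      using coprime_divisors[OF gr[OF that(1)] that(2) cop] .
    \<comment> \<open>An element of \<open>U\<close> minus its image under the \<open>l\<close>-th
      reflection is a multiple of the \<open>l\<close>-th unit vector, and it lies in
      \<open>U\<close>.\<close>
    have step: "g l dvd (\<Sum>i<rk. u i * cartan i l)" if l: "l < rk" and u: "u \<in> U" for l u
    proof -
      let ?s = "\<Sum>i<rk. u i * cartan i l"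
      obtain j where j: "j < card W" "ws j = rfl (en l) (en l \<bullet> ob)"
        using ws_surj[OF W.W_rfl[OF en(1)[OF l]]] by blast
      have uz: "u \<in> zvec rk" using u Uz by blast
      have "wact j u = (\<lambda>i. u i + - sv l ?s i)"
      proof (rule wact_eq)
        show "(\<lambda>i. u i + - sv l ?s i) \<in> zvec rk" using zvec_add[OF uz zvec_neg[OF svz[OF l]]] .
        show "lin_part (ws j) (tau u) = tau (\<lambda>i. u i + - sv l ?s i)"
          unfolding j(2) lin_part_rfl lrfl_tau[OF l] sv_def ..
      qed
      then have "(\<lambda>i. u i + - wact j u i) = sv l ?s" by auto
      then have "sv l ?s \<in> U" using add[OF u neg[OF act[OF j(1) u]]] by simp
      then show ?thesis using g by simp
    qed
    \<comment> \<open>Apply \<open>step\<close> to \<open>g i\<close> times the \<open>i\<close>-th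
      unit vector; the Cartan integer divides \<open>k\<close> and can be cancelled.\<close>
    have linked: "g i = g l" if "i < rk" "l < rk" "cartan i l \<noteq> 0" for i l
    proof -
      have *: "g l dvd g i" if il: "i < rk" "l < rk" "cartan i l \<noteq> 0" for i l
      proof -
        have "sv i (g i) \<in> U" using g by simp
        then have "g l dvd (\<Sum>i'<rk. sv i (g i) i' * cartan i' l)" using step il by blast
        also have "(\<Sum>i'<rk. sv i (g i) i' * cartan i' l) = g i * cartan i l"
          using il by (subst sum.remove[of _ i]) (auto simp: sv_def intro: sum.neutral)
        finally show ?thesis
          using gk[OF il(2) ck[OF il]] by (simp add: coprime_dvd_mult_left_iff)
      qed
      show ?thesis
        using *[OF that] *[OF that(2,1)] that cartan_nonzero_sym[OF that(1,2)] g0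
        by (intro zdvd_antisym_nonneg) auto
    qed
    have "U = {u \<in> zvec rk. \<forall>i<rk. g i dvd u i}"
    proof (intro equalityI subsetI)
      fix u assume u: "u \<in> U"
      have "g c dvd u c" if c: "c < rk" for c
      proof -
        \<comment> \<open>Keeping the coordinates with the same \<open>g\<close> selects whole
          components of the diagram, so the Cartan sums of \<open>u'\<close> are either those of
          \<open>u\<close> or zero. All are divisible by \<open>g c\<close>, and the adjugate passes
          this on to \<open>qq * u c\<close>.\<close>
        define u' where "u' i = (if g i = g c then u i else 0)" for i
        have "g c dvd (\<Sum>i<rk. u' i * cartan i l)" if l: "l < rk" for l
        proof (cases "g l = g c")
          case True
          have "(\<Sum>i<rk. u' i * cartan i l) = (\<Sum>i<rk. u i * cartan i l)"
            using linked[OF _ l] True by (intro sum.cong) (auto simp: u'_def)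
          then show ?thesis using step[OF l u] True by simp
        next
          case False
          have "(\<Sum>i<rk. u' i * cartan i l) = 0"
            using linked[OF _ l] False by (intro sum.neutral) (auto simp: u'_def)
          then show ?thesis by simp
        qed
        then have "g c dvd (\<Sum>l<rk. B c l * (\<Sum>i<rk. u' i * cartan i l))"
          by (rule dvd_sum[OF dvd_mult]) simp
        then have "g c dvd qq * u c" using B[OF c, of u'] by (simp add: u'_def)
        then show ?thesis using gk[OF c qk] by (simp add: coprime_dvd_mult_right_iff)
      qed
      then show "u \<in> {u \<in> zvec rk. \<forall>i<rk. g i dvd u i}" using u Uz by blast
    next
      fix u assume u: "u \<in> {u \<in> zvec rk. \<forall>i<rk. g i dvd u i}"
      have "(\<lambda>i. if i < m then u i else 0) \<in> U" if "m \<le> rk" for m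
        using that
      proof (induction m)
        case (Suc m)
        have "sv m (u m) \<in> U" using u Suc.prems g by simp
        then have "(\<lambda>i. (if i < m then u i else 0) + sv m (u m) i) \<in> U" using Suc by (intro add) auto
        moreover have "(\<lambda>i. (if i < m then u i else 0) + sv m (u m) i) = (\<lambda>i. if i < Suc m then u i else 0)"
          by (auto simp: sv_def fun_eq_iff less_Suc_eq)
        ultimately show ?case by simp
      qed (use zero in simp)
      from this[of rk] have "(\<lambda>i. if i < rk then u i else 0) \<in> U" by blast
      moreover have "(\<lambda>i. if i < rk then u i else 0) = u" using u by (auto simp: zvec_def fun_eq_iff)
      ultimately show "u \<in> U" by simp
    qed
    moreover have "\<forall>i<rk. g i \<noteq> 0" using gr r0 by force
    moreover have "wact j (\<lambda>i. g i * u i) = (\<lambda>i. g i * wact j u i)" if j: "j < card W" and u: "u \<in> zvec rk" for j u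
    proof -
      \<comment> \<open>Only generators need checking: a simple reflection mixes coordinates with
        nonzero Cartan integer, and there \<open>g\<close> is constant by
        \<open>linked\<close>.\<close>
      have comm: "lin_part w (tau (\<lambda>i. g i * u i)) = tau (\<lambda>i. g i * v i)"
        if "w \<in> W" "u \<in> zvec rk" "v \<in> zvec rk" "lin_part w (tau u) = tau v" for w u v
        using that
      proof (induction arbitrary: u v rule: W.induct)
        case W_id
        then have "tau u = tau v" by (simp add: lin_part_def)
        then have "u = v" using W_id tau_inject by blast
        then show ?case by (simp add: lin_part_def)
      next
        case (W_rfl a)
        show ?case
        proof (cases "a \<in> inf_simple")
          case False
          then have "tau u = tau v" using W_rfl by (simp add: lin_part_rfl lrfl_tau_finite)
          then have "u = v" using W_rfl tau_inject by blast
          then show ?thesis using W_rfl False by (simp add: lin_part_rfl lrfl_tau_finite)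
        next
          case True
          then obtain l where l: "l < rk" "a = en l" using en_bij by (auto simp: bij_betw_def)
          let ?s = "\<Sum>i<rk. u i * cartan i l"
          have "tau v = tau (\<lambda>i. u i + - sv l ?s i)"
            using W_rfl(4) unfolding lin_part_rfl l(2) lrfl_tau[OF l(1)] sv_def by simp
          then have v: "v = (\<lambda>i. u i + - sv l ?s i)"
            using W_rfl(2,3) svz[OF l(1)] by (intro tau_inject zvec_add zvec_neg)
          have s: "(\<Sum>i<rk. g i * u i * cartan i l) = g l * ?s"
            unfolding sum_distrib_left
          proof (intro sum.cong HOL.refl)
            fix i assume "i \<in> {..<rk}"
            then show "g i * u i * cartan i l = g l * (u i * cartan i l)"
              using linked[OF _ l(1), of i] by (cases "cartan i l = 0") auto
          qed
          have "(\<lambda>i. g i * u i + - (if i = l then g l * ?s else 0)) = (\<lambda>i. g i * v i)"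
            by (auto simp: v sv_def algebra_simps)
          then show ?thesis unfolding lin_part_rfl l(2) lrfl_tau[OF l(1)] s by simp
        qed
      next
        case (W_comp w w')
        obtain u' where u': "u' \<in> zvec rk" "lin_part w' (tau u) = tau u'"
          using W_tau[OF W_comp(2,5)] by blast
        note c = lin_part_comp[OF W_\<Gamma>[OF W_comp(1)], of w']
        have "lin_part w (tau u') = tau v" using W_comp.prems(3) unfolding c u'(2) .
        then show ?case
          unfolding c W_comp.IH(2)[OF W_comp.prems(1) u'] by (rule W_comp.IH(1)[OF u'(1) W_comp.prems(2)])
      qed
      show ?thesis
        using wact[OF j u] comm[OF ws_W[OF j] u] by (intro wact_eq zvec_mult) auto
    qed
    ultimately show "\<exists>g. (\<forall>i<rk. g i \<noteq> 0) \<and> U = {u \<in> zvec rk. \<forall>i<rk. g i dvd u i} \<and>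
        (\<forall>j<card W. \<forall>u\<in>zvec rk. wact j (\<lambda>i. g i * u i) = (\<lambda>i. g i * wact j u i))"
      by (intro exI[of _ g] conjI) blast+
  qed
  then show ?thesis using k2 by blast
qed

end

theorem discrete_affine_reflection_group_splits:
  fixes \<Gamma> :: "('e::euclidean_space \<Rightarrow> 'e) set"
  assumes "discrete_affine_reflection_group \<Gamma>"
  shows "\<exists>n d th x act mu k. lattice_split (isometry_group\<lparr>carrier := \<Gamma>\<rparr>) n d th x act mu \<and>
    diagonal_sublattices n d act k \<and> 2 \<le> k"
proof -
  interpret discrete_reflection_group \<Gamma> using assms by unfold_locales
  \<comment> \<open>With offset zero, \<open>generic_point\<close> applies to the linear
    mirrors.\<close>
  have "countable ((\<lambda>a. (a, 0)) ` dirs)" using finite_dirs by (simp add: countable_finite)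
  then have "\<exists>q. \<forall>(a, b)\<in>(\<lambda>a. (a, 0)) ` dirs. a \<bullet> q \<noteq> b"
    by (rule generic_point) (use roots_norm in \<open>force simp: dirs_def\<close>)
  then obtain q where "\<forall>a\<in>dirs. a \<bullet> q \<noteq> 0" by auto
  then interpret based_reflection_group \<Gamma> q by unfold_locales auto
  show ?thesis using lattice_split_\<Gamma> diagonal_sublattices_\<Gamma> by blast
qed

theorem theorem1p1:
  fixes S :: "'s set" and m :: "'s \<Rightarrow> 's \<Rightarrow> enat"
    and H :: "('h, 'k) monoid_scheme"
  assumes "coxeter_matrix S m"
    and "coxeter_irreducible S m"
    and "affine_over TYPE('e::euclidean_space) (coxeter_group S m)"
    and "finitely_generated_group H"
    and "elementarily_equivalent H (coxeter_group S m)"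
  shows "H \<cong> coxeter_group S m"
proof -
  let ?W = "coxeter_group S m"
  obtain \<Gamma> :: "('e \<Rightarrow> 'e) set" where \<Gamma>: "discrete_affine_reflection_group \<Gamma>"
    and iso: "?W \<cong> isometry_group\<lparr>carrier := \<Gamma>\<rparr>"
    using assms(3) by (auto simp: affine_over_def)
  have W: "group ?W" by (simp add: coxeter_group_def group_presented_group)
  obtain n d th x act mu k where split: "lattice_split (isometry_group\<lparr>carrier := \<Gamma>\<rparr>) n d th x act mu"
    and k: "diagonal_sublattices n d act k" "2 \<le> k"
    using discrete_affine_reflection_group_splits[OF \<Gamma>] by blast
  obtain f where "f \<in> iso (isometry_group\<lparr>carrier := \<Gamma>\<rparr>) ?W"
    using group.iso_sym[OF W iso] by (auto simp: is_iso_def)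
  from lattice_split_transfer[OF split this W] show ?thesis
    using k assms(4,5) by (rule lattice_split_first_order_rigid)
qed

end
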